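(* Let $\varphi\colon\mathscr G\to\mathscr H$ be a faithful morphism (continuous functor) of locally compact groupoids. Suppose in addition that: (1) the image of $\overline\varphi\colon\mathscr G\to(\mathscr G_0\times\mathscr G_0)\times_{\mathscr H_0\times\mathscr H_0}\mathscr H$, $\overline\varphi(g)=(r(g),d(g),\varphi(g))$, is closed (equivalently, in light of faithfulness, $\overline\varphi$ is a closed map); (2) the map $\psi\colon\mathscr H\times_{\mathscr H_0}\mathscr G\to\mathscr H\times_{\mathscr H_0}\mathscr G_0$ given by $\psi(h,g)=(h\varphi(g),d(g))$ is open, where $\mathscr H\times_{\mathscr H_0}\mathscr G=\{(h,g)\mid d(h)=\varphi(r(g))\}$ and $\mathscr H\times_{\mathscr H_0}\mathscr G_0=\{(h,e)\mid d(h)=\varphi(e)\}$; (3) $\mathscr H_0\times_{\mathscr H_0}\mathscr G_0=\{(\varphi(e),e)\mid e\in\mathscr G_0\}$ is an open subset of $\mathscr H\times_{\mathscr H_0}\mathscr G_0$. Then there is a locally compact Hausdorff space $X$ and an action $(p,\theta)$ of $\mathscr H$ on $X$ such that $\varphi$ factors as $\varphi=\pi\alpha$, where $\pi\colon\mathscr H\ltimes X\to\mathscr H$ is the projection and $\alpha\colon\mathscr G\to\mathscr H\ltimes X$ is a weak equivalence. Thus $\mathscr G$ is Morita equivalent to $\mathscr H\ltimes X$.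
   Context: Groupoids have unit space $\mathscr G_0\subseteq\mathscr G$, domain map $d$ and range map $r$; $gh$ is defined iff $d(g)=r(h)$. "Compact" includes Hausdorff. A locally compact groupoid (in Paterson's sense) is a topological groupoid $\mathscr G$, not assumed Hausdorff, such that $\mathscr G_0$ is locally compact Hausdorff, there is a countable family of compact Hausdorff subsets whose interiors form a basis of the topology of $\mathscr G$, each $r^{-1}(u)$, $u\in\mathscr G_0$, is locally compact Hausdorff, and $\mathscr G$ is equipped with a left Haar system $\{\lambda^u\}_{u\in\mathscr G_0}$ (in particular $d$ and $r$ are open maps). Let $\varphi\colon\mathscr G\to\mathscr H$ be a continuous functor, and let $(\mathscr G_0\times\mathscr G_0)\times_{\mathscr H_0\times\mathscr H_0}\mathscr H=\{(e,f,h)\mid \varphi(e)=r(h),\varphi(f)=d(h)\}$, and $\overline\varphi(g)=(r(g),d(g),\varphi(g))$. $\varphi$ is faithful if $\overline\varphi$ is a topological embedding, and fully faithful if $\overline\varphi$ is a homeomorphism. $\varphi$ is essentially surjective if the map $\{(e,h)\in\mathscr G_0\times\mathscr H\mid\varphi(e)=r(h)\}\to\mathscr H_0$, $(e,h)\mapsto d(h)$, is an open surjection. A weak equivalence is a fully faithful, essentially surjective continuous functor. Locally compact groupoids $\mathscr G,\mathscr H$ are Morita equivalent if there are a locally compact groupoid $\mathscr K$ and weak equivalences $\mathscr K\to\mathscr G$, $\mathscr K\to\mathscr H$. An action $(p,\theta)$ of $\mathscr H$ on a space $X$ is a continuous map $p\colon X\to\mathscr H_0$ and a continuous map $\theta\colon\mathscr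 H\times_{\mathscr H_0}X=\{(h,x)\mid d(h)=p(x)\}\to X$, $(h,x)\mapsto hx$, with $p(x)x=x$, $p(hx)=r(h)$, and $g(hx)=(gh)x$ when defined. The semidirect product $\mathscr H\ltimes X$ is the topological groupoid with underlying space $\mathscr H\times_{\mathscr H_0}X$, unit space identified with $X$ via $x\mapsto(p(x),x)$, $d(h,x)=x$, $r(h,x)=hx$, $(g,hy)(h,y)=(gh,y)$, $(h,x)^{-1}=(h^{-1},hx)$; $\pi(h,x)=h$. It carries the left Haar system $\mu^x(B)=\lambda^{p(x)}(\pi(B))$ for Borel $B\subseteq r^{-1}(x)$. *)

theory Defs
  imports "HOL-Analysis.Analysis"
begin

section \<open>Topological groupoids\<close>

text \<open>
  The set of arrows is the underlying set \<open>topspace (gtop G)\<close>; units are particular arrows.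
  The product \<open>gmult G g h\<close> is meaningful when \<open>gdom G g = gran G h\<close>.
\<close>

record 'g tgroupoid =
  gtop :: "'g topology"
  gunits :: "'g set"
  gdom :: "'g \<Rightarrow> 'g"
  gran :: "'g \<Rightarrow> 'g"
  gmult :: "'g \<Rightarrow> 'g \<Rightarrow> 'g"
  ginv :: "'g \<Rightarrow> 'g"

abbreviation arrows :: "('g, 'z) tgroupoid_scheme \<Rightarrow> 'g set"
  where "arrows G \<equiv> topspace (gtop G)"

definition unit_top :: "('g, 'z) tgroupoid_scheme \<Rightarrow> 'g topology"
  where "unit_top G = subtopology (gtop G) (gunits G)"

definition fiber_product :: "'a topology \<Rightarrow> 'b topology \<Rightarrow> ('a \<Rightarrow> 'c) \<Rightarrow> ('b \<Rightarrow> 'c) \<Rightarrow> ('a \<times> 'b) topology"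
  where "fiber_product A B f g = subtopology (prod_topology A B) {(a, b). f a = g b}"

locale topological_groupoid =
  fixes G :: "('g, 'z) tgroupoid_scheme"
  assumes units_subset: "gunits G \<subseteq> arrows G"
    and dom_unit: "g \<in> arrows G \<Longrightarrow> gdom G g \<in> gunits G"
    and ran_unit: "g \<in> arrows G \<Longrightarrow> gran G g \<in> gunits G"
    and unit_dom: "u \<in> gunits G \<Longrightarrow> gdom G u = u"
    and unit_ran: "u \<in> gunits G \<Longrightarrow> gran G u = u"
    and mult_closed: "\<lbrakk>g \<in> arrows G; h \<in> arrows G; gdom G g = gran G h\<rbrakk> \<Longrightarrow> gmult G g h \<in> arrows G"
    and dom_mult: "\<lbrakk>g \<in> arrows G; h \<in> arrows G; gdom G g = gran G h\<rbrakk> \<Longrightarrow> gdom G (gmult G g h) = gdom G h"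
    and ran_mult: "\<lbrakk>g \<in> arrows G; h \<in> arrows G; gdom G g = gran G h\<rbrakk> \<Longrightarrow> gran G (gmult G g h) = gran G g"
    and mult_assoc: "\<lbrakk>g \<in> arrows G; h \<in> arrows G; k \<in> arrows G; gdom G g = gran G h; gdom G h = gran G k\<rbrakk>
       \<Longrightarrow> gmult G (gmult G g h) k = gmult G g (gmult G h k)"
    and mult_unit_left: "g \<in> arrows G \<Longrightarrow> gmult G (gran G g) g = g"
    and mult_unit_right: "g \<in> arrows G \<Longrightarrow> gmult G g (gdom G g) = g"
    and inv_closed: "g \<in> arrows G \<Longrightarrow> ginv G g \<in> arrows G"
    and dom_inv: "g \<in> arrows G \<Longrightarrow> gdom G (ginv G g) = gran G g"
    and ran_inv: "g \<in> arrows G \<Longrightarrow> gran G (ginv G g) = gdom G g"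
    and mult_inv_left: "g \<in> arrows G \<Longrightarrow> gmult G (ginv G g) g = gdom G g"
    and mult_inv_right: "g \<in> arrows G \<Longrightarrow> gmult G g (ginv G g) = gran G g"
    and continuous_dom: "continuous_map (gtop G) (unit_top G) (gdom G)"
    and continuous_ran: "continuous_map (gtop G) (unit_top G) (gran G)"
    and continuous_mult: "continuous_map (fiber_product (gtop G) (gtop G) (gdom G) (gran G)) (gtop G)
       (\<lambda>(g, h). gmult G g h)"
    and continuous_inv: "continuous_map (gtop G) (gtop G) (ginv G)"


section \<open>Locally compact groupoids in the sense of Paterson\<close>

definition ran_fiber :: "('g, 'z) tgroupoid_scheme \<Rightarrow> 'g \<Rightarrow> 'g topology"
  where "ran_fiber G u = subtopology (gtop G) {g. gran G g = u}"

definition regular_borel_measure :: "'a topology \<Rightarrow> 'a measure \<Rightarrow> bool"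
  where "regular_borel_measure T M \<longleftrightarrow>
    sets M = sets (sigma (topspace T) {U. openin T U}) \<and>
    (\<forall>K. compactin T K \<longrightarrow> emeasure M K < \<infinity>) \<and>
    (\<forall>B\<in>sets M. emeasure M B = (INF U\<in>{U. openin T U \<and> B \<subseteq> U}. emeasure M U)) \<and>
    (\<forall>U. openin T U \<longrightarrow> emeasure M U = (SUP K\<in>{K. compactin T K \<and> K \<subseteq> U}. emeasure M K))"

text \<open>Continuous functions with compact support on \<open>U\<close>, extended by zero off \<open>U\<close>.\<close>

definition Cc_on :: "'a topology \<Rightarrow> 'a set \<Rightarrow> ('a \<Rightarrow> complex) set"
  where "Cc_on T U = {f. continuous_map (subtopology T U) euclidean f \<and>
    (\<exists>K. compactin T K \<and> K \<subseteq> U \<and> (\<forall>x. x \<notin> K \<longrightarrow> f x = 0))}"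

text \<open>
  On a space that need not be Hausdorff, \<open>C\<^sub>c\<close> is the linear span of the functions supported on
  Hausdorff open sets; these functions need not be continuous on the whole space. As each
  \<open>Cc_on T U\<close> is closed under scalar multiplication, finite sums suffice.
\<close>

definition Cc :: "'a topology \<Rightarrow> ('a \<Rightarrow> complex) set"
  where "Cc T = {\<lambda>x. \<Sum>i<n. f i x | (n::nat) f.
    \<forall>i<n. \<exists>U. openin T U \<and> Hausdorff_space (subtopology T U) \<and> f i \<in> Cc_on T U}"

definition left_haar_system :: "('g, 'z) tgroupoid_scheme \<Rightarrow> ('g \<Rightarrow> 'g measure) \<Rightarrow> bool"
  where "left_haar_system G \<mu> \<longleftrightarrow>
    (\<forall>u\<in>gunits G. regular_borel_measure (ran_fiber G u) (\<mu> u)) \<and>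
    (\<forall>u\<in>gunits G. \<forall>U. openin (ran_fiber G u) U \<and> U \<noteq> {} \<longrightarrow> emeasure (\<mu> u) U > 0) \<and>
    (\<forall>f\<in>Cc (gtop G).
       (\<lambda>u. if u \<in> gunits G then \<integral>g. f g \<partial>\<mu> u else 0) \<in> Cc_on (gtop G) (gunits G)) \<and>
    (\<forall>f\<in>Cc (gtop G). \<forall>g\<in>arrows G.
       (\<integral>h. f (gmult G g h) \<partial>\<mu> (gdom G g)) = (\<integral>h. f h \<partial>\<mu> (gran G g)))"

record 'g lc_groupoid = "'g tgroupoid" +
  haar :: "'g \<Rightarrow> 'g measure"

locale locally_compact_groupoid = topological_groupoid G
  for G :: "('g, 'z) lc_groupoid_scheme" +
  assumes units_locally_compact: "locally_compact_space (unit_top G)"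
    and units_Hausdorff: "Hausdorff_space (unit_top G)"
    and compact_base: "\<exists>\<C>. countable \<C> \<and>
       (\<forall>C\<in>\<C>. compactin (gtop G) C \<and> Hausdorff_space (subtopology (gtop G) C)) \<and>
       openin (gtop G) = arbitrary union_of (\<lambda>U. U \<in> (\<lambda>C. gtop G interior_of C) ` \<C>)"
    and fiber_locally_compact: "u \<in> gunits G \<Longrightarrow> locally_compact_space (ran_fiber G u)"
    and fiber_Hausdorff: "u \<in> gunits G \<Longrightarrow> Hausdorff_space (ran_fiber G u)"
    and haar_system: "left_haar_system G (haar G)"


section \<open>Morphisms and Morita equivalence\<close>

definition continuous_functor ::
  "('g, 'y) tgroupoid_scheme \<Rightarrow> ('h, 'z) tgroupoid_scheme \<Rightarrow> ('g \<Rightarrow> 'h) \<Rightarrow> bool"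
  where "continuous_functor G H \<phi> \<longleftrightarrow>
    continuous_map (gtop G) (gtop H) \<phi> \<and>
    (\<forall>u\<in>gunits G. \<phi> u \<in> gunits H) \<and>
    (\<forall>g\<in>arrows G. gdom H (\<phi> g) = \<phi> (gdom G g) \<and> gran H (\<phi> g) = \<phi> (gran G g)) \<and>
    (\<forall>g\<in>arrows G. \<forall>h\<in>arrows G. gdom G g = gran G h \<longrightarrow>
       \<phi> (gmult G g h) = gmult H (\<phi> g) (\<phi> h))"

definition pullback_top ::
  "('g, 'y) tgroupoid_scheme \<Rightarrow> ('h, 'z) tgroupoid_scheme \<Rightarrow> ('g \<Rightarrow> 'h) \<Rightarrow> ('g \<times> 'g \<times> 'h) topology"
  where "pullback_top G H \<phi> =
    subtopology (prod_topology (unit_top G) (prod_topology (unit_top G) (gtop H)))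
      {(e, f, h). \<phi> e = gran H h \<and> \<phi> f = gdom H h}"

definition bar_map :: "('g, 'y) tgroupoid_scheme \<Rightarrow> ('g \<Rightarrow> 'h) \<Rightarrow> 'g \<Rightarrow> 'g \<times> 'g \<times> 'h"
  where "bar_map G \<phi> g = (gran G g, gdom G g, \<phi> g)"

definition faithful ::
  "('g, 'y) tgroupoid_scheme \<Rightarrow> ('h, 'z) tgroupoid_scheme \<Rightarrow> ('g \<Rightarrow> 'h) \<Rightarrow> bool"
  where "faithful G H \<phi> \<longleftrightarrow> embedding_map (gtop G) (pullback_top G H \<phi>) (bar_map G \<phi>)"

definition fully_faithful ::
  "('g, 'y) tgroupoid_scheme \<Rightarrow> ('h, 'z) tgroupoid_scheme \<Rightarrow> ('g \<Rightarrow> 'h) \<Rightarrow> bool"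
  where "fully_faithful G H \<phi> \<longleftrightarrow> homeomorphic_map (gtop G) (pullback_top G H \<phi>) (bar_map G \<phi>)"

definition essentially_surjective ::
  "('g, 'y) tgroupoid_scheme \<Rightarrow> ('h, 'z) tgroupoid_scheme \<Rightarrow> ('g \<Rightarrow> 'h) \<Rightarrow> bool"
  where "essentially_surjective G H \<phi> \<longleftrightarrow>
    (let E = fiber_product (unit_top G) (gtop H) \<phi> (gran H)
     in open_map E (unit_top H) (\<lambda>(e, h). gdom H h) \<and>
        (\<lambda>(e, h). gdom H h) ` topspace E = gunits H)"

definition weak_equivalence ::
  "('g, 'y) tgroupoid_scheme \<Rightarrow> ('h, 'z) tgroupoid_scheme \<Rightarrow> ('g \<Rightarrow> 'h) \<Rightarrow> bool"
  where "weak_equivalence G H \<phi> \<longleftrightarrow>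
    continuous_functor G H \<phi> \<and> fully_faithful G H \<phi> \<and> essentially_surjective G H \<phi>"

text \<open>
  As one cannot quantify over types inside a formula, the type in which the arrows of the linking
  groupoid live is a parameter.
\<close>

definition morita_equivalent :: "'k itself \<Rightarrow> 'g lc_groupoid \<Rightarrow> 'h lc_groupoid \<Rightarrow> bool"
  where "morita_equivalent _ G H \<longleftrightarrow>
    locally_compact_groupoid G \<and> locally_compact_groupoid H \<and>
    (\<exists>(K :: 'k lc_groupoid) \<alpha> \<beta>. locally_compact_groupoid K \<and>
       weak_equivalence K G \<alpha> \<and> weak_equivalence K H \<beta>)"


section \<open>Actions and semidirect products\<close>

locale groupoid_action =
  fixes H :: "('h, 'z) tgroupoid_scheme"
    and X :: "'x topology"
    and p :: "'x \<Rightarrow> 'h"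
    and \<theta> :: "'h \<Rightarrow> 'x \<Rightarrow> 'x"
  assumes continuous_anchor: "continuous_map X (unit_top H) p"
    and continuous_act: "continuous_map (fiber_product (gtop H) X (gdom H) p) X (\<lambda>(h, x). \<theta> h x)"
    and act_unit: "x \<in> topspace X \<Longrightarrow> \<theta> (p x) x = x"
    and anchor_act: "\<lbrakk>h \<in> arrows H; x \<in> topspace X; gdom H h = p x\<rbrakk> \<Longrightarrow> p (\<theta> h x) = gran H h"
    and act_mult: "\<lbrakk>g \<in> arrows H; h \<in> arrows H; x \<in> topspace X; gdom H g = gran H h; gdom H h = p x\<rbrakk>
       \<Longrightarrow> \<theta> g (\<theta> h x) = \<theta> (gmult H g h) x"

text \<open>
  A point \<open>x\<close> of \<open>X\<close> is identified with the unit \<open>(p x, x)\<close>. The measure attached to this unit is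
  \<open>B \<mapsto> \<lambda>\<^bsup>p x\<^esup>(\<pi>(B))\<close>, with \<open>\<pi> = fst\<close>, on the Borel sets of its range fiber.
\<close>

definition semidirect ::
  "('h, 'z) lc_groupoid_scheme \<Rightarrow> 'x topology \<Rightarrow> ('x \<Rightarrow> 'h) \<Rightarrow> ('h \<Rightarrow> 'x \<Rightarrow> 'x) \<Rightarrow> ('h \<times> 'x) lc_groupoid"
  where "semidirect H X p \<theta> =
    (let T = fiber_product (gtop H) X (gdom H) p;
         rg = (\<lambda>(h, x). (p (\<theta> h x), \<theta> h x))
     in \<lparr> gtop = T,
          gunits = (\<lambda>x. (p x, x)) ` topspace X,
          gdom = (\<lambda>(h, x). (p x, x)),
          gran = rg,
          gmult = (\<lambda>(g, y) (h, x). (gmult H g h, x)),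
          ginv = (\<lambda>(h, x). (ginv H h, \<theta> h x)),
          haar = (\<lambda>(u, x). let F = subtopology T {a. rg a = (u, x)}
                    in measure_of (topspace F) {U. openin F U}
                         (\<lambda>B. emeasure (haar H (p x)) (fst ` B))) \<rparr>)"

end

(* The space X is the quotient of {(h,e) | d(h) = phi(e)} by (h phi(g), d(g)) ~ (h, r(g)). By (2) the
   quotient map is open, by (1) the relation is closed, so X is locally compact Hausdorff; H acts by
   left multiplication, and alpha(g) = (phi(g), [phi(d(g)), d(g)]).

   That the semidirect product carries a Haar system is not formal, since H need not be Hausdorff:
   a partition of unity reduces to functions f supported over a Hausdorff open subset V of H.
   Tietze extends the slice of f at a point y0 to a function b on V, compactness makes b uniformly
   close to the slices of f at nearby points y, and the integral of b varies continuously because H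
   has a Haar system. The Morita equivalence is given by the identity of G and alpha; the identity is a
   weak equivalence because a left Haar system forces the domain map to be open. *)

theory Submission
  imports Defs
begin

section \<open>Locally compact spaces that need not be Hausdorff\<close>

text \<open>In a space that is not Hausdorff, compact sets need not be closed, and a member of
  \<open>Cc\<close> is only a sum of functions each continuous on some Hausdorff open set. Urysohn
  and Tietze are therefore used inside such open sets only, and every extension by zero needs an
  argument. The countable compact family is split into second countability and a neighbourhood base
  because the two conditions are easier to carry separately to products and closed subsets.

  Closedness of the relation comes from a reformulation: (h,e) and (h',e') are equivalent iff r(h) =
  r(h') and (e, e', h^-1 h') lies in the image of the map of hypothesis (1). Faithfulness supplies
  the continuous inverse on that image, from which the inverse of \<open>bar_map G \<alpha>\<close>
  is built by forgetting x.

  Openness of the quotient map q is used repeatedly: for the topology of X, for continuity of the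
  action (products of quotient maps may fail to be quotient maps, products of open maps are open),
  and for essential surjectivity, where (h,e) -> (e, (h^-1, q(h,e))) turns the relevant domain map
  into q.\<close>

definition locally_compact_Hausdorff_base :: "'a topology \<Rightarrow> bool"
  where "locally_compact_Hausdorff_base T \<longleftrightarrow>
    neighbourhood_base_of (\<lambda>K. compactin T K \<and> Hausdorff_space (subtopology T K)) T"

lemma neighbourhood_base_ofD:
  assumes "neighbourhood_base_of P X" "openin X W" "x \<in> W"
  shows "\<exists>U V. openin X U \<and> P V \<and> x \<in> U \<and> U \<subseteq> V \<and> V \<subseteq> W"
  by (rule assms(1)[unfolded neighbourhood_base_of, rule_format]) (simp add: assms)

lemma locally_compact_Hausdorff_baseE:
  assumes "locally_compact_Hausdorff_base T" "openin T W" "x \<in> W"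
  obtains U K where "openin T U" "compactin T K" "Hausdorff_space (subtopology T K)"
    "x \<in> U" "U \<subseteq> K" "K \<subseteq> W"
  using neighbourhood_base_ofD[OF assms(1)[unfolded locally_compact_Hausdorff_base_def] assms(2,3)]
  by blast

lemma Hausdorff_subtopology_mono:
  assumes "Hausdorff_space (subtopology T K)" "U \<subseteq> K"
  shows "Hausdorff_space (subtopology T U)"
  using Hausdorff_space_subtopology[OF assms(1), of U] assms(2)
  by (simp add: subtopology_subtopology Int_absorb1)

lemma locally_compact_Hausdorff_base_imp_open:
  assumes "locally_compact_Hausdorff_base T" "openin T W" "x \<in> W"
  obtains U where "openin T U" "Hausdorff_space (subtopology T U)" "x \<in> U" "U \<subseteq> W"
  using locally_compact_Hausdorff_baseE[OF assms] Hausdorff_subtopology_mono by (metis subset_trans)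

text \<open>Left to right, a compact Hausdorff set is regular, so points of its interior have
  arbitrarily small compact neighbourhoods. Right to left, one compact Hausdorff set is chosen
  between each pair of members of a countable base that admits one.\<close>

lemma countable_compact_base_iff:
  "(\<exists>\<C>. countable \<C> \<and> (\<forall>C\<in>\<C>. compactin T C \<and> Hausdorff_space (subtopology T C)) \<and>
       openin T = arbitrary union_of (\<lambda>U. U \<in> (\<lambda>C. T interior_of C) ` \<C>)) \<longleftrightarrow>
   second_countable T \<and> locally_compact_Hausdorff_base T" (is "?L \<longleftrightarrow> ?R")
proof
  assume ?L
  then obtain \<C> where \<C>: "countable \<C>"
    and comp: "\<And>C. C \<in> \<C> \<Longrightarrow> compactin T C \<and> Hausdorff_space (subtopology T C)"
    and base: "openin T = arbitrary union_of (\<lambda>U. U \<in> (\<lambda>C. T interior_of C) ` \<C>)"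
    by blast
  have "second_countable T"
    unfolding second_countable using base \<C> by (meson countable_image)
  moreover have "locally_compact_Hausdorff_base T"
    unfolding locally_compact_Hausdorff_base_def neighbourhood_base_of
  proof clarify
    fix W x assume W: "openin T W" "x \<in> W"
    then obtain C where C: "C \<in> \<C>" "x \<in> T interior_of C" "T interior_of C \<subseteq> W"
      using base[THEN openin_topology_base_unique[THEN iffD1]] by (metis (no_types, lifting) imageE)
    note cC = comp[OF C(1)]
    have "locally_compact_space (subtopology T C)"
      using cC by (simp add: compact_imp_locally_compact_space compact_space_subtopology)
    then have "neighbourhood_base_of (compactin (subtopology T C)) (subtopology T C)"
      using cC locally_compact_space_neighbourhood_base by blast
    moreover have "openin (subtopology T C) (T interior_of C)"
      by (simp add: interior_of_subset openin_subset_topspace_eq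
          openin_interior_of subset_openin_subtopology)
    ultimately obtain U V where UV: "openin (subtopology T C) U" "compactin (subtopology T C) V"
        "x \<in> U" "U \<subseteq> V" "V \<subseteq> T interior_of C"
      using C(2) neighbourhood_base_ofD by metis
    obtain U' where U': "openin T U'" "U = U' \<inter> C"
      using UV(1) by (auto simp: openin_subtopology)
    \<comment> \<open>\<open>U\<close> is so far open only relative to \<open>C\<close>. Lying
      inside the interior of \<open>C\<close>, it is open in the whole space.\<close>
    have "U = U' \<inter> T interior_of C"
      using U' UV interior_of_subset[of T C] by blast
    then have "openin T U"
      using U'(1) by (simp add: openin_Int)
    moreover have "compactin T V" "V \<subseteq> C"
      using UV(2) by (auto simp: compactin_subtopology)
    moreover have "Hausdorff_space (subtopology T V)"
      using cC \<open>V \<subseteq> C\<close> Hausdorff_subtopology_mono by blast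
    ultimately show "\<exists>U V. openin T U \<and> (compactin T V \<and> Hausdorff_space (subtopology T V)) \<and>
        x \<in> U \<and> U \<subseteq> V \<and> V \<subseteq> W"
      using UV C by blast
  qed
  ultimately show ?R ..
next
  assume R: ?R
  then obtain \<B> where \<B>: "countable \<B>" "\<And>V. V \<in> \<B> \<Longrightarrow> openin T V"
    and base: "\<And>U x. openin T U \<Longrightarrow> x \<in> U \<Longrightarrow> \<exists>V\<in>\<B>. x \<in> V \<and> V \<subseteq> U"
    by (auto simp: second_countable_def)
  \<comment> \<open>Pairs of base sets keep the choices countable: the inner set \<open>B\<close>
    forces a point into the interior of \<open>K\<close>, the outer set \<open>B'\<close> keeps
    \<open>K\<close> small.\<close>
  define P where "P = (\<lambda>(B, B') K. compactin T K \<and> Hausdorff_space (subtopology T K) \<and> B \<subseteq> K \<and> K \<subseteq> B')"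
  define \<C> where "\<C> = (\<lambda>q. SOME K. P q K) ` {q \<in> \<B> \<times> \<B>. \<exists>K. P q K}"
  have sel: "P q (SOME K. P q K)" if "\<exists>K. P q K" for q
    using that by (rule someI_ex)
  have "countable \<C>"
    unfolding \<C>_def using \<B>(1) by (intro countable_image countable_subset[OF _ countable_SIGMA]) auto
  moreover have "\<forall>C\<in>\<C>. compactin T C \<and> Hausdorff_space (subtopology T C)"
  proof
    fix C assume "C \<in> \<C>"
    then obtain q where "\<exists>K. P q K" "C = (SOME K. P q K)" unfolding \<C>_def by blast
    then have "P q C" using sel by simp
    then show "compactin T C \<and> Hausdorff_space (subtopology T C)"
      by (simp add: P_def split: prod.splits)
  qed
  moreover have "openin T = arbitrary union_of (\<lambda>U. U \<in> (\<lambda>C. T interior_of C) ` \<C>)"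
    unfolding openin_topology_base_unique
  proof (intro conjI allI impI, goal_cases)
    case (1 V) then show ?case by auto
  next
    case (2 W x)
    then have W: "openin T W" "x \<in> W" by auto
    obtain B' where B': "B' \<in> \<B>" "x \<in> B'" "B' \<subseteq> W" using base[OF W] by blast
    obtain U K where UK: "openin T U" "compactin T K" "Hausdorff_space (subtopology T K)"
      "x \<in> U" "U \<subseteq> K" "K \<subseteq> B'"
      using locally_compact_Hausdorff_baseE R \<B>(2) B' by metis
    obtain B where B: "B \<in> \<B>" "x \<in> B" "B \<subseteq> U" using base UK by metis
    have ex: "\<exists>K. P (B, B') K" using UK B by (auto simp: P_def)
    define K' where "K' = (SOME K. P (B, B') K)"
    have "K' \<in> \<C>" using ex B B' by (auto simp: \<C>_def K'_def)
    moreover have "B \<subseteq> K'" "K' \<subseteq> B'" using sel[OF ex] by (auto simp: P_def K'_def)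
    then have "x \<in> T interior_of K'"
      using B(1,2) \<B>(2) interior_of_maximal[of B K' T] by blast
    moreover have "T interior_of K' \<subseteq> W"
      using \<open>K' \<subseteq> B'\<close> B'(3) interior_of_subset[of T K'] by blast
    ultimately show ?case by blast
  qed
  ultimately show ?L by blast
qed

lemma openin_prod_topologyE:
  assumes "openin (prod_topology A B) W" "(x, y) \<in> W"
  obtains U V where "openin A U" "openin B V" "x \<in> U" "y \<in> V" "U \<times> V \<subseteq> W"
  using assms(1)[unfolded openin_prod_topology_alt, rule_format, OF assms(2)] by blast

lemma locally_compact_Hausdorff_base_prod:
  assumes "locally_compact_Hausdorff_base A" "locally_compact_Hausdorff_base B"
  shows "locally_compact_Hausdorff_base (prod_topology A B)"
  unfolding locally_compact_Hausdorff_base_def neighbourhood_base_of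
proof clarify
  fix W x y assume W: "openin (prod_topology A B) W" "(x, y) \<in> W"
  then obtain U V where UV: "openin A U" "openin B V" "x \<in> U" "y \<in> V" "U \<times> V \<subseteq> W"
    by (rule openin_prod_topologyE)
  obtain U' K where K: "openin A U'" "compactin A K" "Hausdorff_space (subtopology A K)"
    "x \<in> U'" "U' \<subseteq> K" "K \<subseteq> U"
    using locally_compact_Hausdorff_baseE[OF assms(1) UV(1,3)] .
  obtain V' L where L: "openin B V'" "compactin B L" "Hausdorff_space (subtopology B L)"
    "y \<in> V'" "V' \<subseteq> L" "L \<subseteq> V"
    using locally_compact_Hausdorff_baseE[OF assms(2) UV(2,4)] .
  have "openin (prod_topology A B) (U' \<times> V')" "compactin (prod_topology A B) (K \<times> L)"
    using K L by (auto simp: openin_prod_Times_iff compactin_Times)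
  moreover have "Hausdorff_space (subtopology (prod_topology A B) (K \<times> L))"
    using K L by (simp add: subtopology_Times Hausdorff_space_prod_topology)
  ultimately show "\<exists>U V. openin (prod_topology A B) U \<and>
        (compactin (prod_topology A B) V \<and> Hausdorff_space (subtopology (prod_topology A B) V)) \<and>
        (x, y) \<in> U \<and> U \<subseteq> V \<and> V \<subseteq> W"
    using K(4-6) L(4-6) UV(5) by (intro exI[of _ "U' \<times> V'"] exI[of _ "K \<times> L"] conjI) auto
qed

text \<open>A compact set meets a closed set in a compact set whether or not the space is Hausdorff,
  so the given neighbourhoods can simply be cut down.\<close>

lemma locally_compact_Hausdorff_base_closed_subset:
  assumes "locally_compact_Hausdorff_base T" "closedin T S"
  shows "locally_compact_Hausdorff_base (subtopology T S)"
  unfolding locally_compact_Hausdorff_base_def neighbourhood_base_of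
proof clarify
  fix W x assume "openin (subtopology T S) W" "x \<in> W"
  then obtain W' where W': "openin T W'" "W = W' \<inter> S" "x \<in> W'" "x \<in> S"
    by (auto simp: openin_subtopology)
  obtain U K where K: "openin T U" "compactin T K" "Hausdorff_space (subtopology T K)"
    "x \<in> U" "U \<subseteq> K" "K \<subseteq> W'"
    using locally_compact_Hausdorff_baseE[OF assms(1) W'(1,3)] .
  have "compactin (subtopology T S) (K \<inter> S)"
    using K assms by (auto simp: compactin_subtopology compact_Int_closedin)
  moreover have "Hausdorff_space (subtopology (subtopology T S) (K \<inter> S))"
    using K(3) Hausdorff_subtopology_mono[of T K "S \<inter> (K \<inter> S)"]
    by (simp add: subtopology_subtopology le_infI2)
  moreover have "openin (subtopology T S) (U \<inter> S)"
    using K by (simp add: openin_subtopology_Int)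
  ultimately show "\<exists>U V. openin (subtopology T S) U \<and>
        (compactin (subtopology T S) V \<and> Hausdorff_space (subtopology (subtopology T S) V)) \<and>
        x \<in> U \<and> U \<subseteq> V \<and> V \<subseteq> W"
    using K(4-6) W'(2-4) by (intro exI[of _ "U \<inter> S"] exI[of _ "K \<inter> S"] conjI) auto
qed

lemma locally_compact_Hausdorff_imp_base:
  assumes "locally_compact_space X" "Hausdorff_space X"
  shows "locally_compact_Hausdorff_base X"
proof -
  have "neighbourhood_base_of (compactin X) X"
    using assms locally_compact_space_neighbourhood_base by blast
  then show ?thesis
    unfolding locally_compact_Hausdorff_base_def
    by (rule neighbourhood_base_of_mono) (use assms Hausdorff_space_subtopology in blast)
qed

lemma locally_compact_Hausdorff_base_imp_locally_compact:
  "locally_compact_Hausdorff_base X \<Longrightarrow> locally_compact_space X"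
  unfolding locally_compact_Hausdorff_base_def
  by (rule neighbourhood_base_imp_locally_compact_space, erule neighbourhood_base_of_mono) simp

text \<open>Having one compact neighbourhood at each point is not inherited by open subsets of a
  non-Hausdorff space; having arbitrarily small ones is.\<close>

lemma locally_compact_Hausdorff_base_open_subset:
  assumes "locally_compact_Hausdorff_base T" "openin T U"
  shows "locally_compact_space (subtopology T U)"
proof (rule neighbourhood_base_imp_locally_compact_space)
  show "neighbourhood_base_of (compactin (subtopology T U)) (subtopology T U)"
    unfolding neighbourhood_base_of
  proof clarify
    fix W x assume "openin (subtopology T U) W" "x \<in> W"
    then have W: "openin T W" "W \<subseteq> U" "x \<in> W" using assms(2) openin_open_subtopology by auto
    obtain V K where "openin T V" "compactin T K" "x \<in> V" "V \<subseteq> K" "K \<subseteq> W"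
      using locally_compact_Hausdorff_baseE[OF assms(1) W(1,3)] .
    then show "\<exists>V K. openin (subtopology T U) V \<and> compactin (subtopology T U) K \<and> x \<in> V \<and> V \<subseteq> K \<and> K \<subseteq> W"
      using W assms(2) by (intro exI[of _ V] exI[of _ K] conjI)
        (auto simp: openin_open_subtopology compactin_subtopology)
  qed
qed

lemma second_countable_prod_topology:
  assumes "second_countable A" "second_countable B"
  shows "second_countable (prod_topology A B)"
proof -
  obtain \<A> where \<A>: "countable \<A>" "\<forall>V\<in>\<A>. openin A V" "\<forall>U x. openin A U \<and> x \<in> U \<longrightarrow> (\<exists>V\<in>\<A>. x \<in> V \<and> V \<subseteq> U)"
    using assms(1) by (auto simp: second_countable_def)
  obtain \<B> where \<B>: "countable \<B>" "\<forall>V\<in>\<B>. openin B V" "\<forall>U x. openin B U \<and> x \<in> U \<longrightarrow> (\<exists>V\<in>\<B>. x \<in> V \<and> V \<subseteq> U)"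
    using assms(2) by (auto simp: second_countable_def)
  show ?thesis
    unfolding second_countable_def
  proof (intro exI[of _ "(\<lambda>(U, V). U \<times> V) ` (\<A> \<times> \<B>)"] conjI allI impI)
    show "countable ((\<lambda>(U, V). U \<times> V) ` (\<A> \<times> \<B>))" using \<A> \<B> by auto
    show "\<forall>V\<in>(\<lambda>(U, V). U \<times> V) ` (\<A> \<times> \<B>). openin (prod_topology A B) V"
      using \<A> \<B> by (auto simp: openin_prod_Times_iff)
    fix W x assume W: "openin (prod_topology A B) W \<and> x \<in> W"
    obtain a b where x: "x = (a, b)" by force
    obtain U V where UV: "openin A U" "openin B V" "a \<in> U" "b \<in> V" "U \<times> V \<subseteq> W"
      by (rule openin_prod_topologyE[of A B W a b]) (use W x in auto)
    obtain U' where "U' \<in> \<A>" "a \<in> U'" "U' \<subseteq> U" using \<A>(3) UV(1,3) by meson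
    moreover obtain V' where "V' \<in> \<B>" "b \<in> V'" "V' \<subseteq> V" using \<B>(3) UV(2,4) by meson
    ultimately show "\<exists>V\<in>(\<lambda>(U, V). U \<times> V) ` (\<A> \<times> \<B>). x \<in> V \<and> V \<subseteq> W"
      using UV(5) x by (intro bexI[of _ "U' \<times> V'"]) auto
  qed
qed

lemma continuous_map_locally:
  assumes "\<And>x. x \<in> topspace A \<Longrightarrow> \<exists>N. openin A N \<and> x \<in> N \<and> continuous_map (subtopology A N) B f"
  shows "continuous_map A B f"
proof -
  define I where "I = {N. openin A N \<and> continuous_map (subtopology A N) B f}"
  show ?thesis
    by (rule pasting_lemma[of I A "\<lambda>N. N" B "\<lambda>_. f"]) (use assms in \<open>auto simp: I_def\<close>)
qed

lemma continuous_map_combine: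
  fixes f :: "'a \<Rightarrow> 'b::topological_space" and g :: "'a \<Rightarrow> 'c::topological_space"
  assumes "continuous_on UNIV (\<lambda>p. h (fst p) (snd p))"
    and "continuous_map X euclidean f" "continuous_map X euclidean g"
  shows "continuous_map X euclidean (\<lambda>x. h (f x) (g x))"
proof -
  have "continuous_map X (euclidean :: ('b \<times> 'c) topology) (\<lambda>x. (f x, g x))"
    using assms(2,3) by (simp flip: prod_topology_euclidean add: continuous_map_paired)
  then show ?thesis
    using continuous_map_compose[of X euclidean "\<lambda>x. (f x, g x)" euclidean "\<lambda>p. h (fst p) (snd p)"] assms(1)
    by (simp add: o_def)
qed

lemma continuous_map_mult':
  fixes f g :: "'a \<Rightarrow> 'b::real_normed_algebra"
  shows "continuous_map X euclidean f \<Longrightarrow> continuous_map X euclidean g \<Longrightarrow>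
    continuous_map X euclidean (\<lambda>x. f x * g x)"
  by (rule continuous_map_combine[where h = "(*)"]) (auto intro!: continuous_intros)

lemma continuous_map_of_real:
  "continuous_map X euclideanreal f \<Longrightarrow> continuous_map X euclidean (\<lambda>x. complex_of_real (f x))"
  using continuous_map_compose[of X euclidean f euclidean complex_of_real]
  by (simp add: o_def continuous_on_of_real)

section \<open>Cutoff functions and Tietze extension on locally compact Hausdorff spaces\<close>

lemma compactin_finite_subcover:
  assumes "compactin Y K" "\<And>x. x \<in> K \<Longrightarrow> openin Y (N x)" "\<And>x. x \<in> K \<Longrightarrow> x \<in> N x"
  obtains D where "finite D" "D \<subseteq> K" "K \<subseteq> (\<Union>x\<in>D. N x)"
proof -
  have "\<exists>\<F>. finite \<F> \<and> \<F> \<subseteq> N ` K \<and> K \<subseteq> \<Union>\<F>"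
    using assms by (intro compactinD[of Y]) auto
  then obtain \<F> where "finite \<F>" "\<F> \<subseteq> N ` K" "K \<subseteq> \<Union>\<F>" by blast
  then show thesis using that finite_subset_image by metis
qed

text \<open>Finitely many open sets with compact hulls in \<open>W\<close> cover \<open>K\<close>,
  which puts an open set \<open>V\<close> between \<open>K\<close> and a compact \<open>L\<close>.
  Complete regularity then separates \<open>K\<close> from the complement of
  \<open>V\<close>.\<close>

lemma compact_cutoff:
  assumes Y: "locally_compact_space Y" "Hausdorff_space Y" and K: "compactin Y K"
    and W: "openin Y W" "K \<subseteq> W"
  obtains \<eta> :: "'a \<Rightarrow> real" and L where "continuous_map Y euclideanreal \<eta>" "compactin Y L" "L \<subseteq> W"
    "\<And>x. x \<in> topspace Y \<Longrightarrow> 0 \<le> \<eta> x \<and> \<eta> x \<le> 1" "\<And>x. x \<in> K \<Longrightarrow> \<eta> x = 1"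
    "\<And>x. x \<in> topspace Y - L \<Longrightarrow> \<eta> x = 0"
proof -
  have nb: "\<exists>O' L. openin Y O' \<and> compactin Y L \<and> x \<in> O' \<and> O' \<subseteq> L \<and> L \<subseteq> W" if "x \<in> K" for x
    using neighbourhood_base_ofD[of "compactin Y" Y W x] locally_compact_space_neighbourhood_base[of Y]
      Y W that by blast
  then obtain O' L' where OL: "\<And>x. x \<in> K \<Longrightarrow> openin Y (O' x) \<and> compactin Y (L' x) \<and> x \<in> O' x \<and> O' x \<subseteq> L' x \<and> L' x \<subseteq> W"
    by metis
  obtain D where D: "finite D" "D \<subseteq> K" "K \<subseteq> (\<Union>x\<in>D. O' x)"
    using compactin_finite_subcover[OF K, of O'] OL by metis
  define V where "V = \<Union>(O' ` D)"
  define L where "L = \<Union>(L' ` D)"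
  have V: "openin Y V" "K \<subseteq> V" "V \<subseteq> L" "L \<subseteq> W" using OL D by (auto simp: V_def L_def)
  have L: "compactin Y L" unfolding L_def using D OL by (intro compactin_Union) auto
  have "completely_regular_space Y"
    using Y locally_compact_regular_imp_completely_regular_space by blast
  moreover have "closedin Y (topspace Y - V)" using V by auto
  moreover have "disjnt K (topspace Y - V)" using V by (auto simp: disjnt_def)
  ultimately obtain \<eta> where \<eta>: "continuous_map Y (top_of_set {0..1::real}) \<eta>"
    "\<eta> ` (topspace Y - V) \<subseteq> {0}" "\<eta> ` K \<subseteq> {1}"
    using Urysohn_completely_regular_compact_closed[of 0 1 Y K "topspace Y - V"] K by auto
  show thesis
  proof
    show "continuous_map Y euclideanreal \<eta>" using \<eta> continuous_map_into_fulltopology by blast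
    show "0 \<le> \<eta> x \<and> \<eta> x \<le> 1" if "x \<in> topspace Y" for x
      using \<eta>(1) that by (auto simp: continuous_map_in_subtopology Pi_iff)
  qed (use L V \<eta> in \<open>auto simp: image_subset_iff\<close>)
qed

text \<open>Tietze extends the real and imaginary parts, and a cutoff equal to 1 on \<open>K\<close>
  restores compact support. The cutoff does not disturb the values on \<open>E\<close>, because
  \<open>a\<close> already vanishes on \<open>E\<close> off \<open>K\<close>.\<close>

lemma compact_support_extension:
  fixes a :: "'a \<Rightarrow> complex"
  assumes Y: "locally_compact_space Y" "Hausdorff_space Y" and E: "closedin Y E"
    and a: "continuous_map (subtopology Y E) euclidean a"
    and K: "compactin Y K" "K \<subseteq> E" "\<And>x. x \<in> E - K \<Longrightarrow> a x = 0"
  obtains b L where "continuous_map Y euclidean b" "compactin Y L" "\<And>x. x \<notin> L \<Longrightarrow> b x = 0"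
    "\<And>x. x \<in> E \<Longrightarrow> b x = a x"
proof -
  obtain \<eta> L where \<eta>: "continuous_map Y euclideanreal \<eta>" "compactin Y L"
    "\<And>x. x \<in> K \<Longrightarrow> \<eta> x = 1" "\<And>x. x \<in> topspace Y - L \<Longrightarrow> \<eta> x = 0"
    using compact_cutoff[OF Y K(1) openin_topspace compactin_subset_topspace[OF K(1)]] by metis
  have cr: "completely_regular_space Y"
    using Y locally_compact_regular_imp_completely_regular_space by blast
  \<comment> \<open>The form of Tietze's theorem used here extends from compact subsets of a
    completely regular space; \<open>E\<close> itself is merely closed, hence the restriction to
    \<open>L\<close>.\<close>
  have S: "compactin Y (L \<inter> E)" using \<eta> E compact_Int_closedin by blast
  have aS: "continuous_map (subtopology Y (L \<inter> E)) euclidean a"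
    using a continuous_map_from_subtopology_mono by blast
  have "continuous_map (subtopology Y (L \<inter> E)) euclideanreal (\<lambda>x. Re (a x))"
       "continuous_map (subtopology Y (L \<inter> E)) euclideanreal (\<lambda>x. Im (a x))"
    using continuous_map_compose[OF aS, of euclidean Re] continuous_map_compose[OF aS, of euclidean Im]
    by (auto simp: o_def continuous_intros)
  then obtain u v where u: "continuous_map Y euclideanreal u" "\<And>x. x \<in> L \<inter> E \<Longrightarrow> u x = Re (a x)"
    and v: "continuous_map Y euclideanreal v" "\<And>x. x \<in> L \<inter> E \<Longrightarrow> v x = Im (a x)"
    using Tietze_extension_completely_regular[OF cr S is_interval_univ]
    by (metis UNIV_not_empty subset_UNIV)
  \<comment> \<open>The value 0 off the carrier is needed because vanishing outside \<open>L\<close>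
    is asserted for all elements of the type.\<close>
  define b where "b = (\<lambda>x. if x \<in> topspace Y then complex_of_real (\<eta> x) * (complex_of_real (u x) + \<i> * complex_of_real (v x)) else 0)"
  show thesis
  proof
    have "continuous_map Y euclidean (\<lambda>x. complex_of_real (\<eta> x) * (complex_of_real (u x) + \<i> * complex_of_real (v x)))"
      using \<eta>(1) u(1) v(1) by (intro continuous_map_mult' continuous_map_add continuous_map_of_real) auto
    then show "continuous_map Y euclidean b"
      by (rule continuous_map_eq) (simp add: b_def)
    show "compactin Y L" by fact
    show "b x = 0" if "x \<notin> L" for x using that \<eta> by (auto simp: b_def)
    show "b x = a x" if x: "x \<in> E" for x
    proof -
      have xY: "x \<in> topspace Y" using x E closedin_subset by blast
      show ?thesis
      proof (cases "x \<in> L")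
        case True
        then have "b x = complex_of_real (\<eta> x) * a x"
          using xY x u v by (simp add: b_def complex_eq[symmetric])
        then show ?thesis using \<eta>(3)[of x] K(3)[of x] x by (cases "x \<in> K") auto
      next
        case False
        then have "x \<notin> K" using \<eta>(3,4) xY by force
        then show ?thesis using False xY x K \<eta> by (auto simp: b_def)
      qed
    qed
  qed
qed

section \<open>Compactly supported functions and partitions of unity\<close>

lemma Cc_on_zero: "(\<lambda>_. 0) \<in> Cc_on T U"
  by (auto simp: Cc_on_def intro: exI[of _ "{}"])

lemma Cc_on_add:
  assumes "f \<in> Cc_on T U" "g \<in> Cc_on T U"
  shows "(\<lambda>x. f x + g x) \<in> Cc_on T U"
proof -
  obtain K where "compactin T K" "K \<subseteq> U" "\<forall>x. x \<notin> K \<longrightarrow> f x = 0"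
    using assms(1) unfolding Cc_on_def by blast
  moreover obtain L where "compactin T L" "L \<subseteq> U" "\<forall>x. x \<notin> L \<longrightarrow> g x = 0"
    using assms(2) unfolding Cc_on_def by blast
  ultimately have "\<exists>K. compactin T K \<and> K \<subseteq> U \<and> (\<forall>x. x \<notin> K \<longrightarrow> f x + g x = 0)"
    by (intro exI[of _ "K \<union> L"]) (auto simp: compactin_Un)
  then show ?thesis
    using assms unfolding Cc_on_def by (auto intro: continuous_map_add)
qed

text \<open>In the Hausdorff set \<open>W\<close> the compact support is closed. So \<open>W\<close>
  is covered by the open set \<open>U\<close>, where \<open>f\<close> is continuous, and the open
  complement of the support, where it is 0.\<close>

lemma Cc_on_mono:
  assumes f: "f \<in> Cc_on T U" and U: "openin T U" "U \<subseteq> W"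
    and W: "W \<subseteq> topspace T" "Hausdorff_space (subtopology T W)"
  shows "f \<in> Cc_on T W"
proof -
  obtain K where K: "compactin T K" "K \<subseteq> U" "\<forall>x. x \<notin> K \<longrightarrow> f x = 0"
    and cf: "continuous_map (subtopology T U) euclidean f"
    using f unfolding Cc_on_def by blast
  have clK: "closedin (subtopology T W) K"
    using K U W by (intro compactin_imp_closedin) (auto simp: compactin_subtopology)
  have "continuous_map (subtopology T W) euclidean f"
  proof (rule continuous_map_locally)
    fix x assume x: "x \<in> topspace (subtopology T W)"
    show "\<exists>N. openin (subtopology T W) N \<and> x \<in> N \<and>
        continuous_map (subtopology (subtopology T W) N) euclidean f"
    proof (cases "x \<in> U")
      case True
      have "openin (subtopology T W) U" using U subset_openin_subtopology by blast
      moreover have "continuous_map (subtopology (subtopology T W) U) euclidean f"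
        using cf U by (simp add: subtopology_subtopology Int_absorb1)
      ultimately show ?thesis using True by blast
    next
      case False
      let ?N = "topspace (subtopology T W) - K"
      have "openin (subtopology T W) ?N" using clK by blast
      moreover have "continuous_map (subtopology (subtopology T W) ?N) euclidean f"
        by (rule continuous_map_eq[of _ _ "\<lambda>_. 0"]) (use K in auto)
      ultimately show ?thesis using x False K by blast
    qed
  qed
  then show ?thesis using K U unfolding Cc_on_def by blast
qed

text \<open>One term of a partition of unity: \<open>h\<close> will be a quotient whose denominator
  is nonzero only on a neighbourhood \<open>D\<close> of the support \<open>K\<close>. Extension by
  zero is continuous because \<open>K\<close> is closed in the Hausdorff set \<open>U\<close>, and
  the support shrinks to \<open>K \<inter> L\<close>.\<close>

lemma Cc_on_mult_cutoff:
  assumes f: "f \<in> Cc_on T U" and U: "openin T U" "Hausdorff_space (subtopology T U)"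
    and K: "compactin T K" "K \<subseteq> U" "\<And>x. x \<notin> K \<Longrightarrow> f x = 0"
    and D: "openin (subtopology T U) D" "K \<subseteq> D" and h: "continuous_map (subtopology T D) euclidean h"
    and L: "compactin T L" "L \<subseteq> W" "\<And>x. x \<in> K - L \<Longrightarrow> h x = 0"
    and W: "W \<subseteq> U"
  shows "(\<lambda>x. if x \<in> K then f x * h x else 0) \<in> Cc_on T W" (is "?g \<in> _")
proof -
  have cf: "continuous_map (subtopology T U) euclidean f" using f unfolding Cc_on_def by blast
  have Us: "U \<subseteq> topspace T" using U openin_subset by blast
  have DU: "D \<subseteq> U" using openin_subset[OF D(1)] by auto
  have clK: "closedin (subtopology T U) K"
    using K U by (intro compactin_imp_closedin) (auto simp: compactin_subtopology)
  have "continuous_map (subtopology T U) euclidean ?g"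
  proof (rule continuous_map_locally)
    fix x assume x: "x \<in> topspace (subtopology T U)"
    show "\<exists>N. openin (subtopology T U) N \<and> x \<in> N \<and>
        continuous_map (subtopology (subtopology T U) N) euclidean ?g"
    proof (cases "x \<in> D")
      case True
      have "subtopology (subtopology T U) D = subtopology T D"
        using DU by (simp add: subtopology_subtopology Int_absorb1)
      moreover have "continuous_map (subtopology T D) euclidean (\<lambda>x. f x * h x)"
        using continuous_map_from_subtopology_mono[OF cf DU] h by (rule continuous_map_mult')
      then have "continuous_map (subtopology T D) euclidean ?g"
        by (rule continuous_map_eq) (use K in auto)
      ultimately show ?thesis using True D by auto
    next
      case False
      let ?N = "topspace (subtopology T U) - K"
      have "openin (subtopology T U) ?N" using clK by blast
      moreover have "continuous_map (subtopology (subtopology T U) ?N) euclidean ?g"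
        by (rule continuous_map_eq[of _ _ "\<lambda>_. 0"]) auto
      ultimately show ?thesis using x False D by blast
    qed
  qed
  then have "continuous_map (subtopology T W) euclidean ?g"
    using W continuous_map_from_subtopology_mono by blast
  moreover have "compactin T (K \<inter> L)"
  proof -
    have "compactin (subtopology T U) (K \<inter> L)"
      using clK L W by (intro closed_Int_compactin) (auto simp: compactin_subtopology)
    then show ?thesis by (simp add: compactin_subtopology)
  qed
  ultimately show ?thesis
    using L unfolding Cc_on_def by (auto intro!: exI[of _ "K \<inter> L"])
qed

text \<open>Localization by a partition of unity. \<open>Q\<close> names an open cover, and any
  additive property of \<open>Cc\<close> functions need only be checked for functions supported in a
  Hausdorff open subset of one member of the cover.\<close>

lemma Cc_induct [consumes 2, case_names cover zero add on]:
  assumes T: "locally_compact_Hausdorff_base T" and f: "f \<in> Cc T"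
    and cover: "\<And>x. x \<in> topspace T \<Longrightarrow> \<exists>W. Q W \<and> openin T W \<and> x \<in> W"
    and zero: "P (\<lambda>_. 0)"
    and add: "\<And>f g. P f \<Longrightarrow> P g \<Longrightarrow> P (\<lambda>x. f x + g x)"
    and on: "\<And>g U W. Q W \<Longrightarrow> openin T W \<Longrightarrow> openin T U \<Longrightarrow> Hausdorff_space (subtopology T U) \<Longrightarrow> U \<subseteq> W
      \<Longrightarrow> g \<in> Cc_on T U \<Longrightarrow> P g"
  shows "P f"
proof -
  have sum: "P (\<lambda>x. \<Sum>i\<in>I. k i x)" if "finite I" "\<And>i. i \<in> I \<Longrightarrow> P (k i)" for I :: "'i set" and k
    using that by (induction I) (auto intro: zero add)
  have local: "P g" if U: "openin T U" "Hausdorff_space (subtopology T U)" and g: "g \<in> Cc_on T U" for g U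
  proof -
    let ?Y = "subtopology T U"
    have Us: "U \<subseteq> topspace T" using U openin_subset by blast
    have Y: "locally_compact_space ?Y" "Hausdorff_space ?Y"
      using U T locally_compact_Hausdorff_base_open_subset by auto
    obtain K where K: "compactin T K" "K \<subseteq> U" "\<And>x. x \<notin> K \<Longrightarrow> g x = 0"
      using g unfolding Cc_on_def by blast
    \<comment> \<open>Around each point of the support there is a cutoff compactly supported in a
      member of the cover.\<close>
    have "\<exists>W \<eta> L. Q W \<and> openin T W \<and> continuous_map ?Y euclideanreal \<eta> \<and> compactin T L \<and> L \<subseteq> U \<inter> W \<and>
        (\<forall>y\<in>U. 0 \<le> \<eta> y) \<and> \<eta> x = 1 \<and> (\<forall>y\<in>U - L. \<eta> y = 0)" if x: "x \<in> K" for x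
    proof -
      obtain W where W: "Q W" "openin T W" "x \<in> W" using cover[of x] x K Us by blast
      have 1: "compactin ?Y {x}" using x K Us by auto
      have 2: "openin ?Y (U \<inter> W)" using W by (simp add: openin_subtopology_Int2)
      have 3: "{x} \<subseteq> U \<inter> W" using W x K by auto
      obtain \<eta> L where "continuous_map ?Y euclideanreal \<eta>" "compactin ?Y L" "L \<subseteq> U \<inter> W"
        "\<And>y. y \<in> topspace ?Y \<Longrightarrow> 0 \<le> \<eta> y \<and> \<eta> y \<le> 1" "\<And>y. y \<in> {x} \<Longrightarrow> \<eta> y = 1"
        "\<And>y. y \<in> topspace ?Y - L \<Longrightarrow> \<eta> y = 0"
        using compact_cutoff[OF Y 1 2 3] by blast
      then show ?thesis using W Us
        by (intro exI[of _ W] exI[of _ \<eta>] exI[of _ L]) (auto simp: compactin_subtopology)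
    qed
    then obtain W \<eta> L where W\<eta>L: "\<And>x. x \<in> K \<Longrightarrow> Q (W x) \<and> openin T (W x) \<and>
        continuous_map ?Y euclideanreal (\<eta> x) \<and> compactin T (L x) \<and> L x \<subseteq> U \<inter> W x \<and>
        (\<forall>y\<in>U. 0 \<le> \<eta> x y) \<and> \<eta> x x = (1::real) \<and> (\<forall>y\<in>U - L x. \<eta> x y = 0)"
      by metis
    let ?O = "\<lambda>x. {y \<in> topspace ?Y. \<eta> x y \<in> {0<..}}"
    have O: "openin ?Y (?O x)" if "x \<in> K" for x
      using W\<eta>L[OF that] by (intro openin_continuous_map_preimage) auto
    have cK: "compactin ?Y K" using K by (simp add: compactin_subtopology)
    have self: "x \<in> ?O x" if "x \<in> K" for x
      using W\<eta>L[OF that] that K(2) Us by auto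
    obtain D where D: "finite D" "D \<subseteq> K" "K \<subseteq> (\<Union>x\<in>D. ?O x)"
      using cK O self by (rule compactin_finite_subcover)
    \<comment> \<open>The normalizing denominator. It is positive on \<open>K\<close>, hence on a
      neighbourhood \<open>N\<close> of \<open>K\<close>, and division is carried out only
      there.\<close>
    define S where "S = (\<lambda>y. \<Sum>x\<in>D. \<eta> x y)"
    have cS: "continuous_map ?Y euclideanreal S"
      unfolding S_def using D W\<eta>L by (intro continuous_map_sum) auto
    define N where "N = {y \<in> topspace ?Y. S y \<in> {0<..}}"
    have N: "openin ?Y N" unfolding N_def using cS by (intro openin_continuous_map_preimage) auto
    have KN: "K \<subseteq> N"
    proof
      fix y assume y: "y \<in> K"
      then have "y \<in> (\<Union>x\<in>D. ?O x)" using D(3) by (rule subsetD[rotated])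
      then obtain x where x: "x \<in> D" "\<eta> x y > 0" by auto
      have "0 \<le> \<eta> z y" if "z \<in> D" for z
        using W\<eta>L[of z] that D(2) y K(2) by blast
      then have "S y \<ge> \<eta> x y" unfolding S_def
        using x D(1) by (intro member_le_sum) auto
      then show "y \<in> N" using x y K Us by (auto simp: N_def)
    qed
    have NU: "N \<subseteq> U" by (auto simp: N_def)
    \<comment> \<open>On \<open>K\<close> the weights \<open>\<eta> x y / S y\<close> add up to 1,
      so these pieces sum to \<open>g\<close>.\<close>
    define k where "k = (\<lambda>x y. if y \<in> K then g y * complex_of_real (\<eta> x y / S y) else 0)"
    have "P (k x)" if x: "x \<in> D" for x
    proof -
      note w = W\<eta>L[of x]
      have xK: "x \<in> K" using x D by blast
      have UW: "openin T (U \<inter> W x)" using w xK U by blast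
      have "continuous_map (subtopology T N) euclidean (\<lambda>y. complex_of_real (\<eta> x y / S y))"
        using w xK cS NU by (intro continuous_map_of_real continuous_map_real_divide)
          (auto simp: N_def intro: continuous_map_from_subtopology_mono)
      then have "k x \<in> Cc_on T (U \<inter> W x)"
        unfolding k_def using w xK K
        by (intro Cc_on_mult_cutoff[OF g U K(1,2) _ N KN, where L = "L x"]) auto
      moreover have "Hausdorff_space (subtopology T (U \<inter> W x))"
        using U Hausdorff_subtopology_mono by blast
      ultimately show ?thesis using on[of "W x" "U \<inter> W x"] w xK UW by blast
    qed
    then have "P (\<lambda>y. \<Sum>x\<in>D. k x y)" using D by (intro sum)
    moreover have "(\<lambda>y. \<Sum>x\<in>D. k x y) = g"
    proof
      fix y show "(\<Sum>x\<in>D. k x y) = g y"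
      proof (cases "y \<in> K")
        case True
        then have "S y \<noteq> 0" using KN by (auto simp: N_def)
        have "(\<Sum>x\<in>D. k x y) = g y * complex_of_real ((\<Sum>x\<in>D. \<eta> x y) / S y)"
          using True by (simp add: k_def sum_distrib_left sum_divide_distrib)
        then show ?thesis using \<open>S y \<noteq> 0\<close> by (simp add: S_def)
      next
        case False then show ?thesis using K by (simp add: k_def)
      qed
    qed
    ultimately show ?thesis by simp
  qed
  obtain n k where f_eq: "f = (\<lambda>x. \<Sum>i<n. k i x)"
    and k: "\<forall>i<n::nat. \<exists>U. openin T U \<and> Hausdorff_space (subtopology T U) \<and> k i \<in> Cc_on T U"
    using f unfolding Cc_def by blast
  show ?thesis unfolding f_eq using k local by (intro sum) auto
qed

lemma Cc_on_imp_Cc: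
  assumes "f \<in> Cc_on T U" "openin T U" "Hausdorff_space (subtopology T U)"
  shows "f \<in> Cc T"
  unfolding Cc_def using assms
  by (intro CollectI exI[of _ "1::nat"] exI[of _ "\<lambda>_. f"]) auto

lemma Cc_zero: "(\<lambda>_. 0) \<in> Cc T"
  unfolding Cc_def by (intro CollectI exI[of _ "0::nat"]) auto

lemma Cc_add:
  assumes "f \<in> Cc T" "g \<in> Cc T"
  shows "(\<lambda>x. f x + g x) \<in> Cc T"
proof -
  let ?P = "\<lambda>k. \<exists>U. openin T U \<and> Hausdorff_space (subtopology T U) \<and> k \<in> Cc_on T U"
  obtain n k where f: "f = (\<lambda>x. \<Sum>i<n. k i x)" "\<forall>i<n::nat. ?P (k i)"
    using assms(1) unfolding Cc_def by blast
  obtain m l where g: "g = (\<lambda>x. \<Sum>i<m. l i x)" "\<forall>i<m::nat. ?P (l i)"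
    using assms(2) unfolding Cc_def by blast
  define h where "h = (\<lambda>i. if i < n then k i else l (i - n))"
  have "(\<lambda>x. f x + g x) = (\<lambda>x. \<Sum>i<n+m. h i x)"
  proof
    fix x
    have "(\<Sum>i<n+m. h i x) = (\<Sum>i<n. h i x) + (\<Sum>i<m. h (n + i) x)"
      by (induction m) (simp_all add: add.assoc)
    then show "f x + g x = (\<Sum>i<n+m. h i x)" by (simp add: f g h_def)
  qed
  moreover have "\<forall>i<n+m. ?P (h i)" using f(2) g(2) by (simp add: h_def)
  ultimately show ?thesis unfolding Cc_def by blast
qed


section \<open>Measures on range fibers and openness of the structure maps\<close>

definition borel_of :: "'a topology \<Rightarrow> 'a measure"
  where "borel_of T = sigma (topspace T) {U. openin T U}"

lemma open_sets_subset: "{U. openin T U} \<subseteq> Pow (topspace T)"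
  using openin_subset by blast

lemma space_borel_of [simp]: "space (borel_of T) = topspace T"
  unfolding borel_of_def using open_sets_subset by (rule space_measure_of)

lemma sets_borel_of: "sets (borel_of T) = sigma_sets (topspace T) {U. openin T U}"
  unfolding borel_of_def using open_sets_subset by (rule sets_measure_of)

lemma openin_sets_borel_of: "openin T U \<Longrightarrow> U \<in> sets (borel_of T)"
  by (simp add: sets_borel_of sigma_sets.Basic)

lemma closedin_sets_borel_of:
  assumes "closedin T C"
  shows "C \<in> sets (borel_of T)"
proof -
  have "C = space (borel_of T) - (topspace T - C)"
    using closedin_subset[OF assms] by auto
  moreover have "topspace T - C \<in> sets (borel_of T)"
    using assms by (intro openin_sets_borel_of) auto
  ultimately show ?thesis by (metis sets.compl_sets)
qed

lemma continuous_map_measurable: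
  assumes "continuous_map A B f"
  shows "f \<in> borel_of A \<rightarrow>\<^sub>M borel_of B"
  unfolding borel_of_def[of B]
proof (rule measurable_measure_of)
  show "{U. openin B U} \<subseteq> Pow (topspace B)" by (rule open_sets_subset)
  show "f \<in> space (borel_of A) \<rightarrow> topspace B"
    using assms by (simp add: continuous_map_def)
  fix U assume "U \<in> {U. openin B U}"
  then have "openin A {x \<in> topspace A. f x \<in> U}"
    using assms by (simp add: openin_continuous_map_preimage)
  moreover have "f -` U \<inter> space (borel_of A) = {x \<in> topspace A. f x \<in> U}" by auto
  ultimately show "f -` U \<inter> space (borel_of A) \<in> sets (borel_of A)"
    by (simp add: openin_sets_borel_of)
qed

lemma regular_borel_measure_sets:
  "regular_borel_measure T M \<Longrightarrow> sets M = sets (borel_of T)"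
  by (simp add: regular_borel_measure_def borel_of_def)

lemma regular_borel_measure_space:
  "regular_borel_measure T M \<Longrightarrow> space M = topspace T"
  using sets_eq_imp_space_eq[OF regular_borel_measure_sets] by simp

lemma image_eq_preimage_homeomorphic:
  assumes "homeomorphic_maps A B j k" "S \<subseteq> topspace B"
  shows "k ` S = j -` S \<inter> topspace A"
proof -
  have jk: "\<And>x. x \<in> topspace A \<Longrightarrow> k (j x) = x" "\<And>y. y \<in> topspace B \<Longrightarrow> j (k y) = y"
    "\<And>y. y \<in> topspace B \<Longrightarrow> k y \<in> topspace A"
    using assms(1) unfolding homeomorphic_maps_def continuous_map_def by auto
  show ?thesis
  proof (intro equalityI subsetI)
    fix x assume "x \<in> k ` S"
    then show "x \<in> j -` S \<inter> topspace A" using jk assms(2) by auto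
  next
    fix x assume "x \<in> j -` S \<inter> topspace A"
    then show "x \<in> k ` S" using jk(1) by (metis IntD1 IntD2 image_eqI vimageD)
  qed
qed

lemma homeomorphic_maps_openin_image:
  assumes "homeomorphic_maps A B j k" "openin B S"
  shows "openin A (k ` S)"
  using assms homeomorphic_maps_map homeomorphic_map_openness_eq homeomorphic_maps_sym
  by (metis homeomorphic_imp_open_map open_map_def)

text \<open>The semidirect product gives its measures through \<open>measure_of\<close> and a set
  function, and \<open>measure_of\<close> collapses to the zero measure unless that function is a
  measure. Taking images under \<open>k\<close> is taking preimages under \<open>j\<close>, so the
  function is a push-forward and countable additivity is automatic.\<close>

lemma pushforward_homeomorphic_eq_distr:
  assumes h: "homeomorphic_maps A B j k" and M: "sets M = sets (borel_of A)"
  shows "measure_of (topspace B) {U. openin B U} (\<lambda>S. emeasure M (k ` S)) = distr M (borel_of B) j"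
    (is "?N = ?D")
proof (rule measure_eqI)
  have sN: "sets ?N = sets (borel_of B)"
    by (simp add: sets_borel_of sets_measure_of open_sets_subset)
  then show "sets ?N = sets ?D" by simp
  have spM: "space M = topspace A" using sets_eq_imp_space_eq[OF M] by simp
  have j: "j \<in> M \<rightarrow>\<^sub>M borel_of B"
    using h continuous_map_measurable[of A B j] measurable_cong_sets[OF M refl]
    unfolding homeomorphic_maps_def by blast
  have eq: "emeasure M (k ` S) = emeasure ?D S" if "S \<in> sets (borel_of B)" for S
  proof -
    have "S \<subseteq> topspace B" using sets.sets_into_space[OF that] by simp
    then have "k ` S = j -` S \<inter> space M" using image_eq_preimage_homeomorphic[OF h] spM by simp
    then show ?thesis using that j by (simp add: emeasure_distr)
  qed
  fix S assume "S \<in> sets ?N"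
  have "?N = measure_of (topspace B) {U. openin B U} (emeasure ?D)"
    using eq by (intro measure_of_eq open_sets_subset) (simp add: sets_borel_of)
  then show "emeasure ?N S = emeasure ?D S"
  proof (rule emeasure_measure_of)
    show "positive (sets ?N) (emeasure ?D)" "countably_additive (sets ?N) (emeasure ?D)"
      unfolding sN using emeasure_positive[of ?D] emeasure_countably_additive[of ?D] by simp_all
  qed (use \<open>S \<in> sets ?N\<close> open_sets_subset in auto)
qed

text \<open>Regularity is phrased through open and compact sets only, and a homeomorphism matches
  these families bijectively.\<close>

lemma regular_borel_measure_homeomorphic:
  assumes h: "homeomorphic_maps A B j k" and M: "regular_borel_measure A M"
  shows "regular_borel_measure B (distr M (borel_of B) j)"
proof -
  let ?D = "distr M (borel_of B) j"
  note sM = regular_borel_measure_sets[OF M] and spM = regular_borel_measure_space[OF M]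
  have h': "homeomorphic_maps B A k j" using h homeomorphic_maps_sym by blast
  have jk: "\<And>x. x \<in> topspace A \<Longrightarrow> k (j x) = x" "\<And>y. y \<in> topspace B \<Longrightarrow> j (k y) = y"
    "continuous_map A B j" "continuous_map B A k"
    using h unfolding homeomorphic_maps_def by auto
  have j: "j \<in> M \<rightarrow>\<^sub>M borel_of B"
    using continuous_map_measurable[OF jk(3)] measurable_cong_sets[OF sM refl] by blast
  have em: "emeasure ?D S = emeasure M (k ` S)" if "S \<in> sets (borel_of B)" for S
  proof -
    have "S \<subseteq> topspace B" using sets.sets_into_space[OF that] by simp
    then have "k ` S = j -` S \<inter> space M" using image_eq_preimage_homeomorphic[OF h] spM by simp
    then show ?thesis using that j by (simp add: emeasure_distr)
  qed
  have kS: "k ` S \<in> sets M" if "S \<in> sets (borel_of B)" for S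
  proof -
    have "S \<subseteq> topspace B" using sets.sets_into_space[OF that] by simp
    then have "k ` S = j -` S \<inter> space M" using image_eq_preimage_homeomorphic[OF h] spM by simp
    then show ?thesis using that j by simp
  qed
  have jk_image: "j ` (k ` S) = S" if "S \<subseteq> topspace B" for S
    using that jk(2) by force
  have kj_image: "k ` (j ` S) = S" if "S \<subseteq> topspace A" for S
    using that jk(1) by force
  have finK: "emeasure M K < \<infinity>" if "compactin A K" for K
    using M that unfolding regular_borel_measure_def by blast
  have outer: "emeasure M S = (INF U\<in>{U. openin A U \<and> S \<subseteq> U}. emeasure M U)" if "S \<in> sets M" for S
    using M that unfolding regular_borel_measure_def by blast
  have inner: "emeasure M U = (SUP K\<in>{K. compactin A K \<and> K \<subseteq> U}. emeasure M K)" if "openin A U" for U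
    using M that unfolding regular_borel_measure_def by blast
  have jop: "openin B (j ` U)" if "openin A U" for U
    by (rule homeomorphic_maps_openin_image[OF h' that])
  have kop: "openin A (k ` U)" if "openin B U" for U
    by (rule homeomorphic_maps_openin_image[OF h that])
  have Ksub: "compactin A K \<Longrightarrow> K \<subseteq> topspace A" "compactin B L \<Longrightarrow> L \<subseteq> topspace B" for K L
    by (auto simp: compactin_subset_topspace)
  \<comment> \<open>Compact sets need not be Borel here, since \<open>B\<close> is not assumed
    Hausdorff. For a set outside the sigma-algebra both sides are 0 by convention, so the formula
    persists.\<close>
  have em': "emeasure ?D S = emeasure M (k ` S)" if "S \<subseteq> topspace B" for S
  proof (cases "S \<in> sets (borel_of B)")
    case True then show ?thesis by (rule em)
  next
    case False
    have "k ` S \<notin> sets M"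
    proof
      assume "k ` S \<in> sets M"
      then have "k -` (k ` S) \<inter> space (borel_of B) \<in> sets (borel_of B)"
        using continuous_map_measurable[OF jk(4)] unfolding sM by (rule measurable_sets[rotated])
      moreover have "k -` (k ` S) \<inter> space (borel_of B) = S"
        using image_eq_preimage_homeomorphic[OF h', of "k ` S"] jk_image[OF that]
          that jk(4) by (auto simp: continuous_map_def)
      ultimately show False using False by simp
    qed
    then show ?thesis using False by (simp add: emeasure_notin_sets)
  qed
  show ?thesis
    unfolding regular_borel_measure_def
  proof (intro conjI allI ballI impI)
    show "sets ?D = sets (sigma (topspace B) {U. openin B U})" by (simp add: borel_of_def)
    show "emeasure ?D K < \<infinity>" if "compactin B K" for K
      using em'[OF Ksub(2)[OF that]] finK[OF image_compactin[OF that jk(4)]] by simp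
    show "emeasure ?D S = (INF U\<in>{U. openin B U \<and> S \<subseteq> U}. emeasure ?D U)" if S: "S \<in> sets ?D" for S
    proof -
      have S': "S \<in> sets (borel_of B)" using S by simp
      then have Ssub: "S \<subseteq> topspace B" using sets.sets_into_space by fastforce
      have "{U. openin A U \<and> k ` S \<subseteq> U} = (`) k ` {U. openin B U \<and> S \<subseteq> U}" (is "?X = ?Y")
      proof (intro equalityI subsetI)
        fix U assume U: "U \<in> ?X"
        then have "U = k ` (j ` U)" using kj_image[of U] openin_subset by auto
        moreover have "S \<subseteq> j ` U"
          using U jk_image[OF Ssub] by (metis (no_types, lifting) image_mono mem_Collect_eq)
        ultimately show "U \<in> ?Y" using U jop by blast
      next
        fix U assume "U \<in> ?Y"
        then show "U \<in> ?X" using kop by auto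
      qed
      then have "emeasure M (k ` S) = (INF U\<in>(`) k ` {U. openin B U \<and> S \<subseteq> U}. emeasure M U)"
        using outer[OF kS[OF S']] by simp
      also have "\<dots> = (INF U\<in>{U. openin B U \<and> S \<subseteq> U}. emeasure M (k ` U))"
        by (simp add: image_image)
      also have "\<dots> = (INF U\<in>{U. openin B U \<and> S \<subseteq> U}. emeasure ?D U)"
        by (intro INF_cong refl) (simp add: em openin_sets_borel_of)
      finally show ?thesis using em[OF S'] by simp
    qed
    show "emeasure ?D U = (SUP K\<in>{K. compactin B K \<and> K \<subseteq> U}. emeasure ?D K)" if U: "openin B U" for U
    proof -
      have "{K. compactin A K \<and> K \<subseteq> k ` U} = (`) k ` {K. compactin B K \<and> K \<subseteq> U}" (is "?X = ?Y")
      proof (intro equalityI subsetI)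
        fix K assume K: "K \<in> ?X"
        then have "K = k ` (j ` K)" using kj_image[OF Ksub(1)] by auto
        moreover have "j ` K \<subseteq> U"
          using K jk_image[OF openin_subset[OF U]] by (metis (no_types, lifting) image_mono mem_Collect_eq)
        moreover have "compactin B (j ` K)" using K image_compactin jk(3) by blast
        ultimately show "K \<in> ?Y" by blast
      next
        fix K assume "K \<in> ?Y"
        then show "K \<in> ?X" using image_compactin jk(4) by auto
      qed
      then have "emeasure M (k ` U) = (SUP K\<in>(`) k ` {K. compactin B K \<and> K \<subseteq> U}. emeasure M K)"
        using inner[OF kop[OF U]] by simp
      also have "\<dots> = (SUP K\<in>{K. compactin B K \<and> K \<subseteq> U}. emeasure M (k ` K))"
        by (simp add: image_image)
      also have "\<dots> = (SUP K\<in>{K. compactin B K \<and> K \<subseteq> U}. emeasure ?D K)"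
        by (intro SUP_cong refl) (simp add: em' Ksub(2))
      finally show ?thesis using em[OF openin_sets_borel_of[OF U]] by simp
    qed
  qed
qed

text \<open>\<open>f\<close> need not be continuous off \<open>U\<close>, but it is 0 there. The
  preimage of an open set is thus open in \<open>U\<close>, possibly together with the closed
  complement of \<open>U\<close>.\<close>

lemma Cc_on_measurable:
  assumes f: "f \<in> Cc_on T U" and U: "openin T U"
  shows "f \<in> borel_measurable (borel_of (subtopology T E))"
proof (rule borel_measurableI)
  fix S :: "complex set" assume S: "open S"
  let ?F = "subtopology T E"
  obtain K where K: "K \<subseteq> U" "\<And>x. x \<notin> K \<Longrightarrow> f x = 0"
    and cf: "continuous_map (subtopology T U) euclidean f"
    using f unfolding Cc_on_def by blast
  have "openin (subtopology T U) {x \<in> topspace (subtopology T U). f x \<in> S}"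
    using openin_continuous_map_preimage[OF cf] S by simp
  then have "openin T {x \<in> topspace (subtopology T U). f x \<in> S}"
    using U by (simp add: openin_open_subtopology)
  then have 1: "openin ?F ({x \<in> topspace (subtopology T U). f x \<in> S} \<inter> E)"
    by (rule openin_subtopology_Int)
  have 2: "closedin ?F (topspace ?F - (U \<inter> E))"
    using U by (intro closedin_diff closedin_topspace openin_subtopology_Int)
  have nz: "x \<in> U" if "0 \<notin> S" "f x \<in> S" for x
    using K that by (metis subsetD)
  have z: "f x = 0" if "x \<notin> U" for x
    using K that by blast
  have "f -` S \<inter> space (borel_of ?F) =
    ({x \<in> topspace (subtopology T U). f x \<in> S} \<inter> E) \<union> (if 0 \<in> S then topspace ?F - (U \<inter> E) else {})"
    using nz by (auto simp: z openin_subset[OF U, THEN subsetD])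
  then show "f -` S \<inter> space (borel_of ?F) \<in> sets (borel_of ?F)"
    using openin_sets_borel_of[OF 1] closedin_sets_borel_of[OF 2] by (auto intro: sets.Un)
qed

text \<open>The support may fail to be closed in \<open>T\<close>, but its trace on the Hausdorff
  subspace \<open>E\<close> is compact, hence Borel and of finite measure, and \<open>f\<close> is
  bounded on it.\<close>

lemma Cc_on_integrable:
  assumes f: "f \<in> Cc_on T U" and U: "openin T U" and E: "closedin T E"
    and haus: "Hausdorff_space (subtopology T E)"
    and M: "regular_borel_measure (subtopology T E) M"
  shows "integrable M f"
proof -
  let ?F = "subtopology T E"
  obtain K where K: "compactin T K" "K \<subseteq> U" "\<And>x. x \<notin> K \<Longrightarrow> f x = 0"
    and cf: "continuous_map (subtopology T U) euclidean f"
    using f unfolding Cc_on_def by blast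
  note sM = regular_borel_measure_sets[OF M] and spM = regular_borel_measure_space[OF M]
  have meas: "f \<in> borel_measurable M"
    using Cc_on_measurable[OF f U] measurable_cong_sets[OF sM refl] by blast
  have cK: "compactin ?F (K \<inter> E)"
    using K E by (auto simp: compactin_subtopology compact_Int_closedin)
  then have KE: "K \<inter> E \<in> sets M"
    unfolding sM using haus by (intro closedin_sets_borel_of compactin_imp_closedin)
  have fin: "emeasure M (K \<inter> E) < \<infinity>"
    using M cK unfolding regular_borel_measure_def by blast
  have "compactin (subtopology T U) K" using K by (simp add: compactin_subtopology)
  then have "compact (f ` K)" using image_compactin[OF _ cf] by auto
  then obtain B where "\<forall>y\<in>f ` K. norm y \<le> B" using compact_imp_bounded bounded_iff by metis
  then have B: "\<And>x. x \<in> K \<Longrightarrow> norm (f x) \<le> B" by auto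
  show ?thesis
  proof (rule integrableI_bounded_set[of "K \<inter> E" M f B])
    show "AE x\<in>K \<inter> E in M. norm (f x) \<le> B" using B by auto
    show "AE x in M. x \<notin> K \<inter> E \<longrightarrow> f x = 0"
      using K(3) spM by (intro AE_I2) auto
  qed (use KE meas fin in auto)
qed

section \<open>Groupoid identities and continuity of the operations\<close>

context topological_groupoid
begin

lemma unit_arrow: "u \<in> gunits G \<Longrightarrow> u \<in> arrows G"
  using units_subset by blast

lemma topspace_unit_top [simp]: "topspace (unit_top G) = gunits G"
  using units_subset by (auto simp: unit_top_def)

lemma ran_arrow: "g \<in> arrows G \<Longrightarrow> gran G g \<in> arrows G"
  by (simp add: ran_unit unit_arrow)

lemma inv_mult_cancel:
  assumes "g \<in> arrows G" "h \<in> arrows G" "gdom G g = gran G h"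
  shows "gmult G (ginv G g) (gmult G g h) = h"
  using assms mult_assoc[of "ginv G g" g h] by (simp add: inv_closed dom_inv mult_inv_left mult_unit_left)

lemma mult_inv_cancel:
  assumes "g \<in> arrows G" "h \<in> arrows G" "gran G g = gran G h"
  shows "gmult G g (gmult G (ginv G g) h) = h"
  using assms mult_assoc[of g "ginv G g" h]
  by (simp add: inv_closed dom_inv ran_inv mult_inv_right mult_unit_left)

lemma inv_inv:
  assumes "g \<in> arrows G"
  shows "ginv G (ginv G g) = g"
  using assms inv_mult_cancel[of "ginv G g" g] mult_unit_right[of "ginv G (ginv G g)"]
  by (simp add: inv_closed dom_inv ran_inv mult_inv_left)

lemma continuous_map_inv:
  "continuous_map A (gtop G) f \<Longrightarrow> continuous_map A (gtop G) (\<lambda>x. ginv G (f x))"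
  using continuous_map_compose[OF _ continuous_inv, of A f] by (simp add: o_def)

lemma continuous_map_dom:
  "continuous_map A (gtop G) f \<Longrightarrow> continuous_map A (unit_top G) (\<lambda>x. gdom G (f x))"
  using continuous_map_compose[OF _ continuous_dom, of A f] by (simp add: o_def)

lemma continuous_map_ran:
  "continuous_map A (gtop G) f \<Longrightarrow> continuous_map A (unit_top G) (\<lambda>x. gran G (f x))"
  using continuous_map_compose[OF _ continuous_ran, of A f] by (simp add: o_def)

lemma continuous_map_mult:
  assumes "continuous_map A (gtop G) f" "continuous_map A (gtop G) g"
    and "\<And>x. x \<in> topspace A \<Longrightarrow> gdom G (f x) = gran G (g x)"
  shows "continuous_map A (gtop G) (\<lambda>x. gmult G (f x) (g x))"
proof -
  have "continuous_map A (fiber_product (gtop G) (gtop G) (gdom G) (gran G)) (\<lambda>x. (f x, g x))"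
    using assms by (auto simp: fiber_product_def continuous_map_in_subtopology continuous_map_paired)
  then show ?thesis
    using continuous_map_compose[OF _ continuous_mult, of A "\<lambda>x. (f x, g x)"] by (simp add: o_def)
qed

lemma continuous_map_unit_top_arrows:
  "continuous_map A (unit_top G) f \<Longrightarrow> continuous_map A (gtop G) f"
  unfolding unit_top_def by (rule continuous_map_into_fulltopology)

lemma topspace_ran_fiber: "topspace (ran_fiber G u) = {g \<in> arrows G. gran G g = u}"
  by (auto simp: ran_fiber_def)

end

lemma closedin_equalizer:
  assumes "Hausdorff_space B" "continuous_map A B f" "continuous_map A B g"
  shows "closedin A {x \<in> topspace A. f x = g x}"
proof -
  have "closedin (prod_topology B B) ((\<lambda>x. (x, x)) ` topspace B)"
    using assms(1) Hausdorff_space_closedin_diagonal by blast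
  moreover have "continuous_map A (prod_topology B B) (\<lambda>x. (f x, g x))"
    using assms by (simp add: continuous_map_paired)
  ultimately have "closedin A {x \<in> topspace A. (f x, g x) \<in> (\<lambda>x. (x, x)) ` topspace B}"
    using closedin_continuous_map_preimage by blast
  moreover have "{x \<in> topspace A. (f x, g x) \<in> (\<lambda>x. (x, x)) ` topspace B} = {x \<in> topspace A. f x = g x}"
    using assms(2) by (auto simp: continuous_map_def)
  ultimately show ?thesis by simp
qed

lemma Cc_on_restrict_subtopology:
  assumes "continuous_map (subtopology T U) euclidean f" "compactin T K" "K \<subseteq> U"
    "\<And>x. x \<in> U - K \<Longrightarrow> f x = 0"
  shows "(\<lambda>x. if x \<in> U then f x else 0) \<in> Cc_on T U"
  unfolding Cc_on_def
  using assms by (intro CollectI conjI exI[of _ K]) (auto intro: continuous_map_eq)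

section \<open>Haar integrals, and openness of the range and domain maps\<close>

context locally_compact_groupoid
begin

lemma base: "locally_compact_Hausdorff_base (gtop G)"
  and second_countable: "second_countable (gtop G)"
  using compact_base countable_compact_base_iff[of "gtop G"] by auto

lemma regular_haar: "u \<in> gunits G \<Longrightarrow> regular_borel_measure (ran_fiber G u) (haar G u)"
  using haar_system unfolding left_haar_system_def by blast

lemma space_haar: "u \<in> gunits G \<Longrightarrow> space (haar G u) = {g \<in> arrows G. gran G g = u}"
  using regular_borel_measure_space[OF regular_haar] topspace_ran_fiber by auto

lemma closed_fiber: "u \<in> gunits G \<Longrightarrow> closedin (gtop G) {g \<in> arrows G. gran G g = u}"
  using units_Hausdorff continuous_ran by (intro closedin_equalizer[of "unit_top G"]) auto

lemma ran_fiber_eq: "ran_fiber G u = subtopology (gtop G) {g \<in> arrows G. gran G g = u}"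
  unfolding ran_fiber_def by (rule topology_eq[THEN iffD2]) (auto simp: openin_subtopology dest: openin_subset)

lemma Cc_integrable:
  assumes "f \<in> Cc (gtop G)" "u \<in> gunits G"
  shows "integrable (haar G u) f"
proof -
  obtain n k where f_eq: "f = (\<lambda>x. \<Sum>i<n. k i x)"
    and k: "\<forall>i<n::nat. \<exists>U. openin (gtop G) U \<and> Hausdorff_space (subtopology (gtop G) U) \<and> k i \<in> Cc_on (gtop G) U"
    using assms(1) unfolding Cc_def by blast
  have "integrable (haar G u) (k i)" if i: "i < n" for i
  proof -
    obtain U where U: "openin (gtop G) U" "k i \<in> Cc_on (gtop G) U" using k[rule_format, OF i] by blast
    show ?thesis
      using Cc_on_integrable[OF U(2,1) closed_fiber[OF assms(2)]] regular_haar[OF assms(2)]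
        fiber_Hausdorff[OF assms(2)] by (simp add: ran_fiber_eq)
  qed
  then show ?thesis unfolding f_eq by (intro Bochner_Integration.integrable_sum) auto
qed

lemma haar_continuous:
  assumes "f \<in> Cc (gtop G)"
  shows "continuous_map (unit_top G) euclidean (\<lambda>u. \<integral>g. f g \<partial>haar G u)"
proof -
  have "(\<lambda>u. if u \<in> gunits G then \<integral>g. f g \<partial>haar G u else 0) \<in> Cc_on (gtop G) (gunits G)"
    using haar_system assms unfolding left_haar_system_def by blast
  then have "continuous_map (unit_top G) euclidean (\<lambda>u. if u \<in> gunits G then \<integral>g. f g \<partial>haar G u else 0)"
    by (simp add: Cc_on_def unit_top_def)
  then show ?thesis by (rule continuous_map_eq) simp
qed

lemma haar_pos:
  "u \<in> gunits G \<Longrightarrow> openin (ran_fiber G u) U \<Longrightarrow> U \<noteq> {} \<Longrightarrow> emeasure (haar G u) U > 0"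
  using haar_system unfolding left_haar_system_def by blast

lemma haar_invariant:
  "f \<in> Cc (gtop G) \<Longrightarrow> g \<in> arrows G \<Longrightarrow>
    (\<integral>h. f (gmult G g h) \<partial>haar G (gdom G g)) = (\<integral>h. f h \<partial>haar G (gran G g))"
  using haar_system unfolding left_haar_system_def by blast

text \<open>A nonnegative bump supported in the open set has a continuous fibre integral. It is
  positive at the range of the chosen arrow, since the Haar measures have full support, and a unit
  where it is nonzero has a fibre meeting the open set.\<close>

lemma open_map_ran: "open_map (gtop G) (unit_top G) (gran G)"
  unfolding open_map_def
proof (intro allI impI)
  fix U assume U: "openin (gtop G) U"
  show "openin (unit_top G) (gran G ` U)"
  proof (subst openin_subopen, intro ballI)
    fix v assume "v \<in> gran G ` U"
    then obtain g where g: "g \<in> U" "v = gran G g" by blast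
    have gG: "g \<in> arrows G" using U g openin_subset by blast
    have v: "v \<in> gunits G" using g gG ran_unit by simp
    obtain V where V: "openin (gtop G) V" "Hausdorff_space (subtopology (gtop G) V)" "g \<in> V" "V \<subseteq> U"
      using locally_compact_Hausdorff_base_imp_open[OF base U g(1)] .
    let ?V = "subtopology (gtop G) V"
    have tV: "topspace ?V = V" using openin_subset[OF V(1)] by auto
    have lcV: "locally_compact_space ?V"
      by (rule locally_compact_Hausdorff_base_open_subset[OF base V(1)])
    have gV: "compactin ?V {g}" using V(3) tV by simp
    obtain \<eta> L where \<eta>: "continuous_map ?V euclideanreal \<eta>" "compactin ?V L" "L \<subseteq> topspace ?V"
      "\<And>x. x \<in> topspace ?V \<Longrightarrow> 0 \<le> \<eta> x \<and> \<eta> x \<le> 1" "\<And>x. x \<in> {g} \<Longrightarrow> \<eta> x = 1"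
      "\<And>x. x \<in> topspace ?V - L \<Longrightarrow> \<eta> x = 0"
      using compact_cutoff[OF lcV V(2) gV openin_topspace compactin_subset_topspace[OF gV]] by metis
    define e where "e = (\<lambda>x. if x \<in> V then \<eta> x else 0)"
    define f where "f = (\<lambda>x. complex_of_real (e x))"
    have f: "f \<in> Cc (gtop G)"
    proof -
      have "(\<lambda>x. if x \<in> V then complex_of_real (\<eta> x) else 0) \<in> Cc_on (gtop G) V"
        using \<eta> continuous_map_of_real[OF \<eta>(1)] tV
        by (intro Cc_on_restrict_subtopology[where K = L]) (auto simp: compactin_subtopology)
      moreover have "(\<lambda>x. if x \<in> V then complex_of_real (\<eta> x) else 0) = f"
        by (auto simp: f_def e_def)
      ultimately show ?thesis using V Cc_on_imp_Cc by metis
    qed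
    have e0: "0 \<le> e x" for x using \<eta>(4)[of x, unfolded tV] by (simp add: e_def)
    \<comment> \<open>The candidate neighbourhood of \<open>v\<close>: the units at which the fibre
      integral of the bump is nonzero.\<close>
    define N where "N = {u \<in> topspace (unit_top G). (\<integral>x. f x \<partial>haar G u) \<in> - {0}}"
    have "openin (unit_top G) N"
      unfolding N_def using haar_continuous[OF f] by (rule openin_continuous_map_preimage) auto
    moreover have "v \<in> N"
    proof -
      have int: "integrable (haar G v) e"
        using Cc_integrable[OF f v] by (simp add: f_def complex_of_real_integrable_eq)
      have "(\<integral>x. e x \<partial>haar G v) \<noteq> 0"
      proof
        assume "(\<integral>x. e x \<partial>haar G v) = 0"
        then have AE0: "AE x in haar G v. e x = 0"
          using integral_nonneg_eq_0_iff_AE[OF int] e0 by simp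
        \<comment> \<open>A nonempty open part of the fibre on which the bump is positive; its
          positive measure contradicts a vanishing integral.\<close>
        define W where "W = {x \<in> topspace ?V. \<eta> x \<in> {0<..}} \<inter> {g \<in> arrows G. gran G g = v}"
        have "openin ?V {x \<in> topspace ?V. \<eta> x \<in> {0<..}}"
          using \<eta>(1) by (rule openin_continuous_map_preimage) auto
        then have "openin (gtop G) {x \<in> topspace ?V. \<eta> x \<in> {0<..}}"
          using V(1) by (simp add: openin_open_subtopology)
        then have W: "openin (ran_fiber G v) W"
          unfolding W_def ran_fiber_eq by (rule openin_subtopology_Int)
        moreover have "g \<in> W" using g gG V(3) \<eta>(5) tV by (simp add: W_def)
        ultimately have pos: "emeasure (haar G v) W > 0" using haar_pos[OF v] by blast
        have Wm: "W \<in> sets (haar G v)"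
          using W openin_sets_borel_of regular_borel_measure_sets[OF regular_haar[OF v]] by simp
        have Weq: "{x \<in> space (haar G v). \<not> x \<notin> W} = W"
          using sets.sets_into_space[OF Wm] by auto
        have "e x \<noteq> 0" if "x \<in> W" for x
          using that tV by (auto simp: W_def e_def)
        then have "AE x in haar G v. x \<notin> W" using AE0 by (auto elim: eventually_mono)
        then have "emeasure (haar G v) W = 0"
          using AE_iff_measurable[OF Wm Weq] by simp
        then show False using pos by simp
      qed
      then show ?thesis using v unfolding N_def by (simp add: f_def)
    qed
    moreover have "N \<subseteq> gran G ` U"
    proof
      fix u assume u: "u \<in> N"
      show "u \<in> gran G ` U"
      proof (rule ccontr)
        assume nu: "u \<notin> gran G ` U"
        have uu: "u \<in> gunits G" using u by (simp add: N_def)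
        have "(\<integral>x. f x \<partial>haar G u) = (\<integral>x. 0 \<partial>haar G u)"
          using nu V(4) space_haar[OF uu]
          by (intro Bochner_Integration.integral_cong) (auto simp: f_def e_def)
        then show False using u by (simp add: N_def)
      qed
    qed
    ultimately show "\<exists>T. openin (unit_top G) T \<and> v \<in> T \<and> T \<subseteq> gran G ` U" by blast
  qed
qed

text \<open>Inversion is a homeomorphism exchanging the two maps.\<close>

lemma open_map_dom: "open_map (gtop G) (unit_top G) (gdom G)"
  unfolding open_map_def
proof (intro allI impI)
  fix U assume U: "openin (gtop G) U"
  have "openin (gtop G) {g \<in> arrows G. ginv G g \<in> U}"
    using continuous_inv U by (rule openin_continuous_map_preimage)
  then have "openin (unit_top G) (gran G ` {g \<in> arrows G. ginv G g \<in> U})"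
    using open_map_ran unfolding open_map_def by blast
  moreover have "gran G ` {g \<in> arrows G. ginv G g \<in> U} = gdom G ` U"
  proof (intro equalityI subsetI)
    fix u assume "u \<in> gran G ` {g \<in> arrows G. ginv G g \<in> U}"
    then obtain g where "g \<in> arrows G" "ginv G g \<in> U" "u = gran G g" by blast
    then show "u \<in> gdom G ` U" using dom_inv by (metis image_eqI)
  next
    fix u assume "u \<in> gdom G ` U"
    then obtain g where g: "g \<in> U" "u = gdom G g" by blast
    then have "g \<in> arrows G" using U openin_subset by blast
    then show "u \<in> gran G ` {g \<in> arrows G. ginv G g \<in> U}"
      using g inv_inv[of g] inv_closed[of g] ran_inv[of g]
      by (intro image_eqI[of _ _ "ginv G g"]) auto
  qed
  ultimately show "openin (unit_top G) (gdom G ` U)" by simp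
qed

text \<open>In the pullback the arrow determines the two units, so projecting to it inverts the bar
  map. For the same reason the space in essential surjectivity is a copy of the arrow space, with
  \<open>gdom G\<close> as its map, and openness of the domain map applies.\<close>

lemma weak_equivalence_id: "weak_equivalence G G (\<lambda>g. g)"
  unfolding weak_equivalence_def
proof (intro conjI)
  show "continuous_functor G G (\<lambda>g. g)"
    unfolding continuous_functor_def using continuous_map_id[of "gtop G"] by (simp add: id_def)
  have "homeomorphic_maps (gtop G) (pullback_top G G (\<lambda>g. g)) (bar_map G (\<lambda>g. g)) (\<lambda>p. snd (snd p))"
    unfolding homeomorphic_maps_def
  proof (intro conjI)
    show "continuous_map (gtop G) (pullback_top G G (\<lambda>g. g)) (bar_map G (\<lambda>g. g))"
      unfolding pullback_top_def bar_map_def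
      using continuous_ran continuous_dom continuous_map_id[of "gtop G"]
      by (auto simp: continuous_map_in_subtopology continuous_map_paired id_def)
    show "continuous_map (pullback_top G G (\<lambda>g. g)) (gtop G) (\<lambda>p. snd (snd p))"
      unfolding pullback_top_def
      using continuous_map_compose[OF continuous_map_snd continuous_map_snd, of "unit_top G" "unit_top G" "gtop G"]
      by (intro continuous_map_from_subtopology) (simp add: o_def)
    show "\<forall>x\<in>arrows G. snd (snd (bar_map G (\<lambda>g. g) x)) = x"
      by (simp add: bar_map_def)
    show "\<forall>y\<in>topspace (pullback_top G G (\<lambda>g. g)). bar_map G (\<lambda>g. g) (snd (snd y)) = y"
      by (auto simp: pullback_top_def bar_map_def)
  qed
  then show "fully_faithful G G (\<lambda>g. g)"
    unfolding fully_faithful_def homeomorphic_maps_map by blast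
  let ?E = "fiber_product (unit_top G) (gtop G) (\<lambda>g. g) (gran G)"
  have "open_map ?E (unit_top G) (\<lambda>(e, h). gdom G h)"
    unfolding open_map_def
  proof (intro allI impI)
    fix U assume U: "openin ?E U"
    have "continuous_map (gtop G) ?E (\<lambda>h. (gran G h, h))"
      using continuous_ran continuous_map_id[of "gtop G"]
      by (auto simp: fiber_product_def continuous_map_in_subtopology continuous_map_paired id_def)
    then have "openin (gtop G) {h \<in> arrows G. (gran G h, h) \<in> U}"
      using U by (rule openin_continuous_map_preimage)
    then have "openin (unit_top G) (gdom G ` {h \<in> arrows G. (gran G h, h) \<in> U})"
      using open_map_dom unfolding open_map_def by blast
    moreover have "gdom G ` {h \<in> arrows G. (gran G h, h) \<in> U} = (\<lambda>(e, h). gdom G h) ` U"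
    proof -
      have "U \<subseteq> topspace ?E" using U openin_subset by blast
      then have "U = (\<lambda>h. (gran G h, h)) ` {h \<in> arrows G. (gran G h, h) \<in> U}"
        by (auto simp: fiber_product_def)
      then show ?thesis by (metis (no_types, lifting) image_cong image_image case_prod_conv)
    qed
    ultimately show "openin (unit_top G) ((\<lambda>(e, h). gdom G h) ` U)" by simp
  qed
  moreover have "(\<lambda>(e, h). gdom G h) ` topspace ?E = gunits G"
  proof (intro equalityI subsetI)
    fix u assume "u \<in> (\<lambda>(e, h). gdom G h) ` topspace ?E"
    then show "u \<in> gunits G" by (auto simp: fiber_product_def dom_unit)
  next
    fix u assume u: "u \<in> gunits G"
    then have "(u, u) \<in> topspace ?E" by (simp add: fiber_product_def unit_ran unit_arrow)
    then show "u \<in> (\<lambda>(e, h). gdom G h) ` topspace ?E"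
      using u unit_dom by (intro image_eqI[of _ _ "(u, u)"]) auto
  qed
  ultimately show "essentially_surjective G G (\<lambda>g. g)"
    by (simp add: essentially_surjective_def Let_def)
qed

end


section \<open>Semidirect products\<close>

lemma Cc_measurable:
  assumes "f \<in> Cc T"
  shows "f \<in> borel_measurable (borel_of (subtopology T E))"
proof -
  obtain n k where f_eq: "f = (\<lambda>x. \<Sum>i<n. k i x)"
    and k: "\<forall>i<n::nat. \<exists>U. openin T U \<and> Hausdorff_space (subtopology T U) \<and> k i \<in> Cc_on T U"
    using assms unfolding Cc_def by blast
  have "k i \<in> borel_measurable (borel_of (subtopology T E))" if i: "i < n" for i
  proof -
    obtain U where "openin T U" "k i \<in> Cc_on T U" using k[rule_format, OF i] by blast
    then show ?thesis by (intro Cc_on_measurable)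
  qed
  then show ?thesis unfolding f_eq by (intro borel_measurable_sum) auto
qed

lemma norm_integral_le:
  fixes f :: "'a \<Rightarrow> 'b::{banach, second_countable_topology}"
  assumes "integrable M f" "integrable M g" "\<And>x. x \<in> space M \<Longrightarrow> norm (f x) \<le> g x"
  shows "norm (\<integral>x. f x \<partial>M) \<le> (\<integral>x. g x \<partial>M)"
proof -
  have "(\<integral>x. norm (f x) \<partial>M) \<le> (\<integral>x. g x \<partial>M)"
    using assms by (intro integral_mono) auto
  with integral_norm_bound[of M f] show ?thesis by (rule order_trans)
qed

lemma continuous_map_euclidean_dist:
  fixes f :: "'a \<Rightarrow> 'b::metric_space"
  assumes "\<And>x e. x \<in> topspace X \<Longrightarrow> 0 < e \<Longrightarrow> \<exists>N. openin X N \<and> x \<in> N \<and> (\<forall>y\<in>N. dist (f y) (f x) < e)"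
  shows "continuous_map X euclidean f"
  unfolding continuous_map_def
proof (intro conjI allI impI)
  fix U :: "'b set" assume "openin euclidean U"
  then have U: "open U" by simp
  show "openin X {x \<in> topspace X. f x \<in> U}"
  proof (subst openin_subopen, intro ballI)
    fix x assume "x \<in> {x \<in> topspace X. f x \<in> U}"
    then have x: "x \<in> topspace X" "f x \<in> U" by auto
    obtain e where e: "0 < e" "\<And>z. dist z (f x) < e \<Longrightarrow> z \<in> U"
      using U x(2) unfolding open_dist by blast
    obtain N where N: "openin X N" "x \<in> N" "\<forall>y\<in>N. dist (f y) (f x) < e"
      using assms[OF x(1) e(1)] by blast
    then have "N \<subseteq> {x \<in> topspace X. f x \<in> U}" using e(2) openin_subset[OF N(1)] by blast
    then show "\<exists>T. openin X T \<and> x \<in> T \<and> T \<subseteq> {x \<in> topspace X. f x \<in> U}" using N by blast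
  qed
qed simp

lemma continuous_map_euclidean_distD:
  fixes f :: "'a \<Rightarrow> 'b::metric_space"
  assumes "continuous_map X euclidean f" "x \<in> topspace X" "0 < e"
  shows "\<exists>N. openin X N \<and> x \<in> N \<and> (\<forall>y\<in>N. dist (f y) (f x) < e)"
proof (intro exI conjI)
  show "openin X {y \<in> topspace X. f y \<in> ball (f x) e}"
    using assms(1) by (rule openin_continuous_map_preimage) simp
qed (use assms in \<open>auto simp: dist_commute\<close>)

lemma (in topological_groupoid) continuous_map_translation:
  assumes "g \<in> arrows G"
  shows "continuous_map (ran_fiber G (gdom G g)) (ran_fiber G (gran G g)) (gmult G g)"
proof -
  have "continuous_map (ran_fiber G (gdom G g)) (gtop G) (\<lambda>h. h)"
    unfolding ran_fiber_def
    using continuous_map_from_subtopology[OF continuous_map_id[of "gtop G"]] by (simp add: id_def)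
  then have "continuous_map (ran_fiber G (gdom G g)) (gtop G) (\<lambda>h. gmult G g h)"
    using assms by (intro continuous_map_mult) (auto simp: topspace_ran_fiber)
  then show ?thesis
    using assms ran_mult unfolding ran_fiber_def[of G "gran G g"]
    by (auto simp: continuous_map_in_subtopology topspace_ran_fiber)
qed

text \<open>The unit space is Hausdorff, so the fibre product is closed in the full product although
  the arrow space may be non-Hausdorff.\<close>

lemma (in locally_compact_groupoid) base_fiber_product:
  assumes A: "locally_compact_Hausdorff_base A" and p: "continuous_map A (unit_top G) p"
  shows "locally_compact_Hausdorff_base (fiber_product (gtop G) A (gdom G) p)"
proof -
  let ?P = "prod_topology (gtop G) A"
  let ?C = "{z \<in> topspace ?P. gdom G (fst z) = p (snd z)}"
  have "closedin ?P ?C"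
    using units_Hausdorff continuous_map_dom[OF continuous_map_fst] continuous_map_compose[OF continuous_map_snd p]
    by (intro closedin_equalizer) (auto simp: o_def)
  moreover have "fiber_product (gtop G) A (gdom G) p = subtopology ?P ?C"
    unfolding fiber_product_def
    by (subst subtopology_restrict[symmetric]) (rule arg_cong[of _ _ "subtopology _"], auto)
  ultimately show ?thesis
    by (simp add: A base locally_compact_Hausdorff_base_closed_subset locally_compact_Hausdorff_base_prod)
qed

text \<open>Second countability of X provides the countable family of compact sets demanded of the
  semidirect product.\<close>

locale lc_groupoid_action = locally_compact_groupoid H + groupoid_action H X p \<theta>
  for H :: "('h, 'z) lc_groupoid_scheme" and X :: "'x topology" and p \<theta> +
  assumes X_locally_compact: "locally_compact_space X"
    and X_Hausdorff: "Hausdorff_space X"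
    and X_second_countable: "second_countable X"
begin

section \<open>The semidirect product as a topological groupoid\<close>

abbreviation S :: "('h \<times> 'x) lc_groupoid"
  where "S \<equiv> semidirect H X p \<theta>"

abbreviation T :: "('h \<times> 'x) topology"
  where "T \<equiv> fiber_product (gtop H) X (gdom H) p"

lemma gtop_S: "gtop S = T"
  and gunits_S: "gunits S = (\<lambda>x. (p x, x)) ` topspace X"
  and gdom_S: "gdom S = (\<lambda>(h, x). (p x, x))"
  and gran_S: "gran S = (\<lambda>(h, x). (p (\<theta> h x), \<theta> h x))"
  and gmult_S: "gmult S = (\<lambda>(g, y) (h, x). (gmult H g h, x))"
  and ginv_S: "ginv S = (\<lambda>(h, x). (ginv H h, \<theta> h x))"
  by (simp_all add: semidirect_def Let_def)

lemma topspace_T: "topspace T = {(h, x). h \<in> arrows H \<and> x \<in> topspace X \<and> gdom H h = p x}"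
  by (auto simp: fiber_product_def)

lemma anchor_unit: "x \<in> topspace X \<Longrightarrow> p x \<in> gunits H"
  using continuous_anchor by (auto simp: continuous_map_def)

lemma act_closed: "h \<in> arrows H \<Longrightarrow> x \<in> topspace X \<Longrightarrow> gdom H h = p x \<Longrightarrow> \<theta> h x \<in> topspace X"
  using continuous_act topspace_T by (auto simp: continuous_map_def Pi_iff)

lemma act_inv:
  assumes "h \<in> arrows H" "x \<in> topspace X" "gdom H h = p x"
  shows "\<theta> (ginv H h) (\<theta> h x) = x"
  using assms act_mult[of "ginv H h" h x] act_unit[of x] by (simp add: inv_closed dom_inv mult_inv_left)

lemma act_inv':
  assumes "h \<in> arrows H" "x \<in> topspace X" "gran H h = p x"
  shows "\<theta> h (\<theta> (ginv H h) x) = x"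
  using assms act_inv[of "ginv H h" x] by (simp add: inv_closed dom_inv inv_inv)

lemma inv_act:
  assumes "h \<in> arrows H" "x \<in> topspace X" "gran H h = p x"
  shows "\<theta> (ginv H h) x \<in> topspace X" "p (\<theta> (ginv H h) x) = gdom H h"
  using assms by (simp_all add: act_closed inv_closed dom_inv anchor_act ran_inv)

lemma continuous_map_into_T:
  "continuous_map A T (\<lambda>z. (f z, g z)) \<longleftrightarrow>
    continuous_map A (gtop H) f \<and> continuous_map A X g \<and> (\<forall>z\<in>topspace A. gdom H (f z) = p (g z))"
  by (auto simp: fiber_product_def continuous_map_in_subtopology continuous_map_paired)

lemma continuous_map_act:
  assumes "continuous_map A (gtop H) f" "continuous_map A X g"
    "\<And>z. z \<in> topspace A \<Longrightarrow> gdom H (f z) = p (g z)"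
  shows "continuous_map A X (\<lambda>z. \<theta> (f z) (g z))"
proof -
  have "continuous_map A T (\<lambda>z. (f z, g z))" using assms continuous_map_into_T by blast
  then show ?thesis
    using continuous_map_compose[OF _ continuous_act, of A "\<lambda>z. (f z, g z)"] by (simp add: o_def)
qed

lemma continuous_T_fst: "continuous_map T (gtop H) fst"
  and continuous_T_snd: "continuous_map T X snd"
  unfolding fiber_product_def by (rule continuous_map_subtopology_fst continuous_map_subtopology_snd)+

lemma continuous_map_anchor:
  "continuous_map A X f \<Longrightarrow> continuous_map A (gtop H) (\<lambda>z. p (f z))"
  using continuous_map_compose[OF _ continuous_anchor, of A f]
  by (simp add: o_def continuous_map_unit_top_arrows)

lemma continuous_act_T: "continuous_map T X (\<lambda>z. \<theta> (fst z) (snd z))"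
  by (intro continuous_map_act continuous_T_fst continuous_T_snd) (auto simp: topspace_T)

lemma unit_in_T: "x \<in> topspace X \<Longrightarrow> (p x, x) \<in> topspace T"
  by (simp add: topspace_T anchor_unit unit_arrow unit_dom)

lemma continuous_map_S_units:
  assumes "continuous_map A X f"
  shows "continuous_map A (unit_top S) (\<lambda>z. (p (f z), f z))"
proof -
  have f: "f z \<in> topspace X" if "z \<in> topspace A" for z
    using assms that by (auto simp: continuous_map_def)
  have "continuous_map A T (\<lambda>z. (p (f z), f z))"
    using assms f continuous_map_anchor[OF assms]
    by (auto simp: continuous_map_into_T anchor_unit unit_dom)
  then show ?thesis
    unfolding unit_top_def gtop_S gunits_S using f by (auto simp: continuous_map_in_subtopology)
qed

lemma topological_groupoid_S: "topological_groupoid S"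
proof (unfold_locales, unfold gtop_S gunits_S gdom_S gran_S gmult_S ginv_S)
  show "(\<lambda>x. (p x, x)) ` topspace X \<subseteq> topspace T" using unit_in_T by blast
next
  fix g assume "g \<in> topspace T"
  then show "(case g of (h, x) \<Rightarrow> (p x, x)) \<in> (\<lambda>x. (p x, x)) ` topspace X" by (auto simp: topspace_T)
next
  fix g assume "g \<in> topspace T"
  then show "(case g of (h, x) \<Rightarrow> (p (\<theta> h x), \<theta> h x)) \<in> (\<lambda>x. (p x, x)) ` topspace X"
    by (auto simp: topspace_T act_closed)
next
  fix u assume "u \<in> (\<lambda>x. (p x, x)) ` topspace X"
  then show "(case u of (h, x) \<Rightarrow> (p x, x)) = u" by auto
next
  fix u assume "u \<in> (\<lambda>x. (p x, x)) ` topspace X"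
  then show "(case u of (h, x) \<Rightarrow> (p (\<theta> h x), \<theta> h x)) = u" by (auto simp: act_unit)
next
  fix g h assume "g \<in> topspace T" "h \<in> topspace T"
    "(case g of (h, x) \<Rightarrow> (p x, x)) = (case h of (h, x) \<Rightarrow> (p (\<theta> h x), \<theta> h x))"
  then show "(case g of (g, y) \<Rightarrow> \<lambda>(h, x). (gmult H g h, x)) h \<in> topspace T"
    by (auto simp: topspace_T anchor_act mult_closed dom_mult)
next
  fix g h assume "g \<in> topspace T" "h \<in> topspace T"
    "(case g of (h, x) \<Rightarrow> (p x, x)) = (case h of (h, x) \<Rightarrow> (p (\<theta> h x), \<theta> h x))"
  then show "(case (case g of (g, y) \<Rightarrow> \<lambda>(h, x). (gmult H g h, x)) h of (h, x) \<Rightarrow> (p x, x)) =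
      (case h of (h, x) \<Rightarrow> (p x, x))"
    by (auto split: prod.splits)
next
  fix g h assume "g \<in> topspace T" "h \<in> topspace T"
    "(case g of (h, x) \<Rightarrow> (p x, x)) = (case h of (h, x) \<Rightarrow> (p (\<theta> h x), \<theta> h x))"
  then show "(case (case g of (g, y) \<Rightarrow> \<lambda>(h, x). (gmult H g h, x)) h of (h, x) \<Rightarrow> (p (\<theta> h x), \<theta> h x)) =
      (case g of (h, x) \<Rightarrow> (p (\<theta> h x), \<theta> h x))"
    by (auto simp: topspace_T anchor_act act_mult[symmetric])
next
  fix g h k assume "g \<in> topspace T" "h \<in> topspace T" "k \<in> topspace T"
    "(case g of (h, x) \<Rightarrow> (p x, x)) = (case h of (h, x) \<Rightarrow> (p (\<theta> h x), \<theta> h x))"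
    "(case h of (h, x) \<Rightarrow> (p x, x)) = (case k of (h, x) \<Rightarrow> (p (\<theta> h x), \<theta> h x))"
  then show "(case (case g of (g, y) \<Rightarrow> \<lambda>(h, x). (gmult H g h, x)) h of (g, y) \<Rightarrow> \<lambda>(h, x). (gmult H g h, x)) k =
      (case g of (g, y) \<Rightarrow> \<lambda>(h, x). (gmult H g h, x))
       ((case h of (g, y) \<Rightarrow> \<lambda>(h, x). (gmult H g h, x)) k)"
    by (auto simp: topspace_T anchor_act mult_assoc)
next
  fix g assume "g \<in> topspace T"
  then show "(case case g of (h, x) \<Rightarrow> (p (\<theta> h x), \<theta> h x) of (g, y) \<Rightarrow> \<lambda>(h, x). (gmult H g h, x)) g = g"
    by (auto simp: topspace_T anchor_act mult_unit_left)
next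
  fix g assume "g \<in> topspace T"
  then show "(case g of (g, y) \<Rightarrow> \<lambda>(h, x). (gmult H g h, x)) (case g of (h, x) \<Rightarrow> (p x, x)) = g"
    by (auto simp: topspace_T) (metis mult_unit_right)
next
  fix g assume "g \<in> topspace T"
  then show "(case g of (h, x) \<Rightarrow> (ginv H h, \<theta> h x)) \<in> topspace T"
    by (auto simp: topspace_T inv_closed act_closed dom_inv anchor_act)
next
  fix g assume "g \<in> topspace T"
  then show "(case case g of (h, x) \<Rightarrow> (ginv H h, \<theta> h x) of (h, x) \<Rightarrow> (p x, x)) =
      (case g of (h, x) \<Rightarrow> (p (\<theta> h x), \<theta> h x))" by (auto split: prod.splits)
next
  fix g assume "g \<in> topspace T"
  then show "(case case g of (h, x) \<Rightarrow> (ginv H h, \<theta> h x) of (h, x) \<Rightarrow> (p (\<theta> h x), \<theta> h x)) =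
      (case g of (h, x) \<Rightarrow> (p x, x))"
    by (auto simp: topspace_T act_inv)
next
  fix g assume "g \<in> topspace T"
  then show "(case case g of (h, x) \<Rightarrow> (ginv H h, \<theta> h x) of (g, y) \<Rightarrow> \<lambda>(h, x). (gmult H g h, x)) g =
      (case g of (h, x) \<Rightarrow> (p x, x))"
    by (auto simp: topspace_T mult_inv_left)
next
  fix g assume "g \<in> topspace T"
  then show "(case g of (g, y) \<Rightarrow> \<lambda>(h, x). (gmult H g h, x)) (case g of (h, x) \<Rightarrow> (ginv H h, \<theta> h x)) =
      (case g of (h, x) \<Rightarrow> (p (\<theta> h x), \<theta> h x))"
    by (auto simp: topspace_T mult_inv_right anchor_act)
next
  show "continuous_map T (unit_top S) (\<lambda>(h, x). (p x, x))"
    using continuous_map_S_units[OF continuous_T_snd] by (simp add: case_prod_beta')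
  show "continuous_map T (unit_top S) (\<lambda>(h, x). (p (\<theta> h x), \<theta> h x))"
    using continuous_map_S_units[OF continuous_act_T] by (simp add: case_prod_beta')
  let ?A = "fiber_product T T (\<lambda>(h, x). (p x, x)) (\<lambda>(h, x). (p (\<theta> h x), \<theta> h x))"
  have A: "continuous_map ?A T fst" "continuous_map ?A T snd"
    unfolding fiber_product_def[of T] by (rule continuous_map_subtopology_fst continuous_map_subtopology_snd)+
  have A': "continuous_map ?A (gtop H) (\<lambda>z. fst (fst z))" "continuous_map ?A (gtop H) (\<lambda>z. fst (snd z))"
    "continuous_map ?A X (\<lambda>z. snd (snd z))"
    using continuous_map_compose[OF A(1) continuous_T_fst] continuous_map_compose[OF A(2) continuous_T_fst]
      continuous_map_compose[OF A(2) continuous_T_snd] by (simp_all add: o_def)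
  have tA: "gdom H (fst (fst z)) = gran H (fst (snd z)) \<and> gdom H (fst (snd z)) = p (snd (snd z))
      \<and> fst (fst z) \<in> arrows H \<and> fst (snd z) \<in> arrows H" if "z \<in> topspace ?A" for z
    using that unfolding fiber_product_def[of T] by (auto simp: topspace_T anchor_act)
  have "continuous_map ?A T (\<lambda>z. (gmult H (fst (fst z)) (fst (snd z)), snd (snd z)))"
    unfolding continuous_map_into_T using A' tA by (auto intro!: continuous_map_mult simp: dom_mult)
  then show "continuous_map ?A T (\<lambda>(g, h). (case g of (g, y) \<Rightarrow> \<lambda>(h, x). (gmult H g h, x)) h)"
    by (simp add: case_prod_beta')
  have "continuous_map T T (\<lambda>z. (ginv H (fst z), \<theta> (fst z) (snd z)))"
    unfolding continuous_map_into_T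
    using continuous_map_inv[OF continuous_T_fst] continuous_act_T
    by (auto simp: topspace_T dom_inv anchor_act)
  then show "continuous_map T T (\<lambda>(h, x). (ginv H h, \<theta> h x))" by (simp add: case_prod_beta')
qed

sublocale S: topological_groupoid S
  by (rule topological_groupoid_S)

section \<open>Units, base and range fibres of the semidirect product\<close>

lemma homeomorphic_units: "homeomorphic_maps X (unit_top S) (\<lambda>x. (p x, x)) snd"
  unfolding homeomorphic_maps_def
proof (intro conjI)
  show "continuous_map X (unit_top S) (\<lambda>x. (p x, x))"
    using continuous_map_S_units[OF continuous_map_id[of X]] by (simp add: id_def)
  show "continuous_map (unit_top S) X snd"
    unfolding unit_top_def gtop_S using continuous_T_snd by (rule continuous_map_from_subtopology)
  show "\<forall>y\<in>topspace (unit_top S). (p (snd y), snd y) = y"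
    using gunits_S by auto
qed simp

lemma base_T: "locally_compact_Hausdorff_base T"
  by (intro base_fiber_product continuous_anchor locally_compact_Hausdorff_imp_base
      X_locally_compact X_Hausdorff)

lemma second_countable_T: "second_countable T"
  unfolding fiber_product_def
  by (intro second_countable_subtopology second_countable_prod_topology second_countable X_second_countable)

text \<open>An arrow (h,y) with range x has y = h^-1 x, so it is determined by h. The fibre over x
  is therefore a copy of the fibre of \<open>H\<close> over \<open>p x\<close>.\<close>

lemma homeomorphic_fiber:
  assumes x: "x \<in> topspace X"
  shows "homeomorphic_maps (ran_fiber H (p x)) (ran_fiber S (p x, x)) (\<lambda>h. (h, \<theta> (ginv H h) x)) fst"
  unfolding homeomorphic_maps_def
proof (intro conjI)
  have H: "continuous_map (ran_fiber H (p x)) (gtop H) (\<lambda>h. h)"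
    unfolding ran_fiber_def
    using continuous_map_from_subtopology[OF continuous_map_id[of "gtop H"]] by (simp add: id_def)
  have "continuous_map (ran_fiber H (p x)) X (\<lambda>h. \<theta> (ginv H h) x)"
    using x continuous_map_inv[OF H] by (intro continuous_map_act) (auto simp: topspace_ran_fiber dom_inv)
  then have "continuous_map (ran_fiber H (p x)) T (\<lambda>h. (h, \<theta> (ginv H h) x))"
    unfolding continuous_map_into_T using H x by (auto simp: topspace_ran_fiber inv_act)
  then show "continuous_map (ran_fiber H (p x)) (ran_fiber S (p x, x)) (\<lambda>h. (h, \<theta> (ginv H h) x))"
    unfolding ran_fiber_def[of S] gtop_S gran_S
    using x by (auto simp: continuous_map_in_subtopology topspace_ran_fiber act_inv')
  have "continuous_map (ran_fiber S (p x, x)) (gtop H) fst"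
    unfolding ran_fiber_def gtop_S using continuous_T_fst by (rule continuous_map_from_subtopology)
  then show "continuous_map (ran_fiber S (p x, x)) (ran_fiber H (p x)) fst"
    unfolding ran_fiber_def[of H]
    by (auto simp: continuous_map_in_subtopology S.topspace_ran_fiber gtop_S gran_S topspace_T anchor_act)
  show "\<forall>y\<in>topspace (ran_fiber S (p x, x)). (fst y, \<theta> (ginv H (fst y)) x) = y"
    by (auto simp: S.topspace_ran_fiber gtop_S gran_S topspace_T act_inv)
qed simp

abbreviation j :: "'x \<Rightarrow> 'h \<Rightarrow> 'h \<times> 'x"
  where "j x h \<equiv> (h, \<theta> (ginv H h) x)"

lemma j_in_T: "x \<in> topspace X \<Longrightarrow> h \<in> arrows H \<Longrightarrow> gran H h = p x \<Longrightarrow> j x h \<in> topspace T"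
  by (simp add: topspace_T inv_act)

text \<open>Since \<open>fst\<close> inverts \<open>j x\<close> on the fibre, measuring the
  projection of a set is pushing the measure of \<open>H\<close> forward along
  \<open>j x\<close>.\<close>

lemma haar_S:
  assumes x: "x \<in> topspace X"
  shows "haar S (p x, x) = distr (haar H (p x)) (borel_of (ran_fiber S (p x, x))) (j x)"
proof -
  have "haar S (p x, x) = measure_of (topspace (ran_fiber S (p x, x))) {U. openin (ran_fiber S (p x, x)) U}
      (\<lambda>B. emeasure (haar H (p x)) (fst ` B))"
    by (simp add: semidirect_def Let_def ran_fiber_def)
  also have "\<dots> = distr (haar H (p x)) (borel_of (ran_fiber S (p x, x))) (j x)"
    using homeomorphic_fiber[OF x] regular_borel_measure_sets[OF regular_haar[OF anchor_unit[OF x]]]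
    by (rule pushforward_homeomorphic_eq_distr)
  finally show ?thesis .
qed

lemma measurable_j:
  assumes x: "x \<in> topspace X"
  shows "j x \<in> haar H (p x) \<rightarrow>\<^sub>M borel_of (ran_fiber S (p x, x))"
proof -
  have "j x \<in> borel_of (ran_fiber H (p x)) \<rightarrow>\<^sub>M borel_of (ran_fiber S (p x, x))"
    using homeomorphic_fiber[OF x] unfolding homeomorphic_maps_def by (intro continuous_map_measurable) simp
  then show ?thesis
    using measurable_cong_sets[OF regular_borel_measure_sets[OF regular_haar[OF anchor_unit[OF x]]] refl]
    by blast
qed

lemma integral_S:
  fixes f :: "'h \<times> 'x \<Rightarrow> complex"
  assumes "x \<in> topspace X" "f \<in> borel_measurable (borel_of (ran_fiber S (p x, x)))"
  shows "(\<integral>z. f z \<partial>haar S (p x, x)) = (\<integral>h. f (j x h) \<partial>haar H (p x))"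
  unfolding haar_S[OF assms(1)] using measurable_j[OF assms(1)] assms(2) by (rule integral_distr)

text \<open>As \<open>X\<close> is Hausdorff, the tube over a Hausdorff open set is Hausdorff, although \<open>H\<close> need not be.\<close>

definition tube :: "'h set \<Rightarrow> ('h \<times> 'x) set"
  where "tube V = {z \<in> topspace T. fst z \<in> V}"

lemma openin_tube: "openin (gtop H) V \<Longrightarrow> openin T (tube V)"
  unfolding tube_def using continuous_T_fst by (rule openin_continuous_map_preimage)

lemma Hausdorff_tube:
  assumes "Hausdorff_space (subtopology (gtop H) V)"
  shows "Hausdorff_space (subtopology T (tube V))"
proof -
  have "Hausdorff_space (prod_topology (subtopology (gtop H) V) X)"
    using assms X_Hausdorff by (simp add: Hausdorff_space_prod_topology)
  moreover have "prod_topology (subtopology (gtop H) V) X = subtopology (prod_topology (gtop H) X) (V \<times> topspace X)"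
    by (metis subtopology_Times subtopology_topspace)
  ultimately have "Hausdorff_space (subtopology (prod_topology (gtop H) X) (V \<times> topspace X))" by simp
  moreover have "subtopology T (tube V) = subtopology (prod_topology (gtop H) X) ({(a, b). gdom H a = p b} \<inter> tube V)"
    unfolding fiber_product_def[of "gtop H"] by (simp add: subtopology_subtopology)
  moreover have "{(a, b). gdom H a = p b} \<inter> tube V \<subseteq> V \<times> topspace X"
    by (auto simp: tube_def topspace_T)
  ultimately show ?thesis using Hausdorff_subtopology_mono by metis
qed

text \<open>The slice lives on the part of \<open>V\<close> over the unit \<open>p x\<close>, which
  is closed in the locally compact Hausdorff space \<open>V\<close>, and it has compact support
  there. Tietze extension inside \<open>V\<close> therefore applies.\<close>

lemma slice_extension_tube:
  assumes V: "openin (gtop H) V" "Hausdorff_space (subtopology (gtop H) V)"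
    and f: "f \<in> Cc_on T (tube V)" and x: "x \<in> topspace X"
  shows "\<exists>b\<in>Cc_on (gtop H) V. \<forall>h\<in>arrows H. gran H h = p x \<longrightarrow> b h = f (j x h)"
proof -
  let ?Y = "subtopology (gtop H) V"
  let ?F = "{h \<in> arrows H. gran H h = p x}"
  let ?E = "V \<inter> ?F"
  have Vs: "V \<subseteq> arrows H" using openin_subset[OF V(1)] .
  have tY: "topspace ?Y = V" using Vs by auto
  have lcY: "locally_compact_space ?Y"
    by (rule locally_compact_Hausdorff_base_open_subset[OF base V(1)])
  obtain K where K: "compactin T K" "K \<subseteq> tube V" "\<And>z. z \<notin> K \<Longrightarrow> f z = 0"
    and cf: "continuous_map (subtopology T (tube V)) euclidean f"
    using f unfolding Cc_on_def by blast
  have E: "closedin ?Y ?E"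
    using closed_fiber[OF anchor_unit[OF x]] by (rule closedin_subtopology_Int_closed)
  \<comment> \<open>The arrows of the support with range x, projected to \<open>H\<close>. The
    condition on the range is closed because X is Hausdorff, which keeps this set compact.\<close>
  define K' where "K' = fst ` (K \<inter> {z \<in> topspace T. \<theta> (fst z) (snd z) = x})"
  have "closedin T {z \<in> topspace T. \<theta> (fst z) (snd z) \<in> {x}}"
    using continuous_act_T closedin_Hausdorff_sing_eq[OF X_Hausdorff] x
    by (intro closedin_continuous_map_preimage) auto
  then have "compactin T (K \<inter> {z \<in> topspace T. \<theta> (fst z) (snd z) = x})"
    using K(1) by (simp add: compact_Int_closedin)
  then have "compactin (gtop H) K'"
    unfolding K'_def using continuous_T_fst by (rule image_compactin)
  moreover have K'E: "K' \<subseteq> ?E"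
    using K(2) by (auto simp: K'_def tube_def topspace_T anchor_act)
  ultimately have K'c: "compactin ?Y K'" by (simp add: compactin_subtopology)
  have f0: "f (j x h) = 0" if h: "h \<in> ?E - K'" for h
  proof (rule ccontr)
    assume "f (j x h) \<noteq> 0"
    then have "j x h \<in> K" using K(3) by blast
    moreover have "\<theta> h (\<theta> (ginv H h) x) = x" "j x h \<in> topspace T"
      using h x by (auto simp: act_inv' j_in_T)
    ultimately have "h \<in> K'" unfolding K'_def by force
    then show False using h by blast
  qed
  have "continuous_map (subtopology ?Y ?E) (subtopology T (tube V)) (j x)"
  proof -
    have "continuous_map (ran_fiber H (p x)) (ran_fiber S (p x, x)) (j x)"
      using homeomorphic_fiber[OF x] unfolding homeomorphic_maps_def by blast
    then have "continuous_map (ran_fiber H (p x)) T (j x)"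
      unfolding ran_fiber_def[of S] gtop_S by (rule continuous_map_into_fulltopology)
    then have "continuous_map (subtopology (gtop H) ?F) T (j x)" by (simp add: ran_fiber_eq)
    then have "continuous_map (subtopology (gtop H) ?E) T (j x)"
      by (rule continuous_map_from_subtopology_mono) blast
    then show ?thesis
      using x by (auto simp: continuous_map_in_subtopology subtopology_subtopology tube_def j_in_T Int_absorb1)
  qed
  then have cont: "continuous_map (subtopology ?Y ?E) euclidean (\<lambda>h. f (j x h))"
    using continuous_map_compose[OF _ cf] by (simp add: o_def)
  obtain b L where b: "continuous_map ?Y euclidean b" "compactin ?Y L" "\<And>h. h \<notin> L \<Longrightarrow> b h = 0"
    "\<And>h. h \<in> ?E \<Longrightarrow> b h = f (j x h)"
    using lcY V(2) E cont K'c K'E f0 by (rule compact_support_extension) (assumption, (rule that; assumption?))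
  have "b \<in> Cc_on (gtop H) V"
    using b unfolding Cc_on_def by (auto simp: compactin_subtopology)
  moreover have "b h = f (j x h)" if h: "h \<in> arrows H" "gran H h = p x" for h
  proof (cases "h \<in> V")
    case True then show ?thesis using b(4) h by blast
  next
    case False
    then have "h \<notin> L" using b(2) by (auto simp: compactin_subtopology)
    moreover have "j x h \<notin> K" using K(2) False by (auto simp: tube_def)
    ultimately show ?thesis using b(3) K(3) by simp
  qed
  ultimately show ?thesis by blast
qed

text \<open>Tubes over Hausdorff open subsets of \<open>H\<close> cover \<open>T\<close>, so the
  partition of unity leaves only functions supported over one such subset.\<close>

lemma Cc_T_induct [consumes 1, case_names zero add tube]:
  assumes f: "f \<in> Cc T" and zero: "P (\<lambda>_. 0)"
    and add: "\<And>f g. P f \<Longrightarrow> P g \<Longrightarrow> P (\<lambda>z. f z + g z)"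
    and tube: "\<And>f V. openin (gtop H) V \<Longrightarrow> Hausdorff_space (subtopology (gtop H) V) \<Longrightarrow>
      f \<in> Cc_on T (tube V) \<Longrightarrow> P f"
  shows "P f"
  using base_T f
proof (induction rule: Cc_induct[where
      Q = "\<lambda>W. \<exists>V. openin (gtop H) V \<and> Hausdorff_space (subtopology (gtop H) V) \<and> W = tube V"])
  case (cover z)
  then have "fst z \<in> arrows H" by (auto simp: topspace_T)
  then obtain V where "openin (gtop H) V" "Hausdorff_space (subtopology (gtop H) V)" "fst z \<in> V"
    using locally_compact_Hausdorff_base_imp_open[OF base openin_topspace] by metis
  moreover have "z \<in> tube V" using cover calculation by (simp add: tube_def)
  ultimately show ?case using openin_tube by blast
next
  case (on g U W)
  then obtain V where V: "openin (gtop H) V" "Hausdorff_space (subtopology (gtop H) V)" "W = tube V"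
    by blast
  \<comment> \<open>The support may be regarded as lying in the whole tube because the tube is
    itself Hausdorff.\<close>
  have "g \<in> Cc_on T (tube V)"
    by (rule Cc_on_mono[OF on(6,3)])
      (use on(5) V(3) Hausdorff_tube[OF V(2)] openin_subset[OF openin_tube[OF V(1)]] in simp_all)
  then show ?case by (rule tube[OF V(1,2)])
qed (rule zero add; assumption)+

text \<open>On a single fibre, a function on \<open>T\<close> is indistinguishable from a
  \<open>Cc\<close> function on \<open>H\<close>. Integrability and left invariance for the
  semidirect product are borrowed from \<open>H\<close> in this way.\<close>

lemma slice_extension:
  assumes "f \<in> Cc T" and x: "x \<in> topspace X"
  shows "\<exists>b\<in>Cc (gtop H). \<forall>h\<in>arrows H. gran H h = p x \<longrightarrow> b h = f (j x h)"
  using assms(1)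
proof (induction rule: Cc_T_induct)
  case zero
  show ?case using Cc_zero by (intro bexI[of _ "\<lambda>_. 0"]) auto
next
  case (add f g)
  then obtain b c where "b \<in> Cc (gtop H)" "\<forall>h\<in>arrows H. gran H h = p x \<longrightarrow> b h = f (j x h)"
    "c \<in> Cc (gtop H)" "\<forall>h\<in>arrows H. gran H h = p x \<longrightarrow> c h = g (j x h)" by blast
  then show ?case by (intro bexI[of _ "\<lambda>h. b h + c h"]) (auto simp: Cc_add)
next
  case (tube f V)
  then obtain b where "b \<in> Cc_on (gtop H) V" "\<forall>h\<in>arrows H. gran H h = p x \<longrightarrow> b h = f (j x h)"
    using slice_extension_tube[OF _ _ _ x] by blast
  then show ?case using tube Cc_on_imp_Cc by blast
qed

lemma slice_integrable:
  assumes "f \<in> Cc T" and x: "x \<in> topspace X"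
  shows "integrable (haar H (p x)) (\<lambda>h. f (j x h))"
proof -
  obtain b where b: "b \<in> Cc (gtop H)" "\<forall>h\<in>arrows H. gran H h = p x \<longrightarrow> b h = f (j x h)"
    using slice_extension[OF assms] by blast
  have "integrable (haar H (p x)) b" using Cc_integrable[OF b(1) anchor_unit[OF x]] .
  then show ?thesis
    using b(2) space_haar[OF anchor_unit[OF x]]
    by (subst Bochner_Integration.integrable_cong[OF refl, of _ _ b]) auto
qed

section \<open>Continuity and support of the fibre integrals\<close>

definition I :: "('h \<times> 'x \<Rightarrow> complex) \<Rightarrow> 'x \<Rightarrow> complex"
  where "I f x = (\<integral>h. f (j x h) \<partial>haar H (p x))"

text \<open>
  In the coordinates \<open>(h, \<theta> h x)\<close> the bad set is closed over the compact set \<open>M\<close>, and projecting along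
  a compact space is a closed map.
\<close>

lemma slice_uniform:
  assumes V: "openin (gtop H) V" and f: "f \<in> Cc_on T (tube V)" and b: "b \<in> Cc_on (gtop H) V"
    and M: "compactin (gtop H) M" "M \<subseteq> V"
    and y: "y \<in> topspace X" "\<And>h. h \<in> M \<Longrightarrow> gran H h = p y \<Longrightarrow> b h = f (j y h)" and e: "0 < e"
  shows "\<exists>N. openin X N \<and> y \<in> N \<and> (\<forall>x\<in>N. \<forall>h\<in>M. gran H h = p x \<longrightarrow> norm (f (j x h) - b h) < e)"
proof -
  let ?HM = "subtopology (gtop H) M"
  let ?P = "prod_topology ?HM X"
  let ?W = "subtopology T (tube V)"
  have Ms: "M \<subseteq> arrows H" using compactin_subset_topspace[OF M(1)] .
  have tP: "topspace ?P = M \<times> topspace X" using Ms by auto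
  have cf: "continuous_map ?W euclidean f" and cb: "continuous_map (subtopology (gtop H) V) euclidean b"
    using f b unfolding Cc_on_def by auto
  have "continuous_map ?W (subtopology (gtop H) V) fst"
    using continuous_map_from_subtopology[OF continuous_T_fst]
    by (auto simp: continuous_map_in_subtopology tube_def)
  then have "continuous_map ?W euclidean (\<lambda>z. b (fst z))"
    using continuous_map_compose[OF _ cb] by (auto simp: o_def)
  \<comment> \<open>The comparison is made over the tube, where both functions are continuous;
    neither need be so on all of \<open>T\<close>.\<close>
  then have D: "continuous_map ?W euclideanreal (\<lambda>z. norm (f z - b (fst z)))"
    using cf by (intro continuous_map_norm continuous_map_diff)
  define Z where "Z = {z \<in> topspace ?P. gran H (fst z) = p (snd z)}"
  have c1: "continuous_map ?P (gtop H) fst"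
    using continuous_map_fst[of ?HM X] by (rule continuous_map_into_fulltopology)
  have Z: "closedin ?P Z"
    unfolding Z_def using units_Hausdorff continuous_map_ran[OF c1]
      continuous_map_compose[OF continuous_map_snd continuous_anchor]
    by (intro closedin_equalizer) (auto simp: o_def)
  have c1Z: "continuous_map (subtopology ?P Z) (gtop H) fst" "continuous_map (subtopology ?P Z) X snd"
    using continuous_map_from_subtopology[OF c1] continuous_map_from_subtopology[OF continuous_map_snd] by auto
  have tZ: "z \<in> topspace (subtopology ?P Z) \<longleftrightarrow> fst z \<in> M \<and> snd z \<in> topspace X \<and> gran H (fst z) = p (snd z)" for z
    using Ms by (cases z) (auto simp: Z_def)
  have "continuous_map (subtopology ?P Z) X (\<lambda>z. \<theta> (ginv H (fst z)) (snd z))"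
    using continuous_map_inv[OF c1Z(1)] c1Z(2) tZ Ms
    by (intro continuous_map_act) (auto simp: dom_inv subset_iff)
  then have "continuous_map (subtopology ?P Z) T (\<lambda>z. j (snd z) (fst z))"
    unfolding continuous_map_into_T using c1Z tZ Ms by (auto simp: inv_act subset_iff)
  then have "continuous_map (subtopology ?P Z) ?W (\<lambda>z. j (snd z) (fst z))"
    using tZ Ms M(2) by (auto simp: continuous_map_in_subtopology tube_def j_in_T subset_iff)
  then have "continuous_map (subtopology ?P Z) euclideanreal (\<lambda>z. norm (f (j (snd z) (fst z)) - b (fst z)))"
    using continuous_map_compose[OF _ D, of "subtopology ?P Z" "\<lambda>z. j (snd z) (fst z)"] by (simp add: o_def)
  then have "closedin (subtopology ?P Z) {z \<in> topspace (subtopology ?P Z).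
      norm (f (j (snd z) (fst z)) - b (fst z)) \<in> {e..}}" (is "closedin _ ?C")
    by (rule closedin_continuous_map_preimage) simp
  then have "closedin ?P ?C" using Z closedin_trans_full by blast
  moreover have "closed_map ?P X snd"
    using M(1) by (intro closed_map_snd) (simp add: compact_space_subtopology)
  ultimately have C: "closedin X (snd ` ?C)" unfolding closed_map_def by blast
  show ?thesis
  proof (intro exI conjI)
    show "openin X (topspace X - snd ` ?C)" using C by blast
    show "y \<in> topspace X - snd ` ?C"
    proof
      show "y \<notin> snd ` ?C"
      proof
        assume "y \<in> snd ` ?C"
        then obtain z where z: "z \<in> ?C" "y = snd z" by blast
        then have "fst z \<in> M" "gran H (fst z) = p y" using tZ by auto
        then have "norm (f (j (snd z) (fst z)) - b (fst z)) = 0" using y(2) z(2) by simp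
        then show False using z(1) e by auto
      qed
    qed fact
    show "\<forall>x\<in>topspace X - snd ` ?C. \<forall>h\<in>M. gran H h = p x \<longrightarrow> norm (f (j x h) - b h) < e"
    proof (intro ballI impI)
      fix x h assume x: "x \<in> topspace X - snd ` ?C" and h: "h \<in> M" "gran H h = p x"
      have "(h, x) \<in> topspace (subtopology ?P Z)" using tZ[of "(h, x)"] x h by simp
      moreover have "(h, x) \<notin> ?C" using x by force
      ultimately show "norm (f (j x h) - b h) < e" by (simp add: not_le)
    qed
  qed
qed

lemma continuous_I_tube:
  assumes V: "openin (gtop H) V" "Hausdorff_space (subtopology (gtop H) V)"
    and f: "f \<in> Cc_on T (tube V)"
  shows "continuous_map X euclidean (I f)"
proof (rule continuous_map_euclidean_dist)
  fix y and e :: real assume y: "y \<in> topspace X" and e: "0 < e"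
  let ?Y = "subtopology (gtop H) V"
  have fT: "f \<in> Cc T" using Cc_on_imp_Cc[OF f openin_tube[OF V(1)] Hausdorff_tube[OF V(2)]] .
  have Vs: "V \<subseteq> arrows H" using openin_subset[OF V(1)] .
  have tY: "topspace ?Y = V" using Vs by auto
  have lcY: "locally_compact_space ?Y"
    by (rule locally_compact_Hausdorff_base_open_subset[OF base V(1)])
  obtain b where b: "b \<in> Cc_on (gtop H) V" "\<forall>h\<in>arrows H. gran H h = p y \<longrightarrow> b h = f (j y h)"
    using slice_extension_tube[OF V f y] by blast
  have bC: "b \<in> Cc (gtop H)" using Cc_on_imp_Cc[OF b(1) V] .
  obtain K where K: "compactin T K" "K \<subseteq> tube V" "\<And>z. z \<notin> K \<Longrightarrow> f z = 0"
    using f unfolding Cc_on_def by blast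
  obtain L where L: "compactin (gtop H) L" "L \<subseteq> V" "\<And>h. h \<notin> L \<Longrightarrow> b h = 0"
    using b(1) unfolding Cc_on_def by blast
  \<comment> \<open>Off \<open>M\<close> both \<open>b\<close> and every slice of \<open>f\<close>
    vanish, so the slices have to be compared only on this compact set.\<close>
  define M where "M = L \<union> fst ` K"
  have M: "compactin (gtop H) M" "M \<subseteq> V"
    unfolding M_def using L image_compactin[OF K(1) continuous_T_fst] K(2)
    by (auto simp: compactin_Un tube_def)
  then have MY: "compactin ?Y M" by (simp add: compactin_subtopology)
  obtain \<eta> L' where \<eta>: "continuous_map ?Y euclideanreal \<eta>" "compactin ?Y L'" "L' \<subseteq> topspace ?Y"
    "\<And>x. x \<in> topspace ?Y \<Longrightarrow> 0 \<le> \<eta> x \<and> \<eta> x \<le> 1" "\<And>x. x \<in> M \<Longrightarrow> \<eta> x = 1"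
    "\<And>x. x \<in> topspace ?Y - L' \<Longrightarrow> \<eta> x = 0"
    using compact_cutoff[OF lcY V(2) MY openin_topspace compactin_subset_topspace[OF MY]] by metis
  \<comment> \<open>A cutoff that is 1 on \<open>M\<close>. Its fibre integrals vary continuously,
    so they control the error over \<open>M\<close> uniformly for nearby fibres.\<close>
  define c where "c = (\<lambda>h. if h \<in> V then \<eta> h else 0)"
  have c0: "0 \<le> c h" for h using \<eta>(4)[of h, unfolded tY] by (simp add: c_def)
  have c1: "c h = 1" if "h \<in> M" for h using that \<eta>(5) M(2) by (auto simp: c_def)
  have cC: "(\<lambda>h. complex_of_real (c h)) \<in> Cc (gtop H)"
  proof -
    have "(\<lambda>x. if x \<in> V then complex_of_real (\<eta> x) else 0) \<in> Cc_on (gtop H) V"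
      using \<eta>(1,2) \<eta>(6)[unfolded tY] continuous_map_of_real[OF \<eta>(1)]
      by (intro Cc_on_restrict_subtopology[where K = L']) (auto simp: compactin_subtopology)
    moreover have "(\<lambda>x. if x \<in> V then complex_of_real (\<eta> x) else 0) = (\<lambda>h. complex_of_real (c h))"
      by (auto simp: c_def)
    ultimately show ?thesis using V Cc_on_imp_Cc by metis
  qed
  have cont: "continuous_map X euclidean (\<lambda>x. \<integral>h. k h \<partial>haar H (p x))" if "k \<in> Cc (gtop H)" for k
    using continuous_map_compose[OF continuous_anchor haar_continuous[OF that]] by (simp add: o_def)
  have cint: "integrable (haar H (p x)) c" if "x \<in> topspace X" for x
    using Cc_integrable[OF cC anchor_unit[OF that]] by (simp add: complex_of_real_integrable_eq)
  \<comment> \<open>The summand 1 matches the tolerance defining \<open>N3\<close>, so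
    \<open>C\<close> bounds the integral of \<open>c\<close> throughout \<open>N3\<close>; it also
    makes \<open>C\<close> positive. Slices closer than \<open>e / (2 * C)\<close> then contribute
    at most half of \<open>e\<close>, the integral of \<open>b\<close> the other half.\<close>
  define C where "C = (\<integral>h. c h \<partial>haar H (p y)) + 1"
  have "0 \<le> (\<integral>h. c h \<partial>haar H (p y))" using c0 by (simp add: integral_nonneg_AE)
  then have C: "0 < C" by (simp add: C_def)
  obtain N1 where N1: "openin X N1" "y \<in> N1"
    "\<forall>x\<in>N1. \<forall>h\<in>M. gran H h = p x \<longrightarrow> norm (f (j x h) - b h) < e / (2 * C)"
    using slice_uniform[OF V(1) f b(1) M y, of "e / (2 * C)"] b(2) M(2) Vs e C by auto
  obtain N2 where N2: "openin X N2" "y \<in> N2"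
    "\<forall>x\<in>N2. dist (\<integral>h. b h \<partial>haar H (p x)) (\<integral>h. b h \<partial>haar H (p y)) < e / 2"
    using continuous_map_euclidean_distD[OF cont[OF bC] y, of "e / 2"] e by auto
  obtain N3 where N3: "openin X N3" "y \<in> N3"
    "\<forall>x\<in>N3. dist (\<integral>h. complex_of_real (c h) \<partial>haar H (p x)) (\<integral>h. complex_of_real (c h) \<partial>haar H (p y)) < 1"
    using continuous_map_euclidean_distD[OF cont[OF cC] y, of 1] by auto
  have Iy: "I f y = (\<integral>h. b h \<partial>haar H (p y))"
    unfolding I_def using b(2) space_haar[OF anchor_unit[OF y]]
    by (intro Bochner_Integration.integral_cong) auto
  have "dist (I f x) (I f y) < e" if x: "x \<in> N1 \<inter> N2 \<inter> N3" for x
  proof -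
    have xX: "x \<in> topspace X" using x openin_subset[OF N1(1)] by blast
    have "norm (f (j x h) - b h) \<le> e / (2 * C) * c h" if h: "h \<in> space (haar H (p x))" for h
    proof (cases "h \<in> M")
      case True
      have "gran H h = p x" using h space_haar[OF anchor_unit[OF xX]] by simp
      then have "norm (f (j x h) - b h) < e / (2 * C)" using N1(3) x True by blast
      then show ?thesis using c1[OF True] by simp
    next
      case False
      then have "h \<notin> L" "j x h \<notin> K" unfolding M_def by force+
      then have "f (j x h) - b h = 0" using K(3) L(3) by simp
      then show ?thesis using c0 e C by simp
    qed
    then have "norm (\<integral>h. f (j x h) - b h \<partial>haar H (p x)) \<le> (\<integral>h. e / (2 * C) * c h \<partial>haar H (p x))"
      using slice_integrable[OF fT xX] Cc_integrable[OF bC anchor_unit[OF xX]] cint[OF xX]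
      by (intro norm_integral_le Bochner_Integration.integrable_diff
          integrable_mult_right) auto
    also have "\<dots> = e / (2 * C) * (\<integral>h. c h \<partial>haar H (p x))" by simp
    also have "\<dots> \<le> e / (2 * C) * C"
    proof (rule mult_left_mono)
      have "dist (\<integral>h. complex_of_real (c h) \<partial>haar H (p x)) (\<integral>h. complex_of_real (c h) \<partial>haar H (p y)) < 1"
        using N3(3) x by blast
      then have "\<bar>(\<integral>h. c h \<partial>haar H (p x)) - (\<integral>h. c h \<partial>haar H (p y))\<bar> < 1"
        by (simp add: dist_norm flip: of_real_diff)
      then show "(\<integral>h. c h \<partial>haar H (p x)) \<le> C" by (simp add: C_def)
    qed (use e C in simp)
    also have "\<dots> = e / 2" using C by simp
    finally have 1: "norm (I f x - (\<integral>h. b h \<partial>haar H (p x))) \<le> e / 2"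
      using slice_integrable[OF fT xX] Cc_integrable[OF bC anchor_unit[OF xX]]
      by (simp add: I_def)
    have "dist (\<integral>h. b h \<partial>haar H (p x)) (I f y) < e / 2" unfolding Iy using N2(3) x by blast
    moreover have "dist (I f x) (\<integral>h. b h \<partial>haar H (p x)) \<le> e / 2" using 1 by (simp add: dist_norm)
    ultimately show ?thesis using dist_triangle[of "I f x" "I f y" "\<integral>h. b h \<partial>haar H (p x)"] by linarith
  qed
  moreover have "openin X (N1 \<inter> N2 \<inter> N3)" "y \<in> N1 \<inter> N2 \<inter> N3" using N1 N2 N3 by auto
  ultimately show "\<exists>N. openin X N \<and> y \<in> N \<and> (\<forall>x\<in>N. dist (I f x) (I f y) < e)" by blast
qed

lemma haar_S_Cc:
  assumes "f \<in> Cc T"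
  shows "(\<lambda>u. if u \<in> gunits S then I f (snd u) else 0) \<in> Cc_on T (gunits S)"
proof -
  \<comment> \<open>Membership in \<open>Cc T\<close> is carried through the induction because
    additivity of the integral requires integrable slices.\<close>
  have "f \<in> Cc T \<and> (\<lambda>u. if u \<in> gunits S then I f (snd u) else 0) \<in> Cc_on T (gunits S)"
    using assms
  proof (induction rule: Cc_T_induct)
    case zero
    show ?case by (simp add: I_def Cc_zero Cc_on_zero cong: if_cong)
  next
    case (add f g)
    have "I (\<lambda>z. f z + g z) x = I f x + I g x" if "x \<in> topspace X" for x
      unfolding I_def using add slice_integrable that by simp
    then have "(\<lambda>u. if u \<in> gunits S then I (\<lambda>z. f z + g z) (snd u) else 0) =
      (\<lambda>u. (if u \<in> gunits S then I f (snd u) else 0) + (if u \<in> gunits S then I g (snd u) else 0))"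
      by (intro ext) (auto simp: gunits_S)
    then show ?case using add by (simp add: Cc_add Cc_on_add)
  next
    case (tube f V)
    obtain K where K: "compactin T K" "\<And>z. z \<notin> K \<Longrightarrow> f z = 0"
      using tube(3) unfolding Cc_on_def by blast
    \<comment> \<open>This is the range map. It sends the support of \<open>f\<close> to a compact
      set of units outside which every slice, and hence the integral, is zero.\<close>
    have c: "continuous_map T T (\<lambda>z. (p (\<theta> (fst z) (snd z)), \<theta> (fst z) (snd z)))"
      using S.continuous_map_unit_top_arrows[OF continuous_map_S_units[OF continuous_act_T]]
      by (simp add: gtop_S)
    have "continuous_map (subtopology T (gunits S)) euclidean (\<lambda>u. I f (snd u))"
      using continuous_map_compose[OF continuous_map_from_subtopology[OF continuous_T_snd]
          continuous_I_tube[OF tube]] by (simp add: o_def)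
    then have "(\<lambda>u. if u \<in> gunits S then I f (snd u) else 0) \<in> Cc_on T (gunits S)"
    proof (rule Cc_on_restrict_subtopology)
      show "compactin T ((\<lambda>z. (p (\<theta> (fst z) (snd z)), \<theta> (fst z) (snd z))) ` K)"
        using K(1) c by (rule image_compactin)
      show "(\<lambda>z. (p (\<theta> (fst z) (snd z)), \<theta> (fst z) (snd z))) ` K \<subseteq> gunits S"
        using compactin_subset_topspace[OF K(1)] by (auto simp: gunits_S topspace_T act_closed)
      fix u assume u: "u \<in> gunits S - (\<lambda>z. (p (\<theta> (fst z) (snd z)), \<theta> (fst z) (snd z))) ` K"
      then obtain x where x: "x \<in> topspace X" "u = (p x, x)" by (auto simp: gunits_S)
      have "f (j x h) = 0" if h: "h \<in> space (haar H (p x))" for h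
      proof (rule ccontr)
        assume "f (j x h) \<noteq> 0"
        then have "j x h \<in> K" using K(2) by blast
        moreover have "\<theta> h (\<theta> (ginv H h) x) = x"
          using h space_haar[OF anchor_unit[OF x(1)]] x(1) by (simp add: act_inv')
        ultimately show False using u x(2) by force
      qed
      then have "I f x = (\<integral>h. 0 \<partial>haar H (p x))"
        unfolding I_def by (intro Bochner_Integration.integral_cong) auto
      then show "I f (snd u) = 0" using x by simp
    qed
    moreover have "f \<in> Cc T"
      using Cc_on_imp_Cc[OF tube(3) openin_tube[OF tube(1)] Hausdorff_tube[OF tube(2)]] .
    ultimately show ?case by blast
  qed
  then show ?thesis ..
qed

section \<open>The Haar system and local compactness of the semidirect product\<close>

lemma Cc_T_measurable: "f \<in> Cc T \<Longrightarrow> f \<in> borel_measurable (borel_of (ran_fiber S u))"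
  unfolding ran_fiber_def gtop_S by (rule Cc_measurable)

lemma left_haar_system_S: "left_haar_system S (haar S)"
  unfolding left_haar_system_def
proof (intro conjI ballI allI impI)
  fix u assume "u \<in> gunits S"
  then obtain x where x: "x \<in> topspace X" "u = (p x, x)" by (auto simp: gunits_S)
  note reg = regular_haar[OF anchor_unit[OF x(1)]]
  show "regular_borel_measure (ran_fiber S u) (haar S u)"
    unfolding x(2) haar_S[OF x(1)]
    using homeomorphic_fiber[OF x(1)] reg by (rule regular_borel_measure_homeomorphic)
  fix U assume U: "openin (ran_fiber S u) U \<and> U \<noteq> {}"
  have "openin (ran_fiber H (p x)) (fst ` U)"
    using homeomorphic_maps_openin_image[OF homeomorphic_fiber[OF x(1)]] U x(2) by blast
  then have "emeasure (haar H (p x)) (fst ` U) > 0"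
    using haar_pos[OF anchor_unit[OF x(1)]] U by blast
  moreover have "fst ` U = j x -` U \<inter> space (haar H (p x))"
    using image_eq_preimage_homeomorphic[OF homeomorphic_fiber[OF x(1)], of U] U x(2)
      openin_subset regular_borel_measure_space[OF reg] by blast
  moreover have "U \<in> sets (borel_of (ran_fiber S (p x, x)))"
    using U x(2) openin_sets_borel_of by blast
  ultimately show "0 < emeasure (haar S u) U"
    unfolding x(2) haar_S[OF x(1)] by (simp add: emeasure_distr[OF measurable_j[OF x(1)]])
next
  fix f assume "f \<in> Cc (gtop S)"
  then have f: "f \<in> Cc T" by (simp add: gtop_S)
  have "(\<integral>z. f z \<partial>haar S u) = I f (snd u)" if "u \<in> gunits S" for u
    using that integral_S[OF _ Cc_T_measurable[OF f]] by (auto simp: gunits_S I_def)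
  then have "(\<lambda>u. if u \<in> gunits S then \<integral>z. f z \<partial>haar S u else 0) =
      (\<lambda>u. if u \<in> gunits S then I f (snd u) else 0)" by auto
  then show "(\<lambda>u. if u \<in> gunits S then \<integral>z. f z \<partial>haar S u else 0) \<in> Cc_on (gtop S) (gunits S)"
    using haar_S_Cc[OF f] by (simp add: gtop_S)
next
  fix f g assume "f \<in> Cc (gtop S)" and g: "g \<in> arrows S"
  then have f: "f \<in> Cc T" by (simp add: gtop_S)
  obtain k x where gk: "g = (k, x)" by force
  have kx: "k \<in> arrows H" "x \<in> topspace X" "gdom H k = p x"
    using g gk by (auto simp: gtop_S topspace_T)
  note y = act_closed[OF kx]
  have dg: "gdom S g = (p x, x)" and rg: "gran S g = (p (\<theta> k x), \<theta> k x)"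
    using gk by (simp_all add: gdom_S gran_S)
  have pk: "p (\<theta> k x) = gran H k" using kx by (simp add: anchor_act)
  \<comment> \<open>The slice is extended at the range \<open>\<theta> k x\<close> of the
    translating arrow; invariance of the Haar system of \<open>H\<close> is then applied to
    \<open>b\<close>.\<close>
  obtain b where b: "b \<in> Cc (gtop H)" "\<forall>h\<in>arrows H. gran H h = p (\<theta> k x) \<longrightarrow> b h = f (j (\<theta> k x) h)"
    using slice_extension[OF f y] by blast
  have "gmult S g \<in> borel_of (ran_fiber S (p x, x)) \<rightarrow>\<^sub>M borel_of (ran_fiber S (gran S g))"
    using S.continuous_map_translation[OF g] unfolding dg by (rule continuous_map_measurable)
  then have "(\<lambda>z. f (gmult S g z)) \<in> borel_measurable (borel_of (ran_fiber S (p x, x)))"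
    using Cc_T_measurable[OF f] by (rule measurable_compose)
  then have "(\<integral>z. f (gmult S g z) \<partial>haar S (gdom S g)) = (\<integral>h. f (gmult S g (j x h)) \<partial>haar H (p x))"
    unfolding dg by (rule integral_S[OF kx(2)])
  also have "\<dots> = (\<integral>h. b (gmult H k h) \<partial>haar H (gdom H k))"
    unfolding kx(3)
  proof (rule Bochner_Integration.integral_cong[OF refl])
    fix h assume "h \<in> space (haar H (p x))"
    then have h: "h \<in> arrows H" "gran H h = p x" using space_haar[OF anchor_unit[OF kx(2)]] by auto
    let ?y = "\<theta> (ginv H h) x"
    have yX: "?y \<in> topspace X" "p ?y = gdom H h" using inv_act h kx by auto
    have kh: "gmult H k h \<in> arrows H" "gdom H (gmult H k h) = p ?y" "gran H (gmult H k h) = p (\<theta> k x)"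
      using h kx yX pk by (simp_all add: mult_closed dom_mult ran_mult)
    \<comment> \<open>In fibre coordinates, left translation by (k,x) is left translation by k: it
      sends \<open>j x h\<close> to \<open>j (\<theta> k x) (gmult H k h)\<close>, because (kh)(h^-1
      x) = kx.\<close>
    have "\<theta> (gmult H k h) ?y = \<theta> k x"
      using act_mult[of k h ?y] h kx yX act_inv'[of h x] by simp
    then have "\<theta> (ginv H (gmult H k h)) (\<theta> k x) = ?y"
      using act_inv[OF kh(1) yX(1) kh(2)] by simp
    then show "f (gmult S g (j x h)) = b (gmult H k h)"
      using b(2) kh by (simp add: gk gmult_S)
  qed
  also have "\<dots> = (\<integral>h. b h \<partial>haar H (gran H k))" by (rule haar_invariant[OF b(1) kx(1)])
  also have "\<dots> = (\<integral>h. f (j (\<theta> k x) h) \<partial>haar H (p (\<theta> k x)))"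
    unfolding pk[symmetric] using b(2) space_haar[OF anchor_unit[OF y]]
    by (intro Bochner_Integration.integral_cong) auto
  also have "\<dots> = (\<integral>z. f z \<partial>haar S (gran S g))"
    unfolding rg by (rule integral_S[OF y Cc_T_measurable[OF f], symmetric])
  finally show "(\<integral>z. f (gmult S g z) \<partial>haar S (gdom S g)) = (\<integral>z. f z \<partial>haar S (gran S g))" .
qed

lemma locally_compact_groupoid_semidirect: "locally_compact_groupoid S"
proof (unfold_locales)
  have hX: "X homeomorphic_space unit_top S"
    using homeomorphic_units homeomorphic_maps_imp_homeomorphic_space by blast
  show "locally_compact_space (unit_top S)"
    using homeomorphic_locally_compact_space[OF hX] X_locally_compact by blast
  show "Hausdorff_space (unit_top S)"
    using homeomorphic_Hausdorff_space[OF hX] X_Hausdorff by blast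
  show "\<exists>\<C>. countable \<C> \<and>
       (\<forall>C\<in>\<C>. compactin (gtop S) C \<and> Hausdorff_space (subtopology (gtop S) C)) \<and>
       openin (gtop S) = arbitrary union_of (\<lambda>U. U \<in> (\<lambda>C. gtop S interior_of C) ` \<C>)"
    unfolding gtop_S using countable_compact_base_iff[of T] base_T second_countable_T by blast
  show "left_haar_system S (haar S)" by (rule left_haar_system_S)
  fix u assume "u \<in> gunits S"
  then obtain x where x: "x \<in> topspace X" "u = (p x, x)" by (auto simp: gunits_S)
  have h: "ran_fiber H (p x) homeomorphic_space ran_fiber S u"
    using homeomorphic_fiber[OF x(1)] homeomorphic_maps_imp_homeomorphic_space x(2) by blast
  show "locally_compact_space (ran_fiber S u)"
    using homeomorphic_locally_compact_space[OF h] fiber_locally_compact[OF anchor_unit[OF x(1)]] by blast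
  show "Hausdorff_space (ran_fiber S u)"
    using homeomorphic_Hausdorff_space[OF h] fiber_Hausdorff[OF anchor_unit[OF x(1)]] by blast
qed

end


section \<open>The action attached to a functor\<close>

definition quotient_top :: "'a topology \<Rightarrow> ('a \<Rightarrow> 'b) \<Rightarrow> 'b topology"
  where "quotient_top A q = topology (\<lambda>U. U \<subseteq> q ` topspace A \<and> openin A {x \<in> topspace A. q x \<in> U})"

lemma openin_quotient_top:
  "openin (quotient_top A q) U \<longleftrightarrow> U \<subseteq> q ` topspace A \<and> openin A {x \<in> topspace A. q x \<in> U}"
proof -
  have "istopology (\<lambda>U. U \<subseteq> q ` topspace A \<and> openin A {x \<in> topspace A. q x \<in> U})"
    unfolding istopology_def
  proof (intro conjI allI impI)
    fix U V assume *: "U \<subseteq> q ` topspace A \<and> openin A {x \<in> topspace A. q x \<in> U}"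
      "V \<subseteq> q ` topspace A \<and> openin A {x \<in> topspace A. q x \<in> V}"
    have "{x \<in> topspace A. q x \<in> U \<inter> V} = {x \<in> topspace A. q x \<in> U} \<inter> {x \<in> topspace A. q x \<in> V}"
      by auto
    then show "openin A {x \<in> topspace A. q x \<in> U \<inter> V}" using * by (simp add: openin_Int)
    show "U \<inter> V \<subseteq> q ` topspace A" using * by auto
  next
    fix \<K> assume *: "\<forall>K\<in>\<K>. K \<subseteq> q ` topspace A \<and> openin A {x \<in> topspace A. q x \<in> K}"
    have "{x \<in> topspace A. q x \<in> \<Union>\<K>} = \<Union>((\<lambda>K. {x \<in> topspace A. q x \<in> K}) ` \<K>)" by auto
    moreover have "openin A (\<Union>((\<lambda>K. {x \<in> topspace A. q x \<in> K}) ` \<K>))"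
      using * by (intro openin_Union) auto
    ultimately show "openin A {x \<in> topspace A. q x \<in> \<Union>\<K>}" by simp
    show "\<Union>\<K> \<subseteq> q ` topspace A" using * by blast
  qed
  then show ?thesis unfolding quotient_top_def by (simp add: topology_inverse')
qed

lemma topspace_quotient_top [simp]: "topspace (quotient_top A q) = q ` topspace A"
proof -
  have "{x \<in> topspace A. q x \<in> q ` topspace A} = topspace A" by auto
  then have "openin (quotient_top A q) (q ` topspace A)" by (simp add: openin_quotient_top)
  moreover have "topspace (quotient_top A q) \<subseteq> q ` topspace A"
    using openin_quotient_top[of A q "topspace (quotient_top A q)"] by simp
  ultimately show ?thesis by (simp add: openin_subset subset_antisym)
qed

lemma quotient_map_quotient_top: "quotient_map A (quotient_top A q) q"
  unfolding quotient_map_def by (simp add: openin_quotient_top)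

text \<open>Inequivalent points have an open box around them that misses the relation. Its two sides
  have disjoint images, which are open because q is.\<close>

lemma Hausdorff_space_open_quotient:
  assumes q: "q ` topspace A = topspace B" "open_map A B q"
    and closed: "closedin (prod_topology A A) {z \<in> topspace (prod_topology A A). q (fst z) = q (snd z)}"
  shows "Hausdorff_space B"
  unfolding Hausdorff_space_def
proof (intro allI impI)
  fix b c assume bc: "b \<in> topspace B \<and> c \<in> topspace B \<and> b \<noteq> c"
  then obtain x y where xy: "x \<in> topspace A" "y \<in> topspace A" "q x = b" "q y = c"
    using q(1) by (metis imageE)
  let ?R = "{z \<in> topspace (prod_topology A A). q (fst z) = q (snd z)}"
  have "openin (prod_topology A A) (topspace (prod_topology A A) - ?R)" using closed by blast
  moreover have "(x, y) \<in> topspace (prod_topology A A) - ?R" using xy bc by auto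
  ultimately obtain U V where UV: "openin A U" "openin A V" "x \<in> U" "y \<in> V"
    "U \<times> V \<subseteq> topspace (prod_topology A A) - ?R"
    by (rule openin_prod_topologyE)
  have "disjnt (q ` U) (q ` V)"
    unfolding disjnt_iff
  proof (intro allI notI)
    fix w assume "w \<in> q ` U \<and> w \<in> q ` V"
    then obtain s t where st: "s \<in> U" "t \<in> V" "q s = q t" by auto
    then have "(s, t) \<in> ?R" using openin_subset[OF UV(1)] openin_subset[OF UV(2)] by auto
    moreover have "(s, t) \<notin> ?R" using UV(5) st by blast
    ultimately show False by contradiction
  qed
  moreover have "openin B (q ` U)" "openin B (q ` V)" using q(2) UV unfolding open_map_def by auto
  moreover have "b \<in> q ` U" "c \<in> q ` V" using UV xy by auto
  ultimately show "\<exists>U V. openin B U \<and> openin B V \<and> b \<in> U \<and> c \<in> V \<and> disjnt U V" by blast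
qed

text \<open>The product of an identity with an open map is open. Since the anchor upstairs is
  \<open>p\<close> composed with \<open>q\<close>, restricting to the fibre product commutes with
  taking images.\<close>

lemma open_map_fiber_product:
  assumes q: "open_map Y X q" and p: "\<And>y. y \<in> topspace Y \<Longrightarrow> p (q y) = p' y"
  shows "open_map (fiber_product C Y f p') (fiber_product C X f p) (\<lambda>(c, y). (c, q y))"
  unfolding open_map_def
proof (intro allI impI)
  fix U assume "openin (fiber_product C Y f p') U"
  then obtain U' where U': "openin (prod_topology C Y) U'" "U = U' \<inter> {(c, y). f c = p' y}"
    unfolding fiber_product_def openin_subtopology by blast
  have "openin (prod_topology C X) ((\<lambda>(c, y). (c, q y)) ` U')"
    unfolding openin_prod_topology_alt
  proof (intro allI impI)
    fix c x assume "(c, x) \<in> (\<lambda>(c, y). (c, q y)) ` U'"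
    then obtain y where y: "(c, y) \<in> U'" "x = q y" by auto
    obtain V W where VW: "openin C V" "openin Y W" "c \<in> V" "y \<in> W" "V \<times> W \<subseteq> U'"
      using U'(1) y(1) by (rule openin_prod_topologyE)
    have "openin X (q ` W)" using q VW(2) unfolding open_map_def by blast
    moreover have "V \<times> q ` W \<subseteq> (\<lambda>(c, y). (c, q y)) ` U'" using VW(5) by auto
    moreover have "x \<in> q ` W" using y(2) VW(4) by blast
    ultimately show "\<exists>U V. openin C U \<and> openin X V \<and> c \<in> U \<and> x \<in> V \<and> U \<times> V \<subseteq> (\<lambda>(c, y). (c, q y)) ` U'"
      using VW(1,3) by blast
  qed
  then have "openin (fiber_product C X f p) ((\<lambda>(c, y). (c, q y)) ` U' \<inter> {(c, x). f c = p x})"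
    unfolding fiber_product_def by (rule openin_subtopology_Int)
  moreover have "(\<lambda>(c, y). (c, q y)) ` U' \<inter> {(c, x). f c = p x} = (\<lambda>(c, y). (c, q y)) ` U"
    using p openin_subset[OF U'(1)] unfolding U'(2) by force
  ultimately show "openin (fiber_product C X f p) ((\<lambda>(c, y). (c, q y)) ` U)" by simp
qed

locale closed_faithful_functor = G: locally_compact_groupoid G + H: locally_compact_groupoid H
  for G :: "'g lc_groupoid" and H :: "'h lc_groupoid" +
  fixes \<phi> :: "'g \<Rightarrow> 'h"
  assumes is_functor: "continuous_functor G H \<phi>"
    and faithful: "faithful G H \<phi>"
    and closed_image: "closedin (pullback_top G H \<phi>) (bar_map G \<phi> ` arrows G)"
    and open_translation: "open_map (fiber_product (gtop H) (gtop G) (gdom H) (\<lambda>g. \<phi> (gran G g)))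
           (fiber_product (gtop H) (unit_top G) (gdom H) \<phi>)
           (\<lambda>(h, g). (gmult H h (\<phi> g), gdom G g))"
begin

section \<open>The orbit space and its topology\<close>

abbreviation Y :: "('h \<times> 'g) topology"
  where "Y \<equiv> fiber_product (gtop H) (unit_top G) (gdom H) \<phi>"

lemma phi_arrow: "g \<in> arrows G \<Longrightarrow> \<phi> g \<in> arrows H"
  and phi_unit: "u \<in> gunits G \<Longrightarrow> \<phi> u \<in> gunits H"
  and phi_dom: "g \<in> arrows G \<Longrightarrow> gdom H (\<phi> g) = \<phi> (gdom G g)"
  and phi_ran: "g \<in> arrows G \<Longrightarrow> gran H (\<phi> g) = \<phi> (gran G g)"
  and phi_mult: "g \<in> arrows G \<Longrightarrow> g' \<in> arrows G \<Longrightarrow> gdom G g = gran G g' \<Longrightarrow>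
    \<phi> (gmult G g g') = gmult H (\<phi> g) (\<phi> g')"
  and continuous_phi: "continuous_map (gtop G) (gtop H) \<phi>"
  using is_functor unfolding continuous_functor_def continuous_map_def by auto

lemma topspace_Y: "topspace Y = {(h, e). h \<in> arrows H \<and> e \<in> gunits G \<and> gdom H h = \<phi> e}"
  by (auto simp: fiber_product_def)

text \<open>The orbit of y under right translation by G, kept as a set: equivalence becomes
  equality, and the orbit space lives in the type of sets of pairs.\<close>

definition q :: "'h \<times> 'g \<Rightarrow> ('h \<times> 'g) set"
  where "q y = (\<lambda>g. (gmult H (fst y) (\<phi> g), gdom G g)) ` {g \<in> arrows G. gran G g = snd y}"

lemma q_self: "y \<in> topspace Y \<Longrightarrow> y \<in> q y"
  unfolding q_def
  using H.mult_unit_right[of "fst y"]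
  by (intro image_eqI[of _ _ "snd y"])
    (auto simp: topspace_Y G.unit_dom G.unit_ran G.unit_arrow)

text \<open>Composition in G gives one inclusion. The same inclusion for the inverse of
  \<open>g\<close>, which undoes the translation, gives the other.\<close>

lemma q_translate:
  assumes g: "g \<in> arrows G" and h: "h \<in> arrows H" "gdom H h = \<phi> (gran G g)"
  shows "q (gmult H h (\<phi> g), gdom G g) = q (h, gran G g)"
proof -
  have sub: "q (gmult H h (\<phi> g), gdom G g) \<subseteq> q (h, gran G g)"
    if "g \<in> arrows G" "h \<in> arrows H" "gdom H h = \<phi> (gran G g)" for g h
  proof
    fix z assume "z \<in> q (gmult H h (\<phi> g), gdom G g)"
    then obtain k where k: "k \<in> arrows G" "gran G k = gdom G g"
      "z = (gmult H (gmult H h (\<phi> g)) (\<phi> k), gdom G k)" unfolding q_def by auto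
    then have "z = (gmult H h (\<phi> (gmult G g k)), gdom G (gmult G g k))"
      using that by (simp add: phi_arrow phi_mult phi_ran phi_dom H.mult_assoc G.dom_mult)
    then show "z \<in> q (h, gran G g)"
      unfolding q_def using that k
      by (intro image_eqI[of _ _ "gmult G g k"]) (auto simp: G.mult_closed G.ran_mult)
  qed
  have "gmult H (gmult H h (\<phi> g)) (\<phi> (ginv G g)) = h"
  proof -
    have "gmult H (gmult H h (\<phi> g)) (\<phi> (ginv G g)) = gmult H h (gmult H (\<phi> g) (\<phi> (ginv G g)))"
      using g h by (intro H.mult_assoc) (simp_all add: phi_arrow phi_ran phi_dom G.inv_closed G.ran_inv)
    also have "\<dots> = gmult H h (\<phi> (gran G g))"
      using g phi_mult[of g "ginv G g"] by (simp add: G.inv_closed G.ran_inv G.mult_inv_right)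
    also have "\<dots> = h" using h H.mult_unit_right[of h] by simp
    finally show ?thesis .
  qed
  then have "q (h, gran G g) \<subseteq> q (gmult H h (\<phi> g), gdom G g)"
    using sub[of "ginv G g" "gmult H h (\<phi> g)"] g h
    by (simp add: G.inv_closed G.ran_inv G.dom_inv H.mult_closed H.dom_mult phi_arrow phi_ran phi_dom)
  with sub[OF g h] show ?thesis by blast
qed

lemma q_eq_iff:
  assumes "(h, e) \<in> topspace Y" "(h', e') \<in> topspace Y"
  shows "q (h, e) = q (h', e') \<longleftrightarrow> (\<exists>g\<in>arrows G. gran G g = e \<and> gdom G g = e' \<and> h' = gmult H h (\<phi> g))"
proof
  assume "q (h, e) = q (h', e')"
  then have "(h', e') \<in> q (h, e)" using q_self[OF assms(2)] by simp
  then show "\<exists>g\<in>arrows G. gran G g = e \<and> gdom G g = e' \<and> h' = gmult H h (\<phi> g)"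
    unfolding q_def by auto
next
  assume "\<exists>g\<in>arrows G. gran G g = e \<and> gdom G g = e' \<and> h' = gmult H h (\<phi> g)"
  then obtain g where "g \<in> arrows G" "gran G g = e" "gdom G g = e'" "h' = gmult H h (\<phi> g)" by blast
  then show "q (h, e) = q (h', e')" using q_translate[of g h] assms by (auto simp: topspace_Y)
qed

abbreviation X :: "('h \<times> 'g) set topology"
  where "X \<equiv> quotient_top Y q"

lemma quotient_q: "quotient_map Y X q"
  by (rule quotient_map_quotient_top)

lemma continuous_q: "continuous_map Y X q"
  using quotient_q by (rule quotient_imp_continuous_map)

lemma continuous_map_into_Y:
  "continuous_map A Y (\<lambda>z. (f z, g z)) \<longleftrightarrow>
    continuous_map A (gtop H) f \<and> continuous_map A (unit_top G) g \<and> (\<forall>z\<in>topspace A. gdom H (f z) = \<phi> (g z))"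
  by (auto simp: fiber_product_def continuous_map_in_subtopology continuous_map_paired)

lemma continuous_Y_fst: "continuous_map Y (gtop H) fst"
  and continuous_Y_snd: "continuous_map Y (unit_top G) snd"
  unfolding fiber_product_def by (rule continuous_map_subtopology_fst continuous_map_subtopology_snd)+

text \<open>The saturation of an open \<open>U\<close> is the image, under the open translation map
  of the hypothesis, of the pairs (h,g) with (h, r(g)) in \<open>U\<close>.\<close>

lemma open_q: "open_map Y X q"
  unfolding open_map_def
proof (intro allI impI)
  fix U assume U: "openin Y U"
  let ?A = "fiber_product (gtop H) (gtop G) (gdom H) (\<lambda>g. \<phi> (gran G g))"
  have tA: "topspace ?A = {(h, g). h \<in> arrows H \<and> g \<in> arrows G \<and> gdom H h = \<phi> (gran G g)}"
    by (auto simp: fiber_product_def)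
  have "continuous_map ?A (gtop H) fst" "continuous_map ?A (gtop G) snd"
    unfolding fiber_product_def by (rule continuous_map_subtopology_fst continuous_map_subtopology_snd)+
  then have "continuous_map ?A Y (\<lambda>z. (fst z, gran G (snd z)))"
    unfolding continuous_map_into_Y using G.continuous_map_ran tA by auto
  then have "openin ?A {z \<in> topspace ?A. (fst z, gran G (snd z)) \<in> U}"
    using U by (rule openin_continuous_map_preimage)
  then have "openin Y ((\<lambda>(h, g). (gmult H h (\<phi> g), gdom G g)) `
      {z \<in> topspace ?A. (fst z, gran G (snd z)) \<in> U})"
    using open_translation unfolding open_map_def by blast
  moreover have "(\<lambda>(h, g). (gmult H h (\<phi> g), gdom G g)) `
      {z \<in> topspace ?A. (fst z, gran G (snd z)) \<in> U} = {y \<in> topspace Y. q y \<in> q ` U}"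
  proof (intro equalityI subsetI)
    fix y assume "y \<in> (\<lambda>(h, g). (gmult H h (\<phi> g), gdom G g)) `
      {z \<in> topspace ?A. (fst z, gran G (snd z)) \<in> U}"
    then obtain h g where hg: "h \<in> arrows H" "g \<in> arrows G" "gdom H h = \<phi> (gran G g)"
      "(h, gran G g) \<in> U" "y = (gmult H h (\<phi> g), gdom G g)" using tA by auto
    then have "y \<in> topspace Y"
      by (simp add: topspace_Y H.mult_closed H.dom_mult phi_arrow phi_ran phi_dom G.dom_unit)
    moreover have "q y = q (h, gran G g)" using q_translate hg by simp
    ultimately show "y \<in> {y \<in> topspace Y. q y \<in> q ` U}" using hg(4) by auto
  next
    fix y assume "y \<in> {y \<in> topspace Y. q y \<in> q ` U}"
    then obtain w where w: "y \<in> topspace Y" "w \<in> U" "q w = q y" by auto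
    obtain h e h' e' where eqs: "w = (h, e)" "y = (h', e')" by fastforce
    have wY: "w \<in> topspace Y" using w(2) openin_subset[OF U] by blast
    obtain g where "g \<in> arrows G" "gran G g = e" "gdom G g = e'" "h' = gmult H h (\<phi> g)"
      using q_eq_iff[of h e h' e'] w wY eqs by auto
    moreover have "(h, g) \<in> topspace ?A" using calculation wY eqs tA by (auto simp: topspace_Y)
    ultimately show "y \<in> (\<lambda>(h, g). (gmult H h (\<phi> g), gdom G g)) `
      {z \<in> topspace ?A. (fst z, gran G (snd z)) \<in> U}"
      using w(2) eqs by (intro image_eqI[of _ _ "(h, g)"]) auto
  qed
  ultimately have "openin Y {y \<in> topspace Y. q y \<in> q ` U}" by simp
  then show "openin X (q ` U)"
    using openin_subset[OF U] by (auto simp: openin_quotient_top)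
qed

text \<open>Equivalent pairs have equal ranges in \<open>H\<close>, a closed condition. On that
  closed set (e, e', h^-1 h') depends continuously on the two pairs, and they are equivalent exactly
  when it lies in the closed image of \<open>bar_map G \<phi>\<close>.\<close>

lemma Hausdorff_X: "Hausdorff_space X"
proof (rule Hausdorff_space_open_quotient[OF _ open_q])
  let ?P = "prod_topology Y Y"
  let ?Z = "{z \<in> topspace ?P. gran H (fst (fst z)) = gran H (fst (snd z))}"
  have c: "continuous_map ?P (gtop H) (\<lambda>z. fst (fst z))" "continuous_map ?P (gtop H) (\<lambda>z. fst (snd z))"
    "continuous_map ?P (unit_top G) (\<lambda>z. snd (fst z))" "continuous_map ?P (unit_top G) (\<lambda>z. snd (snd z))"
    using continuous_map_compose[OF continuous_map_fst continuous_Y_fst, of Y]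
      continuous_map_compose[OF continuous_map_snd continuous_Y_fst, of Y]
      continuous_map_compose[OF continuous_map_fst continuous_Y_snd, of Y]
      continuous_map_compose[OF continuous_map_snd continuous_Y_snd, of Y] by (simp_all add: o_def)
  have Z: "closedin ?P ?Z"
    using H.units_Hausdorff H.continuous_map_ran[OF c(1)] H.continuous_map_ran[OF c(2)]
    by (rule closedin_equalizer)
  let ?k = "\<lambda>z. (snd (fst z), snd (snd z), gmult H (ginv H (fst (fst z))) (fst (snd z)))"
  have tZ: "fst (fst z) \<in> arrows H \<and> fst (snd z) \<in> arrows H \<and> gdom H (fst (fst z)) = \<phi> (snd (fst z)) \<and>
      gdom H (fst (snd z)) = \<phi> (snd (snd z)) \<and> gran H (fst (fst z)) = gran H (fst (snd z))"
    if "z \<in> topspace (subtopology ?P ?Z)" for z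
    using that by (auto simp: topspace_Y)
  have cZ: "continuous_map (subtopology ?P ?Z) (gtop H) (\<lambda>z. fst (fst z))"
    "continuous_map (subtopology ?P ?Z) (gtop H) (\<lambda>z. fst (snd z))"
    "continuous_map (subtopology ?P ?Z) (unit_top G) (\<lambda>z. snd (fst z))"
    "continuous_map (subtopology ?P ?Z) (unit_top G) (\<lambda>z. snd (snd z))"
    using c continuous_map_from_subtopology by blast+
  have "continuous_map (subtopology ?P ?Z) (gtop H) (\<lambda>z. gmult H (ginv H (fst (fst z))) (fst (snd z)))"
  proof (rule H.continuous_map_mult[OF H.continuous_map_inv[OF cZ(1)] cZ(2)])
    fix z assume "z \<in> topspace (subtopology ?P ?Z)"
    from tZ[OF this] show "gdom H (ginv H (fst (fst z))) = gran H (fst (snd z))" by (simp add: H.dom_inv)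
  qed
  moreover have "?k z \<in> {(e, f, h). \<phi> e = gran H h \<and> \<phi> f = gdom H h}"
    if "z \<in> topspace (subtopology ?P ?Z)" for z
    using tZ[OF that] by (simp add: H.ran_mult H.dom_mult H.inv_closed H.dom_inv H.ran_inv)
  ultimately have k: "continuous_map (subtopology ?P ?Z) (pullback_top G H \<phi>) ?k"
    unfolding pullback_top_def continuous_map_in_subtopology continuous_map_paired
    using cZ(3,4) by blast
  have "closedin (subtopology ?P ?Z) {z \<in> topspace (subtopology ?P ?Z). ?k z \<in> bar_map G \<phi> ` arrows G}"
    using k closed_image by (rule closedin_continuous_map_preimage)
  then have "closedin ?P {z \<in> topspace (subtopology ?P ?Z). ?k z \<in> bar_map G \<phi> ` arrows G}"
    using Z closedin_trans_full by blast
  moreover have "{z \<in> topspace (subtopology ?P ?Z). ?k z \<in> bar_map G \<phi> ` arrows G} =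
    {z \<in> topspace ?P. q (fst z) = q (snd z)}" (is "?A = ?B")
  proof (intro set_eqI)
    fix z :: "('h \<times> 'g) \<times> ('h \<times> 'g)"
    obtain h e h' e' where z: "z = ((h, e), (h', e'))" by (metis surj_pair)
    show "z \<in> ?A \<longleftrightarrow> z \<in> ?B"
    proof (cases "z \<in> topspace ?P")
      case True
      then have Yz: "(h, e) \<in> topspace Y" "(h', e') \<in> topspace Y" using z by auto
      then have hh: "h \<in> arrows H" "h' \<in> arrows H" "gdom H h = \<phi> e" "gdom H h' = \<phi> e'"
        by (auto simp: topspace_Y)
      have "z \<in> ?A \<longleftrightarrow> gran H h = gran H h' \<and>
          (\<exists>g\<in>arrows G. gran G g = e \<and> gdom G g = e' \<and> \<phi> g = gmult H (ginv H h) h')"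
        using True z by (auto simp: bar_map_def)
      also have "\<dots> \<longleftrightarrow> (\<exists>g\<in>arrows G. gran G g = e \<and> gdom G g = e' \<and> h' = gmult H h (\<phi> g))" (is "?L \<longleftrightarrow> ?R")
      proof
        assume ?L
        then show ?R using H.mult_inv_cancel[of h h'] hh by force
      next
        assume ?R
        then obtain g where g: "g \<in> arrows G" "gran G g = e" "gdom G g = e'" "h' = gmult H h (\<phi> g)" by blast
        then have "gran H h = gran H h'" "gmult H (ginv H h) h' = \<phi> g"
          using hh H.inv_mult_cancel[of h "\<phi> g"] by (simp_all add: H.ran_mult phi_arrow phi_ran)
        then show ?L using g by metis
      qed
      also have "\<dots> \<longleftrightarrow> q (h, e) = q (h', e')" using q_eq_iff[OF Yz] by simp
      also have "\<dots> \<longleftrightarrow> z \<in> ?B" using True z by simp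
      finally show ?thesis .
    next
      case False
      then show ?thesis by simp
    qed
  qed
  ultimately show "closedin ?P {z \<in> topspace ?P. q (fst z) = q (snd z)}" by simp
qed simp

text \<open>\<open>Y\<close> has compact neighbourhoods as a fibre product over a Hausdorff unit
  space, and they are carried down by the open continuous map q.\<close>

lemma locally_compact_X: "locally_compact_space X"
proof -
  have "continuous_map (unit_top G) (unit_top H) \<phi>"
    using continuous_phi phi_unit unfolding unit_top_def
    by (auto simp: continuous_map_in_subtopology continuous_map_from_subtopology)
  then have "locally_compact_Hausdorff_base Y"
    using G.units_locally_compact G.units_Hausdorff
    by (intro H.base_fiber_product locally_compact_Hausdorff_imp_base)
  then have "locally_compact_space Y" by (rule locally_compact_Hausdorff_base_imp_locally_compact)
  then show ?thesis
    using locally_compact_space_continuous_open_map_image[of Y X q] continuous_q open_q by simp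
qed

lemma second_countable_X: "second_countable X"
proof (rule second_countable_open_map_image[OF continuous_q open_q])
  show "second_countable Y"
    unfolding fiber_product_def unit_top_def
    by (intro second_countable_subtopology second_countable_prod_topology
        G.second_countable H.second_countable)
qed simp

section \<open>The action of H by left multiplication\<close>

definition rep :: "('h \<times> 'g) set \<Rightarrow> 'h \<times> 'g"
  where "rep x = (SOME y. y \<in> topspace Y \<and> q y = x)"

text \<open>Both structure maps are read off from a chosen representative; \<open>p_q\<close> and
  \<open>\<theta>_q\<close> show that any other representative gives the same value.\<close>

definition p :: "('h \<times> 'g) set \<Rightarrow> 'h"
  where "p x = gran H (fst (rep x))"

definition \<theta> :: "'h \<Rightarrow> ('h \<times> 'g) set \<Rightarrow> ('h \<times> 'g) set"
  where "\<theta> k x = q (gmult H k (fst (rep x)), snd (rep x))"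

lemma rep:
  assumes "y \<in> topspace Y"
  shows "rep (q y) \<in> topspace Y" "q (rep (q y)) = q y"
  unfolding rep_def using someI[of "\<lambda>z. z \<in> topspace Y \<and> q z = q y" y] assms by auto

lemma p_q:
  assumes Yy: "(h, e) \<in> topspace Y"
  shows "p (q (h, e)) = gran H h"
proof -
  obtain h' e' where r: "rep (q (h, e)) = (h', e')" by force
  have "(h', e') \<in> topspace Y" "q (h, e) = q (h', e')" using rep[OF Yy] r by auto
  then obtain g where "g \<in> arrows G" "gran G g = e" "h' = gmult H h (\<phi> g)"
    using q_eq_iff[OF Yy] by blast
  then show ?thesis using Yy by (simp add: p_def r H.ran_mult phi_arrow phi_ran topspace_Y)
qed

lemma translate_Y:
  assumes "(h, e) \<in> topspace Y" "k \<in> arrows H" "gdom H k = gran H h"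
  shows "(gmult H k h, e) \<in> topspace Y"
  using assms by (simp add: topspace_Y H.mult_closed H.dom_mult)

text \<open>Left multiplication commutes with the right translations that define the classes, by
  associativity in \<open>H\<close>.\<close>

lemma \<theta>_q:
  assumes Yy: "(h, e) \<in> topspace Y" and k: "k \<in> arrows H" "gdom H k = gran H h"
  shows "\<theta> k (q (h, e)) = q (gmult H k h, e)"
proof -
  obtain h' e' where r: "rep (q (h, e)) = (h', e')" by force
  have r': "(h', e') \<in> topspace Y" "q (h, e) = q (h', e')" using rep[OF Yy] r by auto
  then obtain g where g: "g \<in> arrows G" "gran G g = e" "gdom G g = e'" "h' = gmult H h (\<phi> g)"
    using q_eq_iff[OF Yy] by blast
  have h: "h \<in> arrows H" "gdom H h = \<phi> e" using Yy by (auto simp: topspace_Y)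
  have "gmult H k h' = gmult H (gmult H k h) (\<phi> g)"
    using g h k H.mult_assoc[of k h "\<phi> g"] by (simp add: phi_arrow phi_ran)
  moreover have "(gmult H k h', e') \<in> topspace Y"
    using r'(1) k g h by (intro translate_Y) (simp_all add: H.ran_mult phi_arrow phi_ran)
  ultimately show ?thesis
    using q_eq_iff[OF translate_Y[OF Yy k]] g r unfolding \<theta>_def by auto
qed

lemma X_cases:
  assumes "x \<in> topspace X"
  obtains h e where "(h, e) \<in> topspace Y" "x = q (h, e)" "h \<in> arrows H" "e \<in> gunits G" "gdom H h = \<phi> e"
    "p x = gran H h"
  using assms p_q by (auto simp: topspace_Y)

lemma continuous_p: "continuous_map X (unit_top H) p"
proof (rule continuous_compose_quotient_map[OF quotient_q])
  have "continuous_map Y (unit_top H) (\<lambda>y. gran H (fst y))"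
    by (rule H.continuous_map_ran[OF continuous_Y_fst])
  then show "continuous_map Y (unit_top H) (p \<circ> q)"
    by (rule continuous_map_eq) (auto simp: p_q)
qed

text \<open>The map (k,y) -> (k, q y) between fibre products is a continuous open surjection, hence
  a quotient map. Continuity may therefore be tested upstairs, where the action is multiplication in
  \<open>H\<close>.\<close>

lemma continuous_\<theta>: "continuous_map (fiber_product (gtop H) X (gdom H) p) X (\<lambda>(h, x). \<theta> h x)"
proof -
  let ?T = "fiber_product (gtop H) X (gdom H) p"
  let ?A = "fiber_product (gtop H) Y (gdom H) (\<lambda>y. gran H (fst y))"
  let ?Q = "\<lambda>(k, y). (k, q y)"
  have tA: "topspace ?A = {(k, y). k \<in> arrows H \<and> y \<in> topspace Y \<and> gdom H k = gran H (fst y)}"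
    by (auto simp: fiber_product_def[of _ Y])
  have tT: "topspace ?T = {(k, x). k \<in> arrows H \<and> x \<in> topspace X \<and> gdom H k = p x}"
    by (auto simp: fiber_product_def[of _ X])
  have cA: "continuous_map ?A (gtop H) fst" "continuous_map ?A Y snd"
    unfolding fiber_product_def[of _ Y] by (rule continuous_map_subtopology_fst continuous_map_subtopology_snd)+
  have op: "open_map ?A ?T ?Q"
    by (rule open_map_fiber_product[OF open_q]) (auto simp: p_q)
  have "continuous_map ?A X (\<lambda>z. q (snd z))"
    using continuous_map_compose[OF cA(2) continuous_q] by (simp add: o_def)
  then have cQ: "continuous_map ?A ?T ?Q"
    unfolding fiber_product_def[of _ X] continuous_map_in_subtopology case_prod_beta' continuous_map_paired
    using cA(1) by (auto simp: tA p_q)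
  have "?Q ` topspace ?A = topspace ?T"
  proof (intro equalityI subsetI)
    fix z assume "z \<in> ?Q ` topspace ?A"
    then show "z \<in> topspace ?T" by (auto simp: tA tT p_q)
  next
    fix z assume z: "z \<in> topspace ?T"
    obtain k x where kx: "z = (k, x)" by force
    then have x: "x \<in> topspace X" "k \<in> arrows H" "gdom H k = p x" using z tT by auto
    obtain h e where he: "(h, e) \<in> topspace Y" "x = q (h, e)" "p x = gran H h"
      using X_cases[OF x(1)] by metis
    then show "z \<in> ?Q ` topspace ?A"
      using x kx by (intro image_eqI[of _ _ "(k, (h, e))"]) (auto simp: tA)
  qed
  then have "quotient_map ?A ?T ?Q" using cQ op by (intro continuous_open_imp_quotient_map)
  then show ?thesis
  proof (rule continuous_compose_quotient_map)
    have "continuous_map ?A (gtop H) (\<lambda>z. fst (snd z))" "continuous_map ?A (unit_top G) (\<lambda>z. snd (snd z))"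
      using continuous_map_compose[OF cA(2) continuous_Y_fst] continuous_map_compose[OF cA(2) continuous_Y_snd]
      by (simp_all add: o_def)
    then have "continuous_map ?A Y (\<lambda>z. (gmult H (fst z) (fst (snd z)), snd (snd z)))"
      unfolding continuous_map_into_Y using cA(1) tA
      by (auto intro!: H.continuous_map_mult simp: topspace_Y H.dom_mult)
    then have "continuous_map ?A X (\<lambda>z. q (gmult H (fst z) (fst (snd z)), snd (snd z)))"
      using continuous_map_compose[OF _ continuous_q] by (simp add: o_def)
    then show "continuous_map ?A X ((\<lambda>(h, x). \<theta> h x) \<circ> ?Q)"
      by (rule continuous_map_eq) (auto simp: tA \<theta>_q)
  qed
qed

lemma action: "groupoid_action H X p \<theta>"
proof
  show "continuous_map X (unit_top H) p" by (rule continuous_p)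
  show "continuous_map (fiber_product (gtop H) X (gdom H) p) X (\<lambda>(h, x). \<theta> h x)" by (rule continuous_\<theta>)
next
  fix x assume "x \<in> topspace X"
  then obtain h e where "(h, e) \<in> topspace Y" "x = q (h, e)" "h \<in> arrows H" "p x = gran H h"
    using X_cases by metis
  then show "\<theta> (p x) x = x"
    by (simp add: \<theta>_q H.ran_arrow H.unit_dom H.ran_unit H.mult_unit_left)
next
  fix k x assume k: "k \<in> arrows H" and x: "x \<in> topspace X" and kx: "gdom H k = p x"
  obtain h e where he: "(h, e) \<in> topspace Y" "x = q (h, e)" "h \<in> arrows H" "p x = gran H h"
    using X_cases[OF x] by metis
  have kr: "gdom H k = gran H h" using kx he(4) by simp
  show "p (\<theta> k x) = gran H k"
    using he(2) \<theta>_q[OF he(1) k kr] p_q[OF translate_Y[OF he(1) k kr]] he(3) k kr by (simp add: H.ran_mult)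
next
  fix l k x assume l: "l \<in> arrows H" and k: "k \<in> arrows H" and x: "x \<in> topspace X"
    and lk: "gdom H l = gran H k" and kx: "gdom H k = p x"
  obtain h e where he: "(h, e) \<in> topspace Y" "x = q (h, e)" "h \<in> arrows H" "p x = gran H h"
    using X_cases[OF x] by metis
  have kr: "gdom H k = gran H h" using kx he(4) by simp
  have "\<theta> l (\<theta> k x) = q (gmult H l (gmult H k h), e)"
    using he(2,3) \<theta>_q[OF he(1) k kr] \<theta>_q[OF translate_Y[OF he(1) k kr] l] k lk kr by (simp add: H.ran_mult)
  also have "\<dots> = \<theta> (gmult H l k) x"
    using he(2,3) l k lk kr \<theta>_q[OF he(1), of "gmult H l k"] H.mult_assoc[of l k h]
    by (simp add: H.mult_closed H.dom_mult)
  finally show "\<theta> l (\<theta> k x) = \<theta> (gmult H l k) x" .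
qed

sublocale S: lc_groupoid_action H X p \<theta>
  by (intro lc_groupoid_action.intro H.locally_compact_groupoid_axioms action
      lc_groupoid_action_axioms.intro locally_compact_X Hausdorff_X second_countable_X)

abbreviation S :: "('h \<times> ('h \<times> 'g) set) lc_groupoid"
  where "S \<equiv> semidirect H X p \<theta>"

section \<open>The factorization through the semidirect product and its weak equivalence\<close>

definition \<iota> :: "'g \<Rightarrow> ('h \<times> 'g) set"
  where "\<iota> e = q (\<phi> e, e)"

definition \<alpha> :: "'g \<Rightarrow> 'h \<times> ('h \<times> 'g) set"
  where "\<alpha> g = (\<phi> g, \<iota> (gdom G g))"

lemma unit_Y: "e \<in> gunits G \<Longrightarrow> (\<phi> e, e) \<in> topspace Y"
  by (simp add: topspace_Y G.unit_arrow phi_arrow phi_unit H.unit_dom)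

lemma p_\<iota>: "e \<in> gunits G \<Longrightarrow> p (\<iota> e) = \<phi> e"
  by (simp add: \<iota>_def p_q unit_Y phi_unit H.unit_ran)

lemma \<iota>_in_X: "e \<in> gunits G \<Longrightarrow> \<iota> e \<in> topspace X"
  by (simp add: \<iota>_def unit_Y)

lemma \<theta>_\<iota>:
  assumes "h \<in> arrows H" "e \<in> gunits G" "gdom H h = \<phi> e"
  shows "\<theta> h (\<iota> e) = q (h, e)"
  using assms \<theta>_q[OF unit_Y[OF assms(2)], of h] H.mult_unit_right[of h]
  by (simp add: \<iota>_def phi_unit H.unit_ran)

text \<open>The pair (\<phi> g, d(g)) is the right translate by g of (\<phi>(r(g)), r(g)), so the
  two have the same class. This makes \<open>\<alpha>\<close> respect ranges.\<close>

lemma \<theta>_phi: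
  assumes g: "g \<in> arrows G"
  shows "\<theta> (\<phi> g) (\<iota> (gdom G g)) = \<iota> (gran G g)"
proof -
  have "\<theta> (\<phi> g) (\<iota> (gdom G g)) = q (\<phi> g, gdom G g)"
    using g by (intro \<theta>_\<iota>) (simp_all add: phi_arrow phi_dom G.dom_unit)
  also have "\<dots> = q (gmult H (\<phi> (gran G g)) (\<phi> g), gdom G g)"
    using g H.mult_unit_left[of "\<phi> g"] by (simp add: phi_arrow phi_ran)
  also have "\<dots> = \<iota> (gran G g)"
    unfolding \<iota>_def using g
    by (intro q_translate) (simp_all add: phi_arrow G.ran_arrow G.ran_unit phi_unit H.unit_dom)
  finally show ?thesis .
qed

lemma continuous_\<iota>: "continuous_map (unit_top G) X \<iota>"
proof -
  have "continuous_map (unit_top G) (unit_top G) (\<lambda>e. e)"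
    using continuous_map_id[of "unit_top G"] by (simp add: id_def)
  moreover have "continuous_map (unit_top G) (gtop H) \<phi>"
    unfolding unit_top_def using continuous_phi by (rule continuous_map_from_subtopology)
  ultimately have "continuous_map (unit_top G) Y (\<lambda>e. (\<phi> e, e))"
    unfolding continuous_map_into_Y by (auto simp: phi_unit H.unit_dom)
  then show ?thesis
    using continuous_map_compose[OF _ continuous_q] unfolding \<iota>_def by (simp add: o_def)
qed

lemma continuous_\<alpha>: "continuous_map (gtop G) S.T \<alpha>"
  unfolding \<alpha>_def S.continuous_map_into_T
  using continuous_phi continuous_map_compose[OF G.continuous_dom continuous_\<iota>]
  by (auto simp: o_def p_\<iota> phi_dom G.dom_unit)

lemma \<alpha>_unit: "e \<in> gunits G \<Longrightarrow> \<alpha> e = (\<phi> e, \<iota> e)"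
  by (simp add: \<alpha>_def G.unit_dom)

lemma functor_\<alpha>: "continuous_functor G S \<alpha>"
  unfolding continuous_functor_def S.gtop_S S.gunits_S S.gdom_S S.gran_S S.gmult_S
proof (intro conjI ballI impI)
  show "continuous_map (gtop G) S.T \<alpha>" by (rule continuous_\<alpha>)
next
  fix u assume "u \<in> gunits G"
  then show "\<alpha> u \<in> (\<lambda>x. (p x, x)) ` topspace X"
    using p_\<iota>[of u] \<iota>_in_X[of u] by (intro image_eqI[of _ _ "\<iota> u"]) (simp_all add: \<alpha>_unit)
next
  fix g assume g: "g \<in> arrows G"
  show "(case \<alpha> g of (h, x) \<Rightarrow> (p x, x)) = \<alpha> (gdom G g)"
    using g by (simp add: \<alpha>_unit G.dom_unit p_\<iota>) (simp add: \<alpha>_def p_\<iota> G.dom_unit)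
  show "(case \<alpha> g of (h, x) \<Rightarrow> (p (\<theta> h x), \<theta> h x)) = \<alpha> (gran G g)"
    using g by (simp add: \<alpha>_unit G.ran_unit) (simp add: \<alpha>_def p_\<iota> G.ran_unit \<theta>_phi)
next
  fix g k assume "g \<in> arrows G" "k \<in> arrows G" "gdom G g = gran G k"
  then show "\<alpha> (gmult G g k) = (case \<alpha> g of (g, y) \<Rightarrow> \<lambda>(h, x). (gmult H g h, x)) (\<alpha> k)"
    by (simp add: \<alpha>_def phi_mult G.dom_mult)
qed

text \<open>An arrow (h,x) from \<open>\<iota> f\<close> to \<open>\<iota> e\<close> says that (h,f)
  and (\<phi> e, e) define the same class. The arrow of G witnessing this equivalence is the
  required preimage.\<close>

lemma pullback_\<alpha>_arrow:
  assumes "(e, f, (h, x)) \<in> topspace (pullback_top G S \<alpha>)"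
  obtains g where "g \<in> arrows G" "bar_map G \<phi> g = (e, f, h)" "bar_map G \<alpha> g = (e, f, (h, x))"
proof -
  have a: "e \<in> gunits G" "f \<in> gunits G" "h \<in> arrows H" "x \<in> topspace X" "gdom H h = p x"
    "\<phi> e = p (\<theta> h x)" "\<iota> e = \<theta> h x" "\<phi> f = p x" "\<iota> f = x"
    using assms by (auto simp: pullback_top_def S.gtop_S S.topspace_T S.gran_S S.gdom_S \<alpha>_unit)
  have hf: "gdom H h = \<phi> f" using a by simp
  have "q (\<phi> e, e) = q (h, f)" using \<theta>_\<iota>[OF a(3,2) hf] a(7,9) by (simp add: \<iota>_def)
  then obtain g where g: "g \<in> arrows G" "gran G g = e" "gdom G g = f" "h = gmult H (\<phi> e) (\<phi> g)"
    using q_eq_iff[OF unit_Y[OF a(1)], of h f] a hf by (auto simp: topspace_Y)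
  moreover have "gmult H (\<phi> e) (\<phi> g) = \<phi> g"
    using g(1,2) H.mult_unit_left[of "\<phi> g"] by (simp add: phi_arrow phi_ran)
  ultimately have "h = \<phi> g" by simp
  then show thesis using that[of g] g a(9) by (simp add: bar_map_def \<alpha>_def)
qed

text \<open>The inverse forgets the point x and applies the inverse of
  \<open>bar_map G \<phi>\<close>, which is continuous on the image by faithfulness.\<close>

lemma fully_faithful_\<alpha>: "fully_faithful G S \<alpha>"
proof -
  let ?B = "subtopology (pullback_top G H \<phi>) (bar_map G \<phi> ` arrows G)"
  let ?P = "pullback_top G S \<alpha>"
  have "homeomorphic_map (gtop G) ?B (bar_map G \<phi>)"
    using faithful unfolding faithful_def embedding_map_def .
  then obtain k where k: "homeomorphic_maps (gtop G) ?B (bar_map G \<phi>) k"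
    using homeomorphic_map_maps by blast
  then have ck: "continuous_map ?B (gtop G) k" and k_bar: "\<And>g. g \<in> arrows G \<Longrightarrow> k (bar_map G \<phi> g) = g"
    unfolding homeomorphic_maps_def by auto
  have cP: "continuous_map ?P (unit_top G) fst" "continuous_map ?P (unit_top G) (\<lambda>z. fst (snd z))"
    "continuous_map ?P (gtop S) (\<lambda>z. snd (snd z))"
    unfolding pullback_top_def
    using continuous_map_compose[OF continuous_map_snd continuous_map_fst, of "unit_top G" "unit_top G" "gtop S"]
      continuous_map_compose[OF continuous_map_snd continuous_map_snd, of "unit_top G" "unit_top G" "gtop S"]
    by (auto intro!: continuous_map_from_subtopology continuous_map_fst simp: o_def)
  have "continuous_map ?P (gtop H) (\<lambda>z. fst (snd (snd z)))"
    using continuous_map_compose[OF cP(3)[unfolded S.gtop_S] S.continuous_T_fst] by (simp add: o_def)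
  \<comment> \<open>After x is forgotten the triple really lies in the image of
    \<open>bar_map G \<phi>\<close>; this is where \<open>pullback_\<alpha>_arrow\<close> is
    used.\<close>
  then have "continuous_map ?P ?B (\<lambda>z. (fst z, fst (snd z), fst (snd (snd z))))"
    unfolding continuous_map_in_subtopology pullback_top_def[of G H] continuous_map_paired
  proof (intro conjI cP(1,2) image_subsetI funcsetI)
    fix z assume z: "z \<in> topspace ?P"
    obtain e f h x where "z = (e, f, (h, x))" by (metis surj_pair)
    then obtain g where g: "g \<in> arrows G" "bar_map G \<phi> g = (fst z, fst (snd z), fst (snd (snd z)))"
      using pullback_\<alpha>_arrow z by (metis fst_conv snd_conv)
    then show "(fst z, fst (snd z), fst (snd (snd z))) \<in> bar_map G \<phi> ` arrows G" by (metis image_eqI)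
    show "(fst z, fst (snd z), fst (snd (snd z))) \<in> {(e, f, h). \<phi> e = gran H h \<and> \<phi> f = gdom H h}"
      using g phi_ran[OF g(1)] phi_dom[OF g(1)] by (auto simp: bar_map_def)
  qed
  then have ck': "continuous_map ?P (gtop G) (\<lambda>z. k (fst z, fst (snd z), fst (snd (snd z))))"
    using continuous_map_compose[OF _ ck] by (simp add: o_def)
  have "homeomorphic_maps (gtop G) ?P (bar_map G \<alpha>) (\<lambda>z. k (fst z, fst (snd z), fst (snd (snd z))))"
    unfolding homeomorphic_maps_def
  proof (intro conjI ballI ck')
    have "gran S (\<alpha> g) = \<alpha> (gran G g)" "gdom S (\<alpha> g) = \<alpha> (gdom G g)" if "g \<in> arrows G" for g
      using functor_\<alpha> that unfolding continuous_functor_def by auto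
    then show "continuous_map (gtop G) ?P (bar_map G \<alpha>)"
      unfolding bar_map_def pullback_top_def continuous_map_in_subtopology continuous_map_paired
      using G.continuous_ran G.continuous_dom continuous_\<alpha> by (auto simp: S.gtop_S)
  next
    fix g assume g: "g \<in> arrows G"
    then show "k (fst (bar_map G \<alpha> g), fst (snd (bar_map G \<alpha> g)), fst (snd (snd (bar_map G \<alpha> g)))) = g"
      using k_bar[OF g] by (simp add: bar_map_def \<alpha>_def)
  next
    fix z assume z: "z \<in> topspace ?P"
    obtain e f h x where zz: "z = (e, f, (h, x))" by (metis surj_pair)
    obtain g where g: "g \<in> arrows G" "bar_map G \<phi> g = (e, f, h)" "bar_map G \<alpha> g = z"
      using pullback_\<alpha>_arrow z unfolding zz by metis
    then have "k (e, f, h) = g" using k_bar by metis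
    then show "bar_map G \<alpha> (k (fst z, fst (snd z), fst (snd (snd z)))) = z" using g(3) zz by simp
  qed
  then show ?thesis unfolding fully_faithful_def homeomorphic_maps_map by blast
qed

text \<open>The map (h,e) -> (e, (h^-1, q(h,e))) parametrizes the fibre product by \<open>Y\<close>.
  The arrow (h^-1, q(h,e)) has domain q(h,e), so the map to be shown open and onto becomes
  q.\<close>

lemma essentially_surjective_\<alpha>: "essentially_surjective G S \<alpha>"
proof -
  let ?E = "fiber_product (unit_top G) (gtop S) \<alpha> (gran S)"
  let ?s = "\<lambda>y. (snd y, (ginv H (fst y), q y))"
  have tE: "topspace ?E = {(e, z). e \<in> gunits G \<and> z \<in> topspace S.T \<and> \<alpha> e = gran S z}"
    by (auto simp: fiber_product_def[of "unit_top G"] S.gtop_S)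
  have s_gran: "gran S (ginv H (fst y), q y) = \<alpha> (snd y)" if Yy: "y \<in> topspace Y" for y
  proof -
    obtain h e where y: "y = (h, e)" by force
    have h: "h \<in> arrows H" "e \<in> gunits G" "gdom H h = \<phi> e" using Yy y by (auto simp: topspace_Y)
    have "\<theta> (ginv H h) (q (h, e)) = q (gmult H (ginv H h) h, e)"
      using Yy y h by (intro \<theta>_q) (simp_all add: H.inv_closed H.dom_inv)
    also have "\<dots> = \<iota> e" using h by (simp add: H.mult_inv_left \<iota>_def)
    finally show ?thesis using h by (simp add: y S.gran_S \<alpha>_unit p_\<iota>)
  qed
  have "continuous_map Y S.T (\<lambda>y. (ginv H (fst y), q y))"
    unfolding S.continuous_map_into_T
    using H.continuous_map_inv[OF continuous_Y_fst] continuous_q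
    by (auto simp: topspace_Y H.dom_inv p_q)
  then have s: "continuous_map Y ?E ?s"
    unfolding fiber_product_def[of "unit_top G"] continuous_map_in_subtopology continuous_map_paired
    using continuous_Y_snd s_gran by (auto simp: S.gtop_S)
  have s_surj: "\<exists>y\<in>topspace Y. ?s y = w" if "w \<in> topspace ?E" for w
  proof -
    obtain e h x where w: "w = (e, (h, x))" by (metis surj_pair)
    have a: "e \<in> gunits G" "h \<in> arrows H" "x \<in> topspace X" "gdom H h = p x" "\<phi> e = p (\<theta> h x)" "\<iota> e = \<theta> h x"
      using that w tE by (auto simp: S.topspace_T S.gran_S \<alpha>_unit)
    have hr: "gran H h = \<phi> e" using a S.anchor_act by simp
    have "x = \<theta> (ginv H h) (\<iota> e)" using S.act_inv[OF a(2,3,4)] a(6) by simp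
    also have "\<dots> = q (ginv H h, e)" using a hr by (intro \<theta>_\<iota>) (simp_all add: H.inv_closed H.dom_inv)
    finally have "x = q (ginv H h, e)" .
    moreover have "(ginv H h, e) \<in> topspace Y" using a hr by (simp add: topspace_Y H.inv_closed H.dom_inv)
    ultimately show ?thesis
      using w a(2) by (intro bexI[of _ "(ginv H h, e)"]) (simp_all add: H.inv_inv)
  qed
  \<comment> \<open>As \<open>?s\<close> is onto, each set in the fibre product is the image of its
    preimage in \<open>Y\<close>, so images under the domain map can be computed with q.\<close>
  have image: "(\<lambda>(e, h). gdom S h) ` U = (\<lambda>x. (p x, x)) ` q ` {y \<in> topspace Y. ?s y \<in> U}"
    if U: "U \<subseteq> topspace ?E" for U
  proof -
    have "U = ?s ` {y \<in> topspace Y. ?s y \<in> U}"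
    proof (intro equalityI subsetI)
      fix w assume w: "w \<in> U"
      then obtain y where "y \<in> topspace Y" "?s y = w" using s_surj U by blast
      then show "w \<in> ?s ` {y \<in> topspace Y. ?s y \<in> U}" using w by blast
    qed blast
    then have "(\<lambda>(e, h). gdom S h) ` U = (\<lambda>(e, h). gdom S h) ` ?s ` {y \<in> topspace Y. ?s y \<in> U}" by simp
    then show ?thesis by (simp add: image_image S.gdom_S)
  qed
  have "open_map ?E (unit_top S) (\<lambda>(e, h). gdom S h)"
    unfolding open_map_def
  proof (intro allI impI)
    fix U assume U: "openin ?E U"
    have "openin Y {y \<in> topspace Y. ?s y \<in> U}" using s U by (rule openin_continuous_map_preimage)
    then have "openin X (q ` {y \<in> topspace Y. ?s y \<in> U})" using open_q unfolding open_map_def by blast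
    moreover have "homeomorphic_maps (unit_top S) X snd (\<lambda>x. (p x, x))"
      using S.homeomorphic_units homeomorphic_maps_sym by blast
    ultimately have "openin (unit_top S) ((\<lambda>x. (p x, x)) ` q ` {y \<in> topspace Y. ?s y \<in> U})"
      by (rule homeomorphic_maps_openin_image[rotated])
    then show "openin (unit_top S) ((\<lambda>(e, h). gdom S h) ` U)" using image openin_subset[OF U] by simp
  qed
  moreover have "(\<lambda>(e, h). gdom S h) ` topspace ?E = gunits S"
  proof -
    have "{y \<in> topspace Y. ?s y \<in> topspace ?E} = topspace Y"
      using s unfolding continuous_map_def by blast
    then show ?thesis using image[of "topspace ?E"] by (simp add: S.gunits_S)
  qed
  ultimately show ?thesis by (simp add: essentially_surjective_def Let_def)
qed

lemma weak_equivalence_\<alpha>: "weak_equivalence G S \<alpha>"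
  unfolding weak_equivalence_def using functor_\<alpha> fully_faithful_\<alpha> essentially_surjective_\<alpha> by blast

lemma morita_equivalent_S: "morita_equivalent TYPE('g) G S"
  unfolding morita_equivalent_def
  using G.locally_compact_groupoid_axioms S.locally_compact_groupoid_semidirect
    G.weak_equivalence_id weak_equivalence_\<alpha> by blast

end

theorem theorem6p3:
  fixes G :: "'g lc_groupoid" and H :: "'h lc_groupoid" and \<phi> :: "'g \<Rightarrow> 'h"
  assumes "locally_compact_groupoid G"
    and "locally_compact_groupoid H"
    and "continuous_functor G H \<phi>"
    and "faithful G H \<phi>"
    and "closedin (pullback_top G H \<phi>) (bar_map G \<phi> ` arrows G)"
    and "open_map (fiber_product (gtop H) (gtop G) (gdom H) (\<lambda>g. \<phi> (gran G g)))
           (fiber_product (gtop H) (unit_top G) (gdom H) \<phi>)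
           (\<lambda>(h, g). (gmult H h (\<phi> g), gdom G g))"
    and "openin (fiber_product (gtop H) (unit_top G) (gdom H) \<phi>) {(\<phi> e, e) | e. e \<in> gunits G}"
  shows "\<exists>(X :: ('h \<times> 'g) set topology) p \<theta>.
           locally_compact_space X \<and> Hausdorff_space X \<and> groupoid_action H X p \<theta> \<and>
           (\<exists>\<alpha>. weak_equivalence G (semidirect H X p \<theta>) \<alpha> \<and>
                (\<forall>g\<in>arrows G. \<phi> g = fst (\<alpha> g))) \<and>
           morita_equivalent TYPE('g) G (semidirect H X p \<theta>)"
proof -
  interpret closed_faithful_functor G H \<phi>
    using assms(1-6) by (intro closed_faithful_functor.intro closed_faithful_functor_axioms.intro)
  have "\<forall>g\<in>arrows G. \<phi> g = fst (\<alpha> g)" by (simp add: \<alpha>_def)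
  then show ?thesis
    using locally_compact_X Hausdorff_X action weak_equivalence_\<alpha> morita_equivalent_S by blast
qed

end
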